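(* Let $N\ge2$ and $R>0$. (I) If $4-N<\alpha\le N-\gamma$ and $\gamma>0$, then the inequality $$\left(\frac{N+\alpha-4}{4}\gamma\right)^2\int_{B_R}\frac{|u|^2}{|x|^\alpha\left(1-\left(\frac{|x|}{R}\right)^\gamma\right)^2}\,dx\le\int_{B_R}\frac{|\Delta u|^2}{|x|^{\alpha-4}}\,dx$$ holds for all $u\in C_c^\infty(B_R)$. Especially, when $\gamma=N-\alpha$, the constant $\left(\frac{(N-\alpha)(N+\alpha-4)}{4}\right)^2$ in this inequality is optimal and is not attained by any $u\not\equiv0$ for which the right-hand side is finite. (II) If $3\le\alpha\le\min\{N-\gamma+2,\,N-3\gamma\}$ and $\gamma>0$, then the inequality $$\left(\frac34\gamma^2\right)^2\int_{B_R}\frac{|u|^2}{|x|^\alpha\left(1-\left(\frac{|x|}{R}\right)^\gamma\right)^4}\,dx\le\int_{B_R}\frac{|\Delta u|^2}{|x|^{\alpha-4}}\,dx$$ holds for all $u\in C_c^\infty(B_R)$. Furthermore, the constant $\left(\frac34\gamma^2\right)^2$ is optimal and is not attained by any $u\not\equiv0$ for which the right-hand side is finite.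
   Context: $B_R\subset\mathbb{R}^N$ is the open ball of radius $R$ centered at $0$. "Optimal" means that the constant cannot be replaced by any larger one in the inequality for all $u\in C_c^\infty(B_R)$. "Not attained" means that equality does not hold for any $u\not\equiv0$ with finite right-hand side in the class to which the inequality extends by density, namely the completion of $C_c^\infty(B_R)$ with respect to the square root of the right-hand side. *)

theory Defs
  imports "HOL-Analysis.Analysis"
begin

definition partial_deriv :: "'a \<Rightarrow> ('a::euclidean_space \<Rightarrow> real) \<Rightarrow> 'a \<Rightarrow> real"
  where "partial_deriv b f x = frechet_derivative f (at x) b"

text \<open>
  Differentiability of every iterated partial derivative makes all of them continuous, so this is
  \<open>C\<^sup>\<infinity>\<close> on the whole space.
\<close>

definition smooth :: "('a::euclidean_space \<Rightarrow> real) \<Rightarrow> bool"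
  where "smooth f \<longleftrightarrow>
    (\<forall>bs. set bs \<subseteq> Basis \<longrightarrow> foldr partial_deriv bs f differentiable_on UNIV)"

text \<open>\<open>C\<^sub>c\<^sup>\<infinity>(\<Omega>)\<close> for open \<open>\<Omega>\<close>, its members being extended by zero to the whole space.\<close>

definition test_functions :: "'a::euclidean_space set \<Rightarrow> ('a \<Rightarrow> real) set"
  where "test_functions \<Omega> =
    {u. smooth u \<and> compact (closure {x. u x \<noteq> 0}) \<and> closure {x. u x \<noteq> 0} \<subseteq> \<Omega>}"

definition laplacian :: "('a::euclidean_space \<Rightarrow> real) \<Rightarrow> 'a \<Rightarrow> real"
  where "laplacian u x = (\<Sum>b\<in>Basis. partial_deriv b (partial_deriv b u) x)"

text \<open>
  Integrals of nonnegative functions are taken in \<open>[0, \<infinity>]\<close>, so that no integrability side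
  conditions are hidden. The weights have no meaning at the origin, which is a null set.
\<close>

definition weighted_lhs ::
    "real \<Rightarrow> real \<Rightarrow> real \<Rightarrow> nat \<Rightarrow> ('a::euclidean_space \<Rightarrow> real) \<Rightarrow> ennreal"
  where "weighted_lhs R \<alpha> \<gamma> k u =
    (\<integral>\<^sup>+ x\<in>ball 0 R. ennreal (\<bar>u x\<bar>\<^sup>2 /
       (norm x powr \<alpha> * (1 - (norm x / R) powr \<gamma>) ^ k)) \<partial>lborel)"

text \<open>To be applied to \<open>h = \<Delta>u\<close>.\<close>

definition weighted_rhs :: "real \<Rightarrow> real \<Rightarrow> ('a::euclidean_space \<Rightarrow> real) \<Rightarrow> ennreal"
  where "weighted_rhs R \<alpha> h =
    (\<integral>\<^sup>+ x\<in>ball 0 R. ennreal (\<bar>h x\<bar>\<^sup>2 / norm x powr (\<alpha> - 4)) \<partial>lborel)"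

text \<open>
  The completion of \<open>C\<^sub>c\<^sup>\<infinity>(B\<^sub>R)\<close> with respect to the square root of
  \<open>weighted_rhs R \<alpha> (laplacian u)\<close>, realised by functions: \<open>u\<close> is a member, with
  (generalised) Laplacian \<open>h\<close>, if some sequence of test functions tends to \<open>u\<close> almost everywhere
  while its Laplacians tend to \<open>h\<close> in the weighted \<open>L\<^sup>2\<close> space; in particular the sequence is
  Cauchy in the norm. Conversely, whenever the norm dominates a weighted \<open>L\<^sup>2\<close> norm of \<open>u\<close>
  with a positive weight, every Cauchy sequence has a subsequence converging almost everywhere, and
  \<open>u\<close> and \<open>h\<close> determine each other up to null sets.
\<close>

definition in_completion ::
    "real \<Rightarrow> real \<Rightarrow> ('a::euclidean_space \<Rightarrow> real) \<Rightarrow> ('a \<Rightarrow> real) \<Rightarrow> bool"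
  where "in_completion R \<alpha> u h \<longleftrightarrow>
    u \<in> borel_measurable lborel \<and> h \<in> borel_measurable lborel \<and>
    (\<exists>\<phi>. (\<forall>n. \<phi> n \<in> test_functions (ball 0 R)) \<and>
         (AE x in lborel. x \<in> ball 0 R \<longrightarrow> (\<lambda>n. \<phi> n x) \<longlonglongrightarrow> u x) \<and>
         (\<lambda>n. weighted_rhs R \<alpha> (\<lambda>x. laplacian (\<phi> n) x - h x)) \<longlonglongrightarrow> 0)"

text \<open>
  In the following, the argument of type \<open>'a itself\<close> fixes the space.
\<close>

definition rellich_inequality ::
    "'a::euclidean_space itself \<Rightarrow> real \<Rightarrow> real \<Rightarrow> real \<Rightarrow> nat \<Rightarrow> real \<Rightarrow> bool"
  where "rellich_inequality _ R \<alpha> \<gamma> k C \<longleftrightarrow>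
    (\<forall>u::'a \<Rightarrow> real. u \<in> test_functions (ball 0 R) \<longrightarrow>
       ennreal C * weighted_lhs R \<alpha> \<gamma> k u \<le> weighted_rhs R \<alpha> (laplacian u))"

definition optimal_constant ::
    "'a::euclidean_space itself \<Rightarrow> real \<Rightarrow> real \<Rightarrow> real \<Rightarrow> nat \<Rightarrow> real \<Rightarrow> bool"
  where "optimal_constant T R \<alpha> \<gamma> k C \<longleftrightarrow>
    rellich_inequality T R \<alpha> \<gamma> k C \<and> (\<forall>C'>C. \<not> rellich_inequality T R \<alpha> \<gamma> k C')"

definition not_attained ::
    "'a::euclidean_space itself \<Rightarrow> real \<Rightarrow> real \<Rightarrow> real \<Rightarrow> nat \<Rightarrow> real \<Rightarrow> bool"
  where "not_attained _ R \<alpha> \<gamma> k C \<longleftrightarrow>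
    (\<forall>(u::'a \<Rightarrow> real) h. in_completion R \<alpha> u h \<longrightarrow>
       \<not> (AE x in lborel. x \<in> ball 0 R \<longrightarrow> u x = 0) \<longrightarrow>
       weighted_rhs R \<alpha> h < \<infinity> \<longrightarrow>
       ennreal C * weighted_lhs R \<alpha> \<gamma> k u \<noteq> weighted_rhs R \<alpha> h)"

end

theory Submission
  imports Defs
begin

text \<open>
  Write \<open>D = x \<bullet> \<nabla>\<close>. For radial coefficients \<open>a\<close>, \<open>b\<close>, \<open>p\<close>, the density
  \<open>\<bar>x\<bar>\<^sup>-\<^sup>\<alpha> (\<bar>x\<bar>\<^sup>2 \<Delta>u)\<^sup>2\<close> equals, up to the divergence of an explicit field of first order in \<open>u\<close>,
  \<open>\<bar>x\<bar>\<^sup>-\<^sup>\<alpha>\<close> times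
  \<open>(\<bar>x\<bar>\<^sup>2 \<Delta>u + a Du + b u)\<^sup>2 + T (\<bar>x\<bar>\<^sup>2 \<bar>\<nabla>u\<bar>\<^sup>2 - (Du)\<^sup>2) + K (Du + p u)\<^sup>2 + E u\<^sup>2\<close>,
  where \<open>T\<close>, \<open>K\<close> and \<open>E\<close> are differential polynomials in the coefficients. So every choice with
  \<open>T, K \<ge> 0\<close> yields a Rellich inequality with weight \<open>E\<close>, without expansion in spherical
  harmonics. Since \<open>\<gamma> / (1 - s\<^sup>\<gamma>)\<close> increases with \<open>\<gamma>\<close>, only the largest admissible \<open>\<gamma>\<close> has to be treated,
  and there \<open>E\<close> can be made strictly larger than the required weight. This strict gap survives the
  passage to the completion by Fatou's lemma, so that equality forces \<open>u = 0\<close>. Optimality follows by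
  testing with the virtual extremals \<open>\<bar>x\<bar>\<^sup>-\<^sup>(\<^sup>N\<^sup>-\<^sup>\<alpha>\<^sup>)\<^sup>/\<^sup>2\<close> at the origin and
  \<open>dist(x, \<partial>B\<^sub>R)\<^sup>3\<^sup>/\<^sup>2\<close> at the boundary, cut off on the logarithmic scale.
\<close>

section \<open>Divergence theorem for compactly supported fields\<close>

text \<open>The sharp constants are local. The power |x|^(-(N-\<alpha>)/2) is an eigenfunction of
  |x|^2 times the Laplacian with eigenvalue -(N-\<alpha>)(N+\<alpha>-4)/4; at distance \<delta> from
  the sphere, \<delta>^(3/2) has second derivative (3/4) \<delta>^(-1/2), while 1 - (|x|/R)^\<gamma>
  behaves like \<gamma> \<delta> / R. With these exponents both integrals diverge, but only
  logarithmically, so cutting off on the logarithmic scale costs arbitrarily little.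

  A sum of squares can give the sharp constant only if each square vanishes to leading order on the
  virtual extremal. This makes \<open>p\<close> equal to -r f'/f for a radial f with that behaviour
  and ties \<open>b\<close> to \<open>a\<close>; the remaining freedom is spent on the signs of
  \<open>T\<close> and \<open>K\<close> and on the gap.

  Integrating the identity meets two singularities. The coefficients blow up at the sphere, which
  the support of a test function avoids. The power weight is singular at the origin; a cutoff at
  radius \<epsilon> costs a term of order \<epsilon>^(N-\<alpha>), which vanishes in the limit
  because \<gamma> > 0 forces \<alpha> < N.\<close>

lemma integral_lborel_shift:
  fixes F :: "'a::euclidean_space \<Rightarrow> real"
  assumes "integrable lborel F"
  shows "integrable lborel (\<lambda>x. F (x + c))" "(\<integral>x. F (x + c) \<partial>lborel) = (\<integral>x. F x \<partial>lborel)"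
proof -
  have m: "F \<in> borel_measurable borel" using assms by (simp add: borel_measurable_integrable)
  have d: "distr lborel borel (\<lambda>x. c + x) = (lborel :: 'a measure)" by (rule lborel_distr_plus)
  have "integrable (distr lborel borel (\<lambda>x. c + x)) F" using assms d by simp
  then show "integrable lborel (\<lambda>x. F (x + c))"
    by (subst (asm) integrable_distr_eq) (auto simp: m add.commute)
  have "(\<integral>x. F x \<partial>lborel) = (\<integral>x. F x \<partial>distr lborel borel (\<lambda>x. c + x))" using d by simp
  also have "\<dots> = (\<integral>x. F (c + x) \<partial>lborel)" by (subst integral_distr) (auto simp: m)
  finally show "(\<integral>x. F (x + c) \<partial>lborel) = (\<integral>x. F x \<partial>lborel)" by (simp add: add.commute)
qed

lemma integrable_continuous_compact_support:
  fixes F :: "'a::euclidean_space \<Rightarrow> real"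
  assumes "continuous_on UNIV F" "\<And>x. norm x > R \<Longrightarrow> F x = 0"
  shows "integrable lborel F"
proof -
  have "integrable lborel (\<lambda>x. indicator (cball 0 R) x *\<^sub>R F x)"
    by (rule borel_integrable_compact) (use assms in \<open>auto intro: continuous_on_subset\<close>)
  moreover have "(\<lambda>x. indicator (cball 0 R) x *\<^sub>R F x) = F"
    using assms(2) by (force simp: indicator_def)
  ultimately show ?thesis by simp
qed

lemma has_derivative_along_line:
  fixes F :: "'a::real_normed_vector \<Rightarrow> real"
  assumes "(F has_derivative F' (x + t *\<^sub>R b)) (at (x + t *\<^sub>R b))"
  shows "((\<lambda>t. F (x + t *\<^sub>R b)) has_real_derivative F' (x + t *\<^sub>R b) b) (at t)"
proof -
  have "((\<lambda>t. x + t *\<^sub>R b) has_derivative (\<lambda>h. h *\<^sub>R b)) (at t)"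
    by (auto intro!: derivative_eq_intros)
  from has_derivative_compose[OF this assms]
  have "((\<lambda>t. F (x + t *\<^sub>R b)) has_derivative (\<lambda>h. F' (x + t *\<^sub>R b) (h *\<^sub>R b))) (at t)" .
  moreover have "F' (x + t *\<^sub>R b) (h *\<^sub>R b) = h * F' (x + t *\<^sub>R b) b" for h
    using linear_scale[OF has_derivative_linear[OF assms]] by simp
  ultimately show ?thesis
    by (simp add: has_field_derivative_def mult.commute[of _ "F' _ _"])
qed

text \<open>Difference quotients along \<open>b\<close> have integral zero because Lebesgue measure
  is translation invariant. The mean value theorem bounds them by a constant on a fixed ball, so
  dominated convergence passes to the derivative.\<close>

lemma integral_directional_derivative_zero:
  fixes F :: "'a::euclidean_space \<Rightarrow> real"
  assumes der: "\<And>x. (F has_derivative F' x) (at x)"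
    and cont: "continuous_on UNIV (\<lambda>x. F' x b)"
    and zero: "\<And>x. norm x > R \<Longrightarrow> F x = 0"
  shows "integrable lborel (\<lambda>x. F' x b)" "(\<integral>x. F' x b \<partial>lborel) = 0"
proof -
  have zero': "F' x b = 0" if "norm x > R" for x
  proof -
    have "((\<lambda>_. 0 :: real) has_derivative F' x) (at x)"
    proof (rule has_derivative_transform_within_open[OF der])
      show "open {x::'a. norm x > R}" by (intro open_Collect_less continuous_intros)
      show "x \<in> {x. norm x > R}" using that by simp
    qed (use zero in auto)
    then have "F' x = (\<lambda>h. 0)" by (rule has_derivative_unique[OF _ has_derivative_const])
    then show ?thesis by simp
  qed
  show int': "integrable lborel (\<lambda>x. F' x b)"
    by (rule integrable_continuous_compact_support[OF cont zero'])
  have contF: "continuous_on UNIV F"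
    using der by (meson continuous_at_imp_continuous_on has_derivative_continuous)
  have intF: "integrable lborel F"
    by (rule integrable_continuous_compact_support[OF contF zero])
  have "compact ((\<lambda>x. F' x b) ` cball 0 R)"
    by (intro compact_continuous_image continuous_on_subset[OF cont]) auto
  then have "bounded ((\<lambda>x. F' x b) ` cball 0 R)" by (rule compact_imp_bounded)
  then obtain B0 where B0: "\<And>x. norm x \<le> R \<Longrightarrow> \<bar>F' x b\<bar> \<le> B0"
    unfolding bounded_iff by (metis image_eqI mem_cball_0 real_norm_def)
  define B where "B = max B0 0"
  have B: "\<bar>F' x b\<bar> \<le> B" for x
    using B0[of x] zero'[of x] by (cases "norm x \<le> R") (auto simp: B_def)
  define s where "s k x = real (Suc k) * (F (x + (1 / real (Suc k)) *\<^sub>R b) - F x)" for k x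
  have line: "((\<lambda>t. F (x + t *\<^sub>R b)) has_real_derivative F' (x + t *\<^sub>R b) b) (at t)" for x t
    by (rule has_derivative_along_line[where F' = F', OF der])
  have lim: "(\<lambda>k. s k x) \<longlonglongrightarrow> F' x b" for x
  proof -
    have "((\<lambda>h. (F (x + (0 + h) *\<^sub>R b) - F (x + 0 *\<^sub>R b)) / h) \<longlongrightarrow> F' x b) (at 0)"
      using line[of x 0] by (simp add: DERIV_def)
    moreover have "filterlim (\<lambda>k. 1 / real (Suc k)) (at 0) sequentially"
      unfolding filterlim_at using LIMSEQ_inverse_real_of_nat by (auto simp: inverse_eq_divide)
    ultimately have "(\<lambda>k. (F (x + (0 + 1 / real (Suc k)) *\<^sub>R b) - F (x + 0 *\<^sub>R b)) / (1 / real (Suc k)))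
        \<longlonglongrightarrow> F' x b" by (rule filterlim_compose)
    then show ?thesis unfolding s_def by (simp add: mult.commute)
  qed
  have bound: "\<bar>s k x\<bar> \<le> B * indicator (cball 0 (\<bar>R\<bar> + norm b)) x" for k x
  proof -
    let ?d = "1 / real (Suc k)"
    obtain z where z: "F (x + ?d *\<^sub>R b) - F (x + 0 *\<^sub>R b) = (?d - 0) * F' (x + z *\<^sub>R b) b"
      using MVT2[of 0 ?d "\<lambda>t. F (x + t *\<^sub>R b)" "\<lambda>t. F' (x + t *\<^sub>R b) b"] line by auto
    have "s k x = F' (x + z *\<^sub>R b) b" unfolding s_def using z by simp
    then have 1: "\<bar>s k x\<bar> \<le> B" using B by simp
    show ?thesis
    proof (cases "norm x \<le> \<bar>R\<bar> + norm b")
      case True then show ?thesis using 1 by simp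
    next
      case False
      have "norm (?d *\<^sub>R b) \<le> norm b"
        using mult_right_mono[of ?d 1 "norm b"] by simp
      then have "norm (x + ?d *\<^sub>R b) > R" using False norm_diff_ineq[of x "?d *\<^sub>R b"] by linarith
      moreover have "norm x > R" using False norm_ge_zero[of b] by linarith
      ultimately have "s k x = 0" unfolding s_def by (simp add: zero)
      then show ?thesis using False by simp
    qed
  qed
  have intB: "integrable lborel (\<lambda>x::'a. B * indicator (cball 0 (\<bar>R\<bar> + norm b)) x)"
    by (intro integrable_mult_right integrable_real_indicator) (use emeasure_bounded_finite[OF bounded_cball] in auto)
  have "(\<lambda>k. \<integral>x. s k x \<partial>lborel) \<longlonglongrightarrow> (\<integral>x. F' x b \<partial>lborel)"
  proof (rule integral_dominated_convergence[OF _ _ intB])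
    show "(\<lambda>x. F' x b) \<in> borel_measurable lborel" using int' by simp
    show "s k \<in> borel_measurable lborel" for k
    proof -
      have "integrable lborel (s k)" unfolding s_def
        by (intro integrable_mult_right Bochner_Integration.integrable_diff integral_lborel_shift intF)
      then show ?thesis by simp
    qed
  qed (use lim bound in auto)
  moreover have "(\<integral>x. s k x \<partial>lborel) = 0" for k
    unfolding s_def using integral_lborel_shift[OF intF] intF by simp
  ultimately show "(\<integral>x. F' x b \<partial>lborel) = 0"
    by (simp add: LIMSEQ_const_iff)
qed

lemma integral_divergence_zero:
  fixes V :: "'a::euclidean_space \<Rightarrow> 'a"
  assumes der: "\<And>x. (V has_derivative V' x) (at x)"
    and cont: "\<And>b. b \<in> Basis \<Longrightarrow> continuous_on UNIV (\<lambda>x. V' x b)"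
    and zero: "\<And>x. norm x > R \<Longrightarrow> V x = 0"
  shows "integrable lborel (\<lambda>x. \<Sum>b\<in>Basis. V' x b \<bullet> b)"
    "(\<integral>x. (\<Sum>b\<in>Basis. V' x b \<bullet> b) \<partial>lborel) = 0"
proof -
  have *: "integrable lborel (\<lambda>x. V' x b \<bullet> b) \<and> (\<integral>x. V' x b \<bullet> b \<partial>lborel) = 0" if "b \<in> Basis" for b
  proof -
    have 1: "((\<lambda>x. V x \<bullet> b) has_derivative (\<lambda>h. V' x h \<bullet> b)) (at x)" for x
      by (rule has_derivative_inner_left[OF der])
    have 2: "continuous_on UNIV (\<lambda>x. V' x b \<bullet> b)"
      by (rule continuous_on_inner[OF cont[OF that] continuous_on_const])
    show ?thesis
      using integral_directional_derivative_zero[of "\<lambda>x. V x \<bullet> b", OF 1 2, of R] zero by simp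
  qed
  then show "integrable lborel (\<lambda>x. \<Sum>b\<in>Basis. V' x b \<bullet> b)" by auto
  show "(\<integral>x. (\<Sum>b\<in>Basis. V' x b \<bullet> b) \<partial>lborel) = 0"
    using * by (subst Bochner_Integration.integral_sum) auto
qed

text \<open>\<open>J\<close> will be a divergence and \<open>e\<close> the cutoff error. The
  integrals of \<open>f\<close> and \<open>g\<close> may be infinite, so nothing is subtracted from
  them: the positive and negative parts of \<open>J\<close>, which have the same finite integral,
  are put on opposite sides and cancelled.\<close>

lemma nn_integral_le_modulo_zero_integral:
  fixes f g e J :: "'a \<Rightarrow> real"
  assumes [measurable]: "f \<in> borel_measurable M" "g \<in> borel_measurable M" "e \<in> borel_measurable M"
    and J: "integrable M J" "(\<integral>x. J x \<partial>M) = 0"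
    and nonneg: "\<And>x. f x \<ge> 0" "\<And>x. g x \<ge> 0" "\<And>x. e x \<ge> 0"
    and le: "AE x in M. f x \<le> g x + J x + e x"
  shows "(\<integral>\<^sup>+x. ennreal (f x) \<partial>M) \<le> (\<integral>\<^sup>+x. ennreal (g x) \<partial>M) + (\<integral>\<^sup>+x. ennreal (e x) \<partial>M)"
proof -
  have [measurable]: "J \<in> borel_measurable M" using J by simp
  let ?p = "\<integral>\<^sup>+x. ennreal (J x) \<partial>M" and ?n = "\<integral>\<^sup>+x. ennreal (- J x) \<partial>M"
  have fin: "?p < \<infinity>" "?n < \<infinity>"
    using J(1) by (auto simp: real_integrable_def top.not_eq_extremum)
  have "enn2real ?p = enn2real ?n"
    using J real_lebesgue_integral_def[OF J(1)] by simp
  then have eq: "?p = ?n" using fin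
    by (metis ennreal_enn2real infinity_ennreal_def)
  have "(\<integral>\<^sup>+x. ennreal (f x) \<partial>M) + ?n = (\<integral>\<^sup>+x. ennreal (f x) + ennreal (- J x) \<partial>M)"
    by (subst nn_integral_add) auto
  also have "\<dots> \<le> (\<integral>\<^sup>+x. ennreal (g x) + ennreal (J x) + ennreal (e x) \<partial>M)"
  proof (rule nn_integral_mono_AE, use le in eventually_elim)
    fix x assume "f x \<le> g x + J x + e x"
    then have 1: "f x + max 0 (- J x) \<le> g x + max 0 (J x) + e x" by (auto simp: max_def)
    have m: "ennreal (J x) = ennreal (max 0 (J x))" "ennreal (- J x) = ennreal (max 0 (- J x))"
      by (auto simp: max_def ennreal_neg)
    have "ennreal (f x) + ennreal (- J x) = ennreal (f x + max 0 (- J x))"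
      unfolding m(2) by (rule ennreal_plus[symmetric]) (use nonneg in auto)
    also have "\<dots> \<le> ennreal (g x + max 0 (J x) + e x)" using 1 by (rule ennreal_leI)
    also have "\<dots> = ennreal (g x + max 0 (J x)) + ennreal (e x)"
      by (rule ennreal_plus) (use nonneg in auto)
    also have "ennreal (g x + max 0 (J x)) = ennreal (g x) + ennreal (J x)"
      unfolding m(1) by (rule ennreal_plus) (use nonneg in auto)
    finally show "ennreal (f x) + ennreal (- J x) \<le> ennreal (g x) + ennreal (J x) + ennreal (e x)" .
  qed
  also have "\<dots> = (\<integral>\<^sup>+x. ennreal (g x) \<partial>M) + ?p + (\<integral>\<^sup>+x. ennreal (e x) \<partial>M)"
    by (simp add: nn_integral_add)
  finally have "(\<integral>\<^sup>+x. ennreal (f x) \<partial>M) + ?n \<le>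
      ((\<integral>\<^sup>+x. ennreal (g x) \<partial>M) + (\<integral>\<^sup>+x. ennreal (e x) \<partial>M)) + ?n"
    using eq by (simp add: ac_simps)
  then have "?n + (\<integral>\<^sup>+x. ennreal (f x) \<partial>M) \<le>
      ?n + ((\<integral>\<^sup>+x. ennreal (g x) \<partial>M) + (\<integral>\<^sup>+x. ennreal (e x) \<partial>M))"
    by (simp add: add.commute)
  then show ?thesis using fin(2) by (auto simp: ennreal_add_left_cancel_le)
qed

section \<open>Second-order calculus of smooth functions\<close>

lemma second_difference_mean_value:
  fixes F :: "'a::real_normed_vector \<Rightarrow> real"
  assumes 1: "\<And>x. (F has_derivative F' x) (at x)"
    and 2: "\<And>x. ((\<lambda>x. F' x b) has_derivative Fb' x) (at x)"
    and e: "e > 0"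
  shows "\<exists>s t. 0 < s \<and> s < e \<and> 0 < t \<and> t < e \<and>
    F (x + e *\<^sub>R b + e *\<^sub>R c) - F (x + e *\<^sub>R b) - F (x + e *\<^sub>R c) + F x =
      e * e * Fb' (x + s *\<^sub>R b + t *\<^sub>R c) c"
proof -
  have d: "((\<lambda>s. F (y + s *\<^sub>R b)) has_real_derivative F' (y + s *\<^sub>R b) b) (at s)" for y s
    by (rule has_derivative_along_line[where F' = F', OF 1])
  have d': "((\<lambda>s. F (x + e *\<^sub>R c + s *\<^sub>R b) - F (x + s *\<^sub>R b)) has_real_derivative
      F' (x + e *\<^sub>R c + s *\<^sub>R b) b - F' (x + s *\<^sub>R b) b) (at s)" for s
    by (intro DERIV_diff d)
  obtain s where s: "0 < s" "s < e"
    "(F (x + e *\<^sub>R c + e *\<^sub>R b) - F (x + e *\<^sub>R b)) - (F (x + e *\<^sub>R c + 0 *\<^sub>R b) - F (x + 0 *\<^sub>R b))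
      = (e - 0) * (F' (x + e *\<^sub>R c + s *\<^sub>R b) b - F' (x + s *\<^sub>R b) b)"
    using MVT2[OF e d'] by blast
  have d2: "((\<lambda>t. F' ((x + s *\<^sub>R b) + t *\<^sub>R c) b) has_real_derivative
      Fb' ((x + s *\<^sub>R b) + t *\<^sub>R c) c) (at t)" for t
    by (rule has_derivative_along_line[where F = "\<lambda>x. F' x b" and F' = Fb', OF 2])
  obtain t where t: "0 < t" "t < e"
    "F' ((x + s *\<^sub>R b) + e *\<^sub>R c) b - F' ((x + s *\<^sub>R b) + 0 *\<^sub>R c) b
      = (e - 0) * Fb' ((x + s *\<^sub>R b) + t *\<^sub>R c) c"
    using MVT2[OF e d2] by blast
  have "F (x + e *\<^sub>R b + e *\<^sub>R c) - F (x + e *\<^sub>R b) - F (x + e *\<^sub>R c) + F x =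
      e * (F' (x + e *\<^sub>R c + s *\<^sub>R b) b - F' (x + s *\<^sub>R b) b)"
    using s(3) by (simp add: algebra_simps)
  also have "\<dots> = e * e * Fb' (x + s *\<^sub>R b + t *\<^sub>R c) c"
    using t(3) by (simp add: algebra_simps)
  finally show ?thesis using s t by blast
qed

text \<open>The second difference over a small parallelogram is symmetric in \<open>b\<close> and
  \<open>c\<close>. The mean value theorem, applied twice in either order, equates it with either
  mixed derivative at points tending to \<open>x\<close>, and continuity of both gives the
  claim.\<close>

lemma symmetric_second_derivative:
  fixes F :: "'a::real_normed_vector \<Rightarrow> real"
  assumes 1: "\<And>x. (F has_derivative F' x) (at x)"
    and b: "\<And>x. ((\<lambda>x. F' x b) has_derivative Fb' x) (at x)"
    and c: "\<And>x. ((\<lambda>x. F' x c) has_derivative Fc' x) (at x)"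
    and contb: "continuous_on UNIV (\<lambda>x. Fb' x c)"
    and contc: "continuous_on UNIV (\<lambda>x. Fc' x b)"
  shows "Fb' x c = Fc' x b"
proof -
  define e where "e k = 1 / real (Suc k)" for k
  have e: "e k > 0" for k by (simp add: e_def)
  have elim: "e \<longlonglongrightarrow> 0"
    unfolding e_def using LIMSEQ_inverse_real_of_nat by (simp add: inverse_eq_divide)
  have "\<forall>k. \<exists>s t. 0 < s \<and> s < e k \<and> 0 < t \<and> t < e k \<and>
    F (x + e k *\<^sub>R b + e k *\<^sub>R c) - F (x + e k *\<^sub>R b) - F (x + e k *\<^sub>R c) + F x =
      e k * e k * Fb' (x + s *\<^sub>R b + t *\<^sub>R c) c"
    using second_difference_mean_value[OF 1 b e] by blast
  then obtain s t where st: "\<And>k. 0 < s k \<and> s k < e k" "\<And>k. 0 < t k \<and> t k < e k"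
    "\<And>k. F (x + e k *\<^sub>R b + e k *\<^sub>R c) - F (x + e k *\<^sub>R b) - F (x + e k *\<^sub>R c) + F x =
      e k * e k * Fb' (x + s k *\<^sub>R b + t k *\<^sub>R c) c" by metis
  have "\<forall>k. \<exists>s t. 0 < s \<and> s < e k \<and> 0 < t \<and> t < e k \<and>
    F (x + e k *\<^sub>R c + e k *\<^sub>R b) - F (x + e k *\<^sub>R c) - F (x + e k *\<^sub>R b) + F x =
      e k * e k * Fc' (x + s *\<^sub>R c + t *\<^sub>R b) b"
    using second_difference_mean_value[OF 1 c e] by blast
  then obtain s' t' where st': "\<And>k. 0 < s' k \<and> s' k < e k" "\<And>k. 0 < t' k \<and> t' k < e k"
    "\<And>k. F (x + e k *\<^sub>R c + e k *\<^sub>R b) - F (x + e k *\<^sub>R c) - F (x + e k *\<^sub>R b) + F x =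
      e k * e k * Fc' (x + s' k *\<^sub>R c + t' k *\<^sub>R b) b" by metis
  have eq: "Fb' (x + s k *\<^sub>R b + t k *\<^sub>R c) c = Fc' (x + s' k *\<^sub>R c + t' k *\<^sub>R b) b" for k
  proof -
    have "e k * e k * Fb' (x + s k *\<^sub>R b + t k *\<^sub>R c) c = e k * e k * Fc' (x + s' k *\<^sub>R c + t' k *\<^sub>R b) b"
      unfolding st(3)[symmetric] st'(3)[symmetric] by (simp add: algebra_simps)
    then show ?thesis using e[of k] by simp
  qed
  have squeeze: "r \<longlonglongrightarrow> 0" if "\<And>k. 0 < r k \<and> r k < e k" for r
    by (rule tendsto_sandwich[OF _ _ tendsto_const elim])
      (use that less_imp_le in \<open>auto intro!: always_eventually\<close>)
  have lims: "s \<longlonglongrightarrow> 0" "t \<longlonglongrightarrow> 0" "s' \<longlonglongrightarrow> 0" "t' \<longlonglongrightarrow> 0"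
    using squeeze st(1,2) st'(1,2) by auto
  have "(\<lambda>k. x + s k *\<^sub>R b + t k *\<^sub>R c) \<longlonglongrightarrow> x + 0 *\<^sub>R b + 0 *\<^sub>R c"
    by (intro tendsto_intros lims)
  then have "(\<lambda>k. Fb' (x + s k *\<^sub>R b + t k *\<^sub>R c) c) \<longlonglongrightarrow> Fb' x c"
    using continuous_on_tendsto_compose[OF contb] by simp
  moreover have "(\<lambda>k. x + s' k *\<^sub>R c + t' k *\<^sub>R b) \<longlonglongrightarrow> x + 0 *\<^sub>R c + 0 *\<^sub>R b"
    by (intro tendsto_intros lims)
  then have "(\<lambda>k. Fc' (x + s' k *\<^sub>R c + t' k *\<^sub>R b) b) \<longlonglongrightarrow> Fc' x b"
    using continuous_on_tendsto_compose[OF contc] by simp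
  ultimately show ?thesis unfolding eq by (rule LIMSEQ_unique)
qed

definition grad :: "('a::euclidean_space \<Rightarrow> real) \<Rightarrow> 'a \<Rightarrow> 'a"
  where "grad u x = (\<Sum>b\<in>Basis. partial_deriv b u x *\<^sub>R b)"

definition hess :: "('a::euclidean_space \<Rightarrow> real) \<Rightarrow> 'a \<Rightarrow> 'a \<Rightarrow> 'a"
  where "hess u x h = (\<Sum>b\<in>Basis. frechet_derivative (partial_deriv b u) (at x) h *\<^sub>R b)"

lemma differentiable_has_frechet:
  "f differentiable_on UNIV \<Longrightarrow> (f has_derivative frechet_derivative f (at x)) (at x)"
  by (simp add: differentiable_on_def frechet_derivative_works[symmetric])

context
  fixes u :: "'a::euclidean_space \<Rightarrow> real"
  assumes smooth: "smooth u"
begin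

lemma smooth_differentiable:
  shows "u differentiable_on UNIV"
    and "b \<in> Basis \<Longrightarrow> partial_deriv b u differentiable_on UNIV"
    and "b \<in> Basis \<Longrightarrow> c \<in> Basis \<Longrightarrow> partial_deriv c (partial_deriv b u) differentiable_on UNIV"
proof -
  have "foldr partial_deriv bs u differentiable_on UNIV" if "set bs \<subseteq> Basis" for bs
    using smooth that unfolding smooth_def by blast
  from this[of "[]"] this[of "[b]"] this[of "[c, b]"]
  show "u differentiable_on UNIV"
    "b \<in> Basis \<Longrightarrow> partial_deriv b u differentiable_on UNIV"
    "b \<in> Basis \<Longrightarrow> c \<in> Basis \<Longrightarrow> partial_deriv c (partial_deriv b u) differentiable_on UNIV"
    by auto
qed

lemma frechet_eq_grad: "frechet_derivative u (at x) h = grad u x \<bullet> h"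
proof -
  interpret linear "frechet_derivative u (at x)"
    using differentiable_has_frechet[OF smooth_differentiable(1)] by (rule has_derivative_linear)
  have "frechet_derivative u (at x) h = frechet_derivative u (at x) (\<Sum>b\<in>Basis. (h \<bullet> b) *\<^sub>R b)"
    by (simp add: euclidean_representation)
  also have "\<dots> = (\<Sum>b\<in>Basis. (h \<bullet> b) * partial_deriv b u x)"
    by (simp add: sum scale partial_deriv_def)
  also have "\<dots> = grad u x \<bullet> h"
    by (simp add: grad_def inner_sum_left inner_commute[of h] mult.commute)
  finally show ?thesis .
qed

lemma has_derivative_grad: "(u has_derivative (\<lambda>h. grad u x \<bullet> h)) (at x)"
  using differentiable_has_frechet[OF smooth_differentiable(1), of x]
  unfolding frechet_eq_grad[abs_def] .

lemma grad_has_derivative_hess: "(grad u has_derivative hess u x) (at x)"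
  unfolding grad_def hess_def
  by (intro has_derivative_sum has_derivative_scaleR_left differentiable_has_frechet
      smooth_differentiable(2))

text \<open>Second partial derivatives are differentiable by \<open>smooth\<close>, hence
  continuous; continuity of the Hessian and of the Laplacian rests on this representation.\<close>

lemma hess_eq: "hess u x h = (\<Sum>b\<in>Basis. (\<Sum>c\<in>Basis. (h \<bullet> c) * partial_deriv c (partial_deriv b u) x) *\<^sub>R b)"
proof -
  have "frechet_derivative (partial_deriv b u) (at x) h =
      (\<Sum>c\<in>Basis. (h \<bullet> c) * partial_deriv c (partial_deriv b u) x)" if b: "b \<in> Basis" for b
  proof -
    interpret linear "frechet_derivative (partial_deriv b u) (at x)"
      using differentiable_has_frechet[OF smooth_differentiable(2)[OF b]] by (rule has_derivative_linear)
    have "frechet_derivative (partial_deriv b u) (at x) h =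
        frechet_derivative (partial_deriv b u) (at x) (\<Sum>b\<in>Basis. (h \<bullet> b) *\<^sub>R b)"
      by (simp add: euclidean_representation)
    also have "\<dots> = (\<Sum>c\<in>Basis. (h \<bullet> c) * partial_deriv c (partial_deriv b u) x)"
      by (simp add: sum scale partial_deriv_def)
    finally show ?thesis .
  qed
  then show ?thesis unfolding hess_def by simp
qed

lemma continuous_on_u: "continuous_on UNIV u"
  and continuous_on_grad: "continuous_on UNIV (grad u)"
  and continuous_on_hess: "continuous_on UNIV (\<lambda>x. hess u x h)"
  unfolding hess_eq grad_def[abs_def]
  by (intro continuous_intros differentiable_imp_continuous_on[OF smooth_differentiable(1)]
      differentiable_imp_continuous_on[OF smooth_differentiable(2)]
      differentiable_imp_continuous_on[OF smooth_differentiable(3)]; assumption)+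

lemma laplacian_eq_hess: "laplacian u x = (\<Sum>b\<in>Basis. hess u x b \<bullet> b)"
  unfolding laplacian_def hess_def partial_deriv_def[of _ "partial_deriv _ u"]
  by (simp add: inner_sum_left inner_Basis if_distrib[of "\<lambda>x. _ * x"] cong: if_cong)

lemma continuous_on_laplacian: "continuous_on UNIV (laplacian u)"
  unfolding laplacian_eq_hess[abs_def] by (intro continuous_intros continuous_on_hess)

lemma hess_symmetric: "hess u x h \<bullet> k = hess u x k \<bullet> h"
proof (rule symmetric_second_derivative[where F = u and F' = "\<lambda>x h. grad u x \<bullet> h" and b = k and c = h
      and Fb' = "\<lambda>x h. hess u x h \<bullet> k" and Fc' = "\<lambda>x k. hess u x k \<bullet> h"])
  show "(u has_derivative (\<lambda>h. grad u x \<bullet> h)) (at x)" for x by (rule has_derivative_grad)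
  show "((\<lambda>x. grad u x \<bullet> h) has_derivative (\<lambda>k. hess u x k \<bullet> h)) (at x)"
    "((\<lambda>x. grad u x \<bullet> k) has_derivative (\<lambda>h. hess u x h \<bullet> k)) (at x)" for x
    by (rule has_derivative_inner_left[OF grad_has_derivative_hess])+
qed (intro continuous_intros continuous_on_hess)+

end

text \<open>A compact subset of the open ball keeps a positive distance from the sphere, so
  coefficients that blow up at the sphere are bounded wherever \<open>u\<close> or its derivatives
  are nonzero.\<close>

lemma test_function_support:
  fixes u :: "'a::euclidean_space \<Rightarrow> real"
  assumes u: "u \<in> test_functions (ball 0 R)" and R: "R > 0"
  obtains \<rho> where "0 < \<rho>" "\<rho> < R"
    "\<And>x. norm x > \<rho> \<Longrightarrow> u x = 0" "\<And>x. norm x > \<rho> \<Longrightarrow> grad u x = 0"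
    "\<And>x h. norm x > \<rho> \<Longrightarrow> hess u x h = 0"
proof -
  let ?K = "closure {x. u x \<noteq> 0}"
  have sm: "smooth u" and K: "compact ?K" "?K \<subseteq> ball 0 R"
    using u by (auto simp: test_functions_def)
  have "\<exists>\<rho>0<R. \<forall>x\<in>?K. norm x \<le> \<rho>0"
  proof (cases "?K = {}")
    case True then show ?thesis using R by (intro exI[of _ 0]) (auto simp del: closure_eq_empty)
  next
    case False
    obtain z where "z \<in> ?K" "\<forall>x\<in>?K. norm x \<le> norm z"
      using continuous_attains_sup[OF K(1) False continuous_on_norm_id] by auto
    moreover have "norm z < R" using \<open>z \<in> ?K\<close> K(2) by auto
    ultimately show ?thesis by blast
  qed
  then obtain \<rho>0 where \<rho>0: "\<rho>0 < R" "\<And>x. x \<in> ?K \<Longrightarrow> norm x \<le> \<rho>0" by blast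
  \<comment> \<open>The lower bound \<open>R / 2\<close> keeps \<rho> positive when the support is
    empty.\<close>
  define \<rho> where "\<rho> = max \<rho>0 (R / 2)"
  let ?S = "{x::'a. norm x > \<rho>}"
  have op: "open ?S" by (intro open_Collect_less continuous_intros)
  have 1: "u x = 0" if "norm x > \<rho>" for x
    using that \<rho>0(2)[of x] closure_subset[of "{x. u x \<noteq> 0}"] by (auto simp: \<rho>_def)
  have 2: "grad u x = 0" if x: "norm x > \<rho>" for x
  proof -
    have "((\<lambda>_. 0 :: real) has_derivative (\<lambda>h. grad u x \<bullet> h)) (at x)"
      by (rule has_derivative_transform_within_open[OF has_derivative_grad[OF sm] op])
        (use x 1 in auto)
    then have "(\<lambda>h. grad u x \<bullet> h) = (\<lambda>h. 0)"
      by (rule has_derivative_unique[OF _ has_derivative_const])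
    then have "grad u x \<bullet> grad u x = 0" by metis
    then show ?thesis by simp
  qed
  have 3: "hess u x h = 0" if x: "norm x > \<rho>" for x h
  proof -
    have "((\<lambda>_. 0 :: 'a) has_derivative hess u x) (at x)"
      by (rule has_derivative_transform_within_open[OF grad_has_derivative_hess[OF sm] op])
        (use x 2 in auto)
    then have "hess u x = (\<lambda>h. 0)"
      by (rule has_derivative_unique[OF _ has_derivative_const])
    then show ?thesis by simp
  qed
  show thesis by (rule that[of \<rho>]) (use 1 2 3 R \<rho>0(1) in \<open>auto simp: \<rho>_def\<close>)
qed

text \<open>The quartic 1 - (1 - s^2)^2 on [0,1], continued by 0 and 1; its slope vanishes at both
  ends. One continuous derivative suffices, because the field multiplied by the cutoff is
  differentiated only once.\<close>

definition smoothstep :: "real \<Rightarrow> real"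
  where "smoothstep s = 1 - (max 0 (1 - (max 0 s)\<^sup>2))\<^sup>2"

definition smoothstep' :: "real \<Rightarrow> real"
  where "smoothstep' s = 4 * max 0 s * max 0 (1 - (max 0 s)\<^sup>2)"

lemma has_derivative_max_sq: "((\<lambda>s::real. (max 0 s)\<^sup>2) has_real_derivative 2 * max 0 s) (at s)"
proof -
  consider "s < 0" | "s = 0" | "s > 0" by linarith
  then show ?thesis
  proof cases
    case 1
    have "((\<lambda>s::real. (max 0 s)\<^sup>2) has_real_derivative 0) (at s)"
      by (rule has_field_derivative_transform_within_open[of "\<lambda>_. 0" _ _ "{..<0}"])
        (use 1 in \<open>auto simp: max_def\<close>)
    then show ?thesis using 1 by simp
  next
    case 3
    have "((\<lambda>s::real. (max 0 s)\<^sup>2) has_real_derivative 2 * s) (at s)"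
      by (rule has_field_derivative_transform_within_open[of "\<lambda>s. s\<^sup>2" _ _ "{0<..}"])
        (use 3 in \<open>auto intro!: derivative_eq_intros simp: max_def\<close>)
    then show ?thesis using 3 by simp
  next
    case 2
    have "((\<lambda>h::real. (max 0 (0 + h))\<^sup>2 / h) \<longlongrightarrow> 0) (at 0)"
    proof (rule Lim_null_comparison)
      show "\<forall>\<^sub>F h::real in at 0. norm ((max 0 (0 + h))\<^sup>2 / h) \<le> \<bar>h\<bar>"
        by (rule always_eventually) (auto simp: max_def power2_eq_square)
      show "((\<lambda>h::real. \<bar>h\<bar>) \<longlongrightarrow> 0) (at 0)"
        using tendsto_rabs_zero[OF tendsto_ident_at[of "0::real" UNIV]] by simp
    qed
    then show ?thesis using 2 by (simp add: DERIV_def)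
  qed
qed

lemma has_derivative_smoothstep: "(smoothstep has_real_derivative smoothstep' s) (at s)"
  unfolding smoothstep_def[abs_def] smoothstep'_def
  by (rule derivative_eq_intros DERIV_chain'[OF _ has_derivative_max_sq] has_derivative_max_sq refl)+
    (simp add: algebra_simps)

lemma continuous_on_smoothstep':
  "continuous_on A f \<Longrightarrow> continuous_on A (\<lambda>x. smoothstep' (f x))"
  unfolding smoothstep'_def by (intro continuous_intros)

lemma smoothstep_bounds: "0 \<le> smoothstep s" "smoothstep s \<le> 1" "\<bar>smoothstep' s\<bar> \<le> 4"
proof -
  have "(max 0 (1 - (max 0 s)\<^sup>2))\<^sup>2 \<le> 1\<^sup>2" by (rule power_mono) auto
  then show "0 \<le> smoothstep s" "smoothstep s \<le> 1" by (auto simp: smoothstep_def)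
  show "\<bar>smoothstep' s\<bar> \<le> 4"
  proof (cases "\<bar>s\<bar> \<le> 1")
    case True
    then have "max 0 s * max 0 (1 - (max 0 s)\<^sup>2) \<le> 1 * 1" by (intro mult_mono) auto
    then show ?thesis by (simp add: smoothstep'_def abs_mult)
  next
    case False
    then have "s < 0 \<or> (s > 1 \<and> s\<^sup>2 > 1)" by (auto simp: abs_square_less_1 abs_le_square_iff power2_eq_square not_le) (metis False abs_square_le_1 not_le power2_eq_square)
    then show ?thesis by (auto simp: smoothstep'_def max_def)
  qed
qed

lemma smoothstep_le_0: "s \<le> 0 \<Longrightarrow> smoothstep s = 0" "s \<le> 0 \<Longrightarrow> smoothstep' s = 0"
  by (auto simp: smoothstep_def smoothstep'_def max_def)

lemma smoothstep_ge_1: "s \<ge> 1 \<Longrightarrow> smoothstep s = 1" "s \<ge> 1 \<Longrightarrow> smoothstep' s = 0"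
proof -
  assume "s \<ge> 1"
  then have "s\<^sup>2 \<ge> 1" by (simp add: one_le_power)
  then show "smoothstep s = 1" "smoothstep' s = 0"
    using \<open>s \<ge> 1\<close> by (auto simp: smoothstep_def smoothstep'_def)
qed

section \<open>The weighted square completion\<close>

lemma has_derivative_norm_powr:
  fixes x :: "'a::euclidean_space"
  assumes "x \<noteq> 0"
  shows "((\<lambda>x. norm x powr s) has_derivative (\<lambda>h. s * norm x powr s * (x \<bullet> h) / (x \<bullet> x))) (at x)"
proof -
  have "((\<lambda>x. norm x powr s) has_derivative (\<lambda>h. s * norm x powr (s - 1) * (x \<bullet> h / norm x))) (at x)"
    using DERIV_compose_FDERIV[OF has_real_derivative_powr[of "norm x" s] has_derivative_norm[OF assms]] assms
    by (simp add: sgn_div_norm inner_commute[of _ x] divide_inverse mult_ac)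
  moreover have "(\<lambda>h. s * norm x powr (s - 1) * (x \<bullet> h / norm x)) = (\<lambda>h. s * norm x powr s * (x \<bullet> h) / (x \<bullet> x))"
    using assms by (simp add: powr_diff dot_square_norm power2_eq_square)
  ultimately show ?thesis by simp
qed

text \<open>In the notation of the vector field below: \<open>q = \<bar>x\<bar>\<^sup>2\<close>, \<open>e = x \<bullet> \<nabla>u\<close>, \<open>g = \<bar>\<nabla>u\<bar>\<^sup>2\<close>, \<open>l = \<Delta>u\<close>
  and \<open>k = x \<bullet> D\<^sup>2u \<nabla>u\<close>; the slack is the sum of squares
  \<open>(q l + a e + b u)\<^sup>2 + T (q g - e\<^sup>2) + K (e + p u)\<^sup>2\<close>.\<close>
lemma pointwise_square_completion:
  fixes q e u g l k a a' b b' w w' p n \<alpha> W :: real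
  defines "T \<equiv> 2 * b - a' - (n - \<alpha>) * a"
    and "K \<equiv> 2 * b + a' - (n + \<alpha> - 4) * a - a\<^sup>2"
  assumes q: "q > 0" and cs: "e\<^sup>2 \<le> q * g" and T: "T \<ge> 0" and K: "K \<ge> 0"
    and w: "w = K * p + a * b - b' - (2 - \<alpha>) * b"
    and E: "W \<le> w' + (n - \<alpha>) * w - b\<^sup>2 - K * p\<^sup>2"
  shows "W * u\<^sup>2 \<le> q\<^sup>2 * l\<^sup>2 + ((2*a*q*e + 2*b*q*u) * l - \<alpha> * (e/q) * (2*a*q*e + 2*b*q*u)
    + (2*a'*(e/q)*q*e + 4*a*e*e + 2*a*q*(g + k) + 2*b'*(e/q)*q*u + 4*b*e*u + 2*b*q*g)
    + n * (w*u\<^sup>2 - a*q*g) - \<alpha> * (w*u\<^sup>2 - a*q*g)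
    + (w'*u\<^sup>2 + 2*w*u*e - a'*q*g - 2*a*q*g - 2*a*q*k))" (is "_ \<le> ?rhs")
proof -
  \<comment> \<open>The terms in \<open>k\<close> cancel. \<open>T\<close> is the coefficient left
    at \<open>q*g\<close>, \<open>K\<close> then accounts for the square of \<open>e\<close>, and
    the prescribed \<open>w\<close> is exactly what matches the coefficient of \<open>e*u\<close>.
    The rest is the coefficient of the square of \<open>u\<close>.\<close>
  have "?rhs = (q*l + a*e + b*u)\<^sup>2 + T * (q*g - e\<^sup>2) + K * (e + p*u)\<^sup>2
      + (w' + (n - \<alpha>) * w - b\<^sup>2 - K * p\<^sup>2) * u\<^sup>2"
    using q unfolding w by (simp add: T_def K_def power2_eq_square) (simp add: field_simps)
  moreover have "W * u\<^sup>2 \<le> (w' + (n - \<alpha>) * w - b\<^sup>2 - K * p\<^sup>2) * u\<^sup>2"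
    using E by (rule mult_right_mono) simp
  moreover have "T * (q*g - e\<^sup>2) \<ge> 0" "K * (e + p*u)\<^sup>2 \<ge> 0" using T K cs by simp_all
  ultimately show ?thesis using zero_le_power2[of "q*l + a*e + b*u"] by linarith
qed

text \<open>On the shell where the cutoff varies, \<open>r / \<epsilon>\<close> lies between 1/2 and
  1, so its powers are at most 2^|s|. Both signs of \<open>s\<close> matter, since the exponent will
  be -\<alpha>.\<close>

lemma powr_bound_on_shell:
  fixes r s \<epsilon> :: real
  assumes "0 < \<epsilon>" "\<epsilon> / 2 \<le> r" "r \<le> \<epsilon>"
  shows "r powr s \<le> 2 powr \<bar>s\<bar> * \<epsilon> powr s"
proof -
  have "r / \<epsilon> \<in> {1/2..1}" using assms by (auto simp: field_simps)
  moreover have "y powr s \<le> 2 powr \<bar>s\<bar>" if "y \<in> {1/2..1}" for y :: real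
  proof (cases "s \<ge> 0")
    case True
    have "y powr s \<le> 1 powr s" using that True by (intro powr_mono2) auto
    also have "\<dots> \<le> 2 powr \<bar>s\<bar>" by (simp add: ge_one_powr_ge_zero)
    finally show ?thesis .
  next
    case False
    have "y powr s \<le> (1/2) powr s" using that False by (intro powr_mono2') auto
    also have "\<dots> = 2 powr \<bar>s\<bar>" using False by (simp add: powr_divide powr_minus_divide)
    finally show ?thesis .
  qed
  ultimately have "(r / \<epsilon>) powr s \<le> 2 powr \<bar>s\<bar>" by blast
  then show ?thesis using assms by (simp add: powr_divide field_simps)
qed

text \<open>The gradient is parallel to x, and \<open>f'\<close> is x . grad f, that is r d/dr
  instead of d/dr. In this normalisation \<open>T\<close>, \<open>K\<close> and the equation for
  \<open>w\<close> contain no powers of the radius.\<close>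

definition radial_derivative :: "'a::euclidean_space set \<Rightarrow> ('a \<Rightarrow> real) \<Rightarrow> ('a \<Rightarrow> real) \<Rightarrow> bool"
  where "radial_derivative S f f' \<longleftrightarrow>
    (\<forall>x\<in>S. (f has_derivative (\<lambda>h. f' x * (x \<bullet> h) / (x \<bullet> x))) (at x)) \<and> continuous_on S f'"

lemma radial_derivative_continuous: "radial_derivative S f f' \<Longrightarrow> continuous_on S f"
  unfolding radial_derivative_def
  by (meson continuous_at_imp_continuous_on has_derivative_continuous)

text \<open>The cutoff \<open>\<eta>\<close> removes the origin; \<open>integral_divergence_zero\<close> applies to the field
  \<open>\<eta> \<bar>x\<bar>\<^sup>-\<^sup>\<alpha> (a \<bar>x\<bar>\<^sup>2 (2 (x \<bullet> \<nabla>u) \<nabla>u - \<bar>\<nabla>u\<bar>\<^sup>2 x) + 2 b \<bar>x\<bar>\<^sup>2 u \<nabla>u + w u\<^sup>2 x)\<close>, and the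
  terms containing \<open>\<nabla>\<eta>\<close> are absorbed by the last integral.\<close>
lemma cutoff_estimate:
  fixes u a a' b b' w w' p W \<eta> \<eta>' :: "'a::euclidean_space \<Rightarrow> real" and R \<alpha> \<epsilon> :: real
  defines "n \<equiv> real DIM('a)"
  defines "T x \<equiv> 2 * b x - a' x - (n - \<alpha>) * a x"
    and "K x \<equiv> 2 * b x + a' x - (n + \<alpha> - 4) * a x - (a x)\<^sup>2"
    and "S x \<equiv> ((x \<bullet> grad u x) / (x \<bullet> x)) * (2 * a x * (x \<bullet> x) * (x \<bullet> grad u x) + 2 * b x * (x \<bullet> x) * u x)
       + (w x * (u x)\<^sup>2 - a x * (x \<bullet> x) * (grad u x \<bullet> grad u x))"
  assumes u: "smooth u" and \<rho>: "\<rho> < R"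
    and supp: "\<And>x. norm x > \<rho> \<Longrightarrow> u x = 0" "\<And>x. norm x > \<rho> \<Longrightarrow> grad u x = 0"
      "\<And>x h. norm x > \<rho> \<Longrightarrow> hess u x h = 0"
    and rad: "radial_derivative (ball 0 R - {0}) a a'" "radial_derivative (ball 0 R - {0}) b b'"
      "radial_derivative (ball 0 R - {0}) w w'" "radial_derivative (ball 0 R - {0}) \<eta> \<eta>'"
    and \<epsilon>: "\<epsilon> > 0" and \<eta>: "\<And>x. 0 \<le> \<eta> x" "\<And>x. \<eta> x \<le> 1" "\<And>x. norm x < \<epsilon> \<Longrightarrow> \<eta> x = 0" "\<And>x. norm x < \<epsilon> \<Longrightarrow> \<eta>' x = 0"
    and \<eta>_meas[measurable]: "\<eta> \<in> borel_measurable borel" "\<eta>' \<in> borel_measurable borel"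
    and W_meas[measurable]: "W \<in> borel_measurable borel"
    and W0: "\<And>x. x \<in> ball 0 R - {0} \<Longrightarrow> 0 \<le> W x"
    and T: "\<And>x. x \<in> ball 0 R - {0} \<Longrightarrow> T x \<ge> 0" and K: "\<And>x. x \<in> ball 0 R - {0} \<Longrightarrow> K x \<ge> 0"
    and w: "\<And>x. x \<in> ball 0 R - {0} \<Longrightarrow> w x = K x * p x + a x * b x - b' x - (2 - \<alpha>) * b x"
    and E: "\<And>x. x \<in> ball 0 R - {0} \<Longrightarrow> W x \<le> w' x + (n - \<alpha>) * w x - (b x)\<^sup>2 - K x * (p x)\<^sup>2"
    and Z_meas[measurable]: "Z \<in> borel_measurable borel" and Z0: "\<And>x. Z x \<ge> 0"
    and Z: "\<And>x. x \<in> ball 0 R - {0} \<Longrightarrow> \<bar>\<eta>' x * norm x powr (-\<alpha>) * S x\<bar> \<le> Z x"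
  shows "(\<integral>\<^sup>+x\<in>ball 0 R. ennreal (\<eta> x * (W x * \<bar>u x\<bar>\<^sup>2 / norm x powr \<alpha>)) \<partial>lborel)
    \<le> weighted_rhs R \<alpha> (laplacian u) + (\<integral>\<^sup>+x. ennreal (Z x) \<partial>lborel)"
proof -
  let ?A = "ball 0 R - {0::'a}"
  define P where "P x = norm x powr (-\<alpha>)" for x :: 'a
  let ?q = "\<lambda>x::'a. x \<bullet> x" and ?e = "\<lambda>x. x \<bullet> grad u x" and ?g = "\<lambda>x. grad u x \<bullet> grad u x"
  define m where "m x = \<eta> x * P x" for x
  define m' where "m' x h = (\<eta>' x - \<alpha> * \<eta> x) * P x * ((x \<bullet> h) / ?q x)" for x h
  define Q1 where "Q1 x = 2 * a x * ?q x * ?e x + 2 * b x * ?q x * u x" for x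
  define Q1' where "Q1' x h = 2 * a' x * ((x \<bullet> h) / ?q x) * ?q x * ?e x + 4 * a x * (x \<bullet> h) * ?e x
      + 2 * a x * ?q x * (grad u x \<bullet> h + hess u x h \<bullet> x)
      + 2 * b' x * ((x \<bullet> h) / ?q x) * ?q x * u x + 4 * b x * (x \<bullet> h) * u x + 2 * b x * ?q x * (grad u x \<bullet> h)" for x h
  define Q2 where "Q2 x = w x * (u x)\<^sup>2 - a x * ?q x * ?g x" for x
  define Q2' where "Q2' x h = w' x * ((x \<bullet> h) / ?q x) * (u x)\<^sup>2 + 2 * w x * u x * (grad u x \<bullet> h)
      - a' x * ((x \<bullet> h) / ?q x) * ?q x * ?g x - 2 * a x * (x \<bullet> h) * ?g x
      - 2 * a x * ?q x * (hess u x h \<bullet> grad u x)" for x h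
  define V where "V x = (m x * Q1 x) *\<^sub>R grad u x + (m x * Q2 x) *\<^sub>R x" for x
  define V' where "V' x h = (m' x h * Q1 x + m x * Q1' x h) *\<^sub>R grad u x + (m x * Q1 x) *\<^sub>R hess u x h
      + (m' x h * Q2 x + m x * Q2' x h) *\<^sub>R x + (m x * Q2 x) *\<^sub>R h" for x h
  have openA: "open ?A" by (intro open_Diff) auto
  have dP: "(P has_derivative (\<lambda>h. (-\<alpha>) * P x * (x \<bullet> h) / ?q x)) (at x)" if "x \<in> ?A" for x
    unfolding P_def using has_derivative_norm_powr[of x "-\<alpha>"] that by simp
  have rd: "(f has_derivative (\<lambda>h. f' x * (x \<bullet> h) / (x \<bullet> x))) (at x)"
    if "radial_derivative ?A f f'" "x \<in> ?A" for f f' x using that by (auto simp: radial_derivative_def)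
  have du: "(u has_derivative (\<lambda>h. grad u x \<bullet> h)) (at x)" for x by (rule has_derivative_grad[OF u])
  have dg: "(grad u has_derivative hess u x) (at x)" for x by (rule grad_has_derivative_hess[OF u])
  have derA: "(V has_derivative V' x) (at x)" if x: "x \<in> ?A" for x
  proof -
    have dm: "(m has_derivative m' x) (at x)"
      unfolding m_def[abs_def]
      by (rule derivative_eq_intros rd[OF rad(4) x] dP[OF x] refl)+
        (simp add: m'_def fun_eq_iff algebra_simps add_divide_distrib diff_divide_distrib)
    have de: "((\<lambda>x. x \<bullet> grad u x) has_derivative (\<lambda>h. grad u x \<bullet> h + hess u x h \<bullet> x)) (at x)"
      by (rule derivative_eq_intros dg refl)+ (simp add: fun_eq_iff inner_commute)
    have dq: "((\<lambda>x. x \<bullet> x) has_derivative (\<lambda>h. 2 * (x \<bullet> h))) (at x)"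
      by (rule derivative_eq_intros refl)+ (simp add: fun_eq_iff inner_commute)
    have dgg: "((\<lambda>x. grad u x \<bullet> grad u x) has_derivative (\<lambda>h. 2 * (hess u x h \<bullet> grad u x))) (at x)"
      by (rule derivative_eq_intros dg refl)+ (simp add: fun_eq_iff inner_commute)
    have dQ1: "(Q1 has_derivative Q1' x) (at x)"
      unfolding Q1_def[abs_def]
      by (rule derivative_eq_intros rd[OF rad(1) x] rd[OF rad(2) x] de dq du refl)+
        (simp add: Q1'_def fun_eq_iff algebra_simps)
    have dQ2: "(Q2 has_derivative Q2' x) (at x)"
      unfolding Q2_def[abs_def]
      by (rule derivative_eq_intros rd[OF rad(1) x] rd[OF rad(3) x] dgg dq du refl)+
        (simp add: Q2'_def fun_eq_iff algebra_simps)
    show ?thesis unfolding V_def[abs_def]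
      by (rule derivative_eq_intros dm dQ1 dQ2 dg refl)+
        (simp add: V'_def fun_eq_iff algebra_simps)
  qed
  have V_small: "V x = 0" "V' x h = 0" if "norm x < \<epsilon>" for x h
    using \<eta>(3,4)[OF that] by (simp_all add: V_def V'_def m_def m'_def)
  have V_large: "V x = 0" "V' x h = 0" if "norm x > \<rho>" for x h
    using supp[OF that] by (simp_all add: V_def V'_def Q1_def Q2_def Q1'_def Q2'_def)
  let ?U1 = "{x::'a. norm x < \<epsilon>}" and ?U3 = "{x::'a. norm x > \<rho>}"
  have op1: "open ?U1" and op3: "open ?U3" by (intro open_Collect_less continuous_intros)+
  \<comment> \<open>\<open>V\<close> vanishes identically near the origin and beyond \<rho>, and the
    three open sets cover the space; so differentiability and continuity need an argument only on
    the punctured ball.\<close>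
  have cover: "?A \<union> (?U1 \<union> ?U3) = UNIV" using \<epsilon> \<rho> by (auto simp: not_less)
  have z0: "((\<lambda>_. 0 :: 'a) has_derivative (\<lambda>_. 0)) (at x)" for x :: 'a by simp
  have der: "(V has_derivative V' x) (at x)" for x
  proof -
    consider "x \<in> ?A" | "x \<in> ?U1" | "x \<in> ?U3" using cover by blast
    then show ?thesis
    proof cases
      case 2
      have "(V has_derivative (\<lambda>_. 0)) (at x)"
        by (rule has_derivative_transform_within_open[OF z0 op1 2]) (use V_small in auto)
      moreover have "V' x = (\<lambda>_. 0)" using V_small(2) 2 by auto
      ultimately show ?thesis by simp
    next
      case 3
      have "(V has_derivative (\<lambda>_. 0)) (at x)"
        by (rule has_derivative_transform_within_open[OF z0 op3 3]) (use V_large in auto)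
      moreover have "V' x = (\<lambda>_. 0)" using V_large(2) 3 by auto
      ultimately show ?thesis by simp
    qed (rule derA)
  qed
  have contA: "continuous_on ?A (\<lambda>x. V' x h)" for h
  proof -
    have cu: "continuous_on ?A u" "continuous_on ?A (grad u)" "continuous_on ?A (\<lambda>x. hess u x h)"
      using continuous_on_u[OF u] continuous_on_grad[OF u] continuous_on_hess[OF u]
      by (auto intro: continuous_on_subset)
    have cr: "continuous_on ?A a" "continuous_on ?A a'" "continuous_on ?A b" "continuous_on ?A b'"
      "continuous_on ?A w" "continuous_on ?A w'" "continuous_on ?A \<eta>" "continuous_on ?A \<eta>'"
      using rad radial_derivative_continuous by (auto simp: radial_derivative_def)
    have cP: "continuous_on ?A P" using dP has_derivative_continuous
      by (blast intro: continuous_at_imp_continuous_on)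
    have cm: "continuous_on ?A m" "continuous_on ?A (\<lambda>x. m' x h)"
      unfolding m_def m'_def by (intro continuous_intros cr cP; simp)+
    have cQ: "continuous_on ?A Q1" "continuous_on ?A (\<lambda>x. Q1' x h)" "continuous_on ?A Q2" "continuous_on ?A (\<lambda>x. Q2' x h)"
      unfolding Q1_def Q1'_def Q2_def Q2'_def by (intro continuous_intros cr cu; simp)+
    show ?thesis unfolding V'_def by (intro continuous_intros cm cQ cu)
  qed
  have cont: "continuous_on UNIV (\<lambda>x. V' x h)" for h
  proof -
    have 1: "continuous_on ?U1 (\<lambda>x. V' x h)" "continuous_on ?U3 (\<lambda>x. V' x h)"
      by (subst continuous_on_cong[OF refl, where g = "\<lambda>_. 0"]; simp add: V_small V_large)+
    have "continuous_on (?A \<union> (?U1 \<union> ?U3)) (\<lambda>x. V' x h)"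
      by (intro continuous_on_open_Un open_Un openA op1 op3 contA 1)
    then show ?thesis unfolding cover .
  qed
  define J where "J x = (\<Sum>b\<in>Basis. V' x b \<bullet> b)" for x
  have J: "integrable lborel J" "(\<integral>x. J x \<partial>lborel) = 0"
    unfolding J_def using integral_divergence_zero[of V V' \<rho>, OF der cont V_large(1)] by auto
  \<comment> \<open>The divergence is the trace of \<open>V'\<close>: a functional times a vector
    contributes the functional at that vector, the Hessian contributes the Laplacian, the identity
    contributes the dimension.\<close>
  have J_eq: "J x = (m' x (grad u x) * Q1 x + m x * Q1' x (grad u x)) + m x * Q1 x * laplacian u x
      + (m' x x * Q2 x + m x * Q2' x x) + m x * Q2 x * n" for x
  proof -
    have lin: "linear (\<lambda>h. m' x h * Q1 x + m x * Q1' x h)" "linear (\<lambda>h. m' x h * Q2 x + m x * Q2' x h)"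
    proof -
      have lh: "linear (hess u x)" by (rule has_derivative_linear[OF dg])
      show "linear (\<lambda>h. m' x h * Q1 x + m x * Q1' x h)" "linear (\<lambda>h. m' x h * Q2 x + m x * Q2' x h)"
        by (rule linearI;
         simp add: m'_def Q1'_def Q2'_def linear_add[OF lh] linear_cmul[OF lh]
            inner_add_right inner_add_left algebra_simps add_divide_distrib)+
    qed
    have sum: "(\<Sum>b\<in>Basis. f b * (v \<bullet> b)) = f v" if "linear f" for f :: "'a \<Rightarrow> real" and v
    proof -
      interpret linear f by fact
      have "f v = f (\<Sum>b\<in>Basis. (v \<bullet> b) *\<^sub>R b)" by (simp add: euclidean_representation)
      then show ?thesis by (simp add: sum scale mult.commute)
    qed
    have "J x = (\<Sum>b\<in>Basis. (m' x b * Q1 x + m x * Q1' x b) * (grad u x \<bullet> b))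
        + (\<Sum>b\<in>Basis. m x * Q1 x * (hess u x b \<bullet> b))
        + (\<Sum>b\<in>Basis. (m' x b * Q2 x + m x * Q2' x b) * (x \<bullet> b)) + (\<Sum>b\<in>(Basis::'a set). m x * Q2 x)"
      unfolding J_def V'_def sum.distrib[symmetric]
      by (intro sum.cong refl) (simp add: inner_add_left)
    also have "(\<Sum>b\<in>Basis. (m' x b * Q1 x + m x * Q1' x b) * (grad u x \<bullet> b)) = m' x (grad u x) * Q1 x + m x * Q1' x (grad u x)"
      by (rule sum[OF lin(1)])
    also have "(\<Sum>b\<in>Basis. (m' x b * Q2 x + m x * Q2' x b) * (x \<bullet> b)) = m' x x * Q2 x + m x * Q2' x x"
      by (rule sum[OF lin(2)])
    also have "(\<Sum>b\<in>Basis. m x * Q1 x * (hess u x b \<bullet> b)) = m x * Q1 x * laplacian u x"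
      by (simp add: laplacian_eq_hess[OF u] sum_distrib_left)
    finally show ?thesis by (simp add: n_def mult.commute)
  qed
  have main: "\<eta> x * P x * W x * (u x)\<^sup>2 \<le> P x * (?q x)\<^sup>2 * (laplacian u x)\<^sup>2 + J x + Z x" if x: "x \<in> ?A" for x
  proof -
    have q: "?q x > 0" using x by simp
    have P0: "P x \<ge> 0" by (simp add: P_def)
    \<comment> \<open>One such term comes from differentiating x . grad u along grad u, the other
      from differentiating |grad u|^2 along x. Once identified they cancel, and the Laplacian is the
      only second-order quantity left.\<close>
    have sym: "hess u x x \<bullet> grad u x = hess u x (grad u x) \<bullet> x" by (rule hess_symmetric[OF u])
    let ?k = "hess u x (grad u x) \<bullet> x"
    let ?D = "(2*a x*?q x*?e x + 2*b x*?q x*u x) * laplacian u x - \<alpha> * (?e x/?q x) * (2*a x*?q x*?e x + 2*b x*?q x*u x)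
      + (2*a' x*(?e x/?q x)*?q x*?e x + 4*a x*?e x*?e x + 2*a x*?q x*(?g x + ?k) + 2*b' x*(?e x/?q x)*?q x*u x + 4*b x*?e x*u x + 2*b x*?q x*?g x)
      + n * (w x*(u x)\<^sup>2 - a x*?q x*?g x) - \<alpha> * (w x*(u x)\<^sup>2 - a x*?q x*?g x)
      + (w' x*(u x)\<^sup>2 + 2*w x*u x*?e x - a' x*?q x*?g x - 2*a x*?q x*?g x - 2*a x*?q x*?k)"
    have pw: "W x * (u x)\<^sup>2 \<le> (?q x)\<^sup>2 * (laplacian u x)\<^sup>2 + ?D"
    proof (rule pointwise_square_completion[OF q, where p = "p x"])
      show "(?e x)\<^sup>2 \<le> ?q x * ?g x" by (rule Cauchy_Schwarz_ineq)
    qed (use T[OF x] K[OF x] w[OF x] E[OF x] in \<open>auto simp: T_def K_def\<close>)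
    have J: "J x = \<eta> x * P x * ?D + \<eta>' x * P x * S x"
      unfolding J_eq m_def m'_def Q1_def Q1'_def Q2_def Q2'_def S_def sym
      using q by (simp add: inner_commute[of "grad u x" x]) (simp add: algebra_simps diff_divide_distrib add_divide_distrib)
    have "\<eta> x * P x * (W x * (u x)\<^sup>2) \<le> \<eta> x * P x * ((?q x)\<^sup>2 * (laplacian u x)\<^sup>2 + ?D)"
      by (rule mult_left_mono[OF pw]) (use P0 \<eta>(1) in simp)
    also have "\<dots> = \<eta> x * (P x * (?q x)\<^sup>2 * (laplacian u x)\<^sup>2) + (J x - \<eta>' x * P x * S x)"
      unfolding J by (simp add: algebra_simps)
    also have "\<eta> x * (P x * (?q x)\<^sup>2 * (laplacian u x)\<^sup>2) \<le> 1 * (P x * (?q x)\<^sup>2 * (laplacian u x)\<^sup>2)"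
      by (rule mult_right_mono) (use \<eta>(2) P0 in auto)
    finally show ?thesis using Z[OF x] by (simp add: P_def mult.assoc)
  qed
  have [measurable]: "u \<in> borel_measurable borel" "laplacian u \<in> borel_measurable borel"
    using continuous_on_u[OF u] continuous_on_laplacian[OF u] by (auto intro: borel_measurable_continuous_onI)
  have [measurable]: "P \<in> borel_measurable borel" unfolding P_def by simp
  let ?f = "\<lambda>x. indicator ?A x * (\<eta> x * P x * W x * (u x)\<^sup>2)"
  let ?h = "\<lambda>x. indicator ?A x * (P x * (?q x)\<^sup>2 * (laplacian u x)\<^sup>2)"
  have outside: "J x = 0" if "x \<notin> ?A" for x
  proof -
    have "norm x < \<epsilon> \<or> norm x > \<rho>" using that cover by blast
    then show ?thesis unfolding J_def using V_small(2) V_large(2) by auto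
  qed
  have "(\<integral>\<^sup>+x. ennreal (?f x) \<partial>lborel) \<le> (\<integral>\<^sup>+x. ennreal (?h x) \<partial>lborel) + (\<integral>\<^sup>+x. ennreal (Z x) \<partial>lborel)"
  proof (rule nn_integral_le_modulo_zero_integral[OF _ _ _ J])
    show "?f \<in> borel_measurable lborel" "?h \<in> borel_measurable lborel"
      by (intro borel_measurable_times borel_measurable_indicator borel_measurable_power borel_measurable_inner; simp)+
    show "Z \<in> borel_measurable lborel" by simp
    show "?f x \<ge> 0" for x using \<eta>(1) W0 by (simp add: indicator_def P_def)
    show "?h x \<ge> 0" for x by (simp add: indicator_def P_def)
    show "AE x in lborel. ?f x \<le> ?h x + J x + Z x"
    proof (rule AE_I2)
      fix x show "?f x \<le> ?h x + J x + Z x"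
        using main[of x] outside[of x] Z0[of x] by (cases "x \<in> ?A") auto
    qed
  qed (rule Z0)
  moreover have ae0: "AE x in lborel. x \<noteq> (0::'a)" by (rule AE_lborel_singleton)
  have "(\<integral>\<^sup>+x\<in>ball 0 R. ennreal (\<eta> x * (W x * \<bar>u x\<bar>\<^sup>2 / norm x powr \<alpha>)) \<partial>lborel) = (\<integral>\<^sup>+x. ennreal (?f x) \<partial>lborel)"
    by (rule nn_integral_cong_AE, use ae0 in eventually_elim)
      (auto simp: indicator_def P_def powr_minus divide_inverse mult_ac)
  moreover have "weighted_rhs R \<alpha> (laplacian u) = (\<integral>\<^sup>+x. ennreal (?h x) \<partial>lborel)"
    unfolding weighted_rhs_def
  proof (rule nn_integral_cong_AE, use ae0 in eventually_elim)
    fix x :: 'a assume x: "x \<noteq> 0"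
    have "norm x powr (\<alpha> - 4) = norm x powr \<alpha> / norm x powr (real 4)"
      by (simp add: powr_diff)
    also have "norm x powr (real 4) = norm x ^ 4" using x by (intro powr_realpow) simp
    also have "norm x ^ 4 = (?q x)\<^sup>2" by (simp add: dot_square_norm power2_eq_square power4_eq_xxxx)
    finally have "\<bar>laplacian u x\<bar>\<^sup>2 / norm x powr (\<alpha> - 4) = P x * (?q x)\<^sup>2 * (laplacian u x)\<^sup>2"
      using x by (simp add: P_def powr_minus divide_inverse mult_ac)
    then show "ennreal (\<bar>laplacian u x\<bar>\<^sup>2 / norm x powr (\<alpha> - 4)) * indicator (ball 0 R) x = ennreal (?h x)"
      using x by (auto simp: indicator_def)
  qed
  ultimately show ?thesis by simp
qed

lemma nn_integral_shell:
  assumes "\<epsilon> > 0" "C \<ge> 0"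
  shows "(\<integral>\<^sup>+x. ennreal (C * indicator (cball 0 \<epsilon>) (x::'a::euclidean_space)) \<partial>lborel)
    = ennreal (C * unit_ball_vol (DIM('a)) * \<epsilon> ^ DIM('a))"
proof -
  have "(\<integral>\<^sup>+x. ennreal (C * indicator (cball 0 \<epsilon>) (x::'a)) \<partial>lborel)
      = (\<integral>\<^sup>+x. ennreal C * indicator (cball 0 \<epsilon>) (x::'a) \<partial>lborel)"
    by (intro nn_integral_cong) (simp add: indicator_def)
  also have "\<dots> = ennreal C * ennreal (unit_ball_vol (DIM('a)) * \<epsilon> ^ DIM('a))"
    using assms by (simp add: nn_integral_cmult_indicator emeasure_cball)
  finally show ?thesis using assms by (simp add: ennreal_mult mult.assoc)
qed

text \<open>The cutoff is shrunk to the origin. Its derivative lives in a ball of radius \<epsilon>,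
  where the error density is of order \<epsilon>^(-\<alpha>); times the volume this is of order
  \<epsilon>^(n-\<alpha>), which tends to 0. Fatou's lemma restores the full left-hand side.\<close>

lemma rellich_from_square_completion:
  fixes u a a' b b' w w' p W :: "'a::euclidean_space \<Rightarrow> real" and R \<alpha> :: real
  defines "n \<equiv> real DIM('a)"
  defines "T x \<equiv> 2 * b x - a' x - (n - \<alpha>) * a x"
    and "K x \<equiv> 2 * b x + a' x - (n + \<alpha> - 4) * a x - (a x)\<^sup>2"
  assumes u: "u \<in> test_functions (ball 0 R)" and R: "R > 0" and \<alpha>: "\<alpha> < n"
    and rad: "radial_derivative (ball 0 R - {0}) a a'" "radial_derivative (ball 0 R - {0}) b b'"
      "radial_derivative (ball 0 R - {0}) w w'"
    and bdd: "\<And>\<rho>. \<rho> < R \<Longrightarrow> \<exists>M. \<forall>x\<in>cball 0 \<rho> - {0}. \<bar>a x\<bar> \<le> M \<and> \<bar>b x\<bar> \<le> M \<and> \<bar>w x\<bar> \<le> M"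
    and W_meas[measurable]: "W \<in> borel_measurable borel"
    and W0: "\<And>x. x \<in> ball 0 R - {0} \<Longrightarrow> 0 \<le> W x"
    and T: "\<And>x. x \<in> ball 0 R - {0} \<Longrightarrow> T x \<ge> 0" and K: "\<And>x. x \<in> ball 0 R - {0} \<Longrightarrow> K x \<ge> 0"
    and w: "\<And>x. x \<in> ball 0 R - {0} \<Longrightarrow> w x = K x * p x + a x * b x - b' x - (2 - \<alpha>) * b x"
    and E: "\<And>x. x \<in> ball 0 R - {0} \<Longrightarrow> W x \<le> w' x + (n - \<alpha>) * w x - (b x)\<^sup>2 - K x * (p x)\<^sup>2"
  shows "(\<integral>\<^sup>+x\<in>ball 0 R. ennreal (W x * \<bar>u x\<bar>\<^sup>2 / norm x powr \<alpha>) \<partial>lborel) \<le> weighted_rhs R \<alpha> (laplacian u)"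
proof -
  let ?A = "ball 0 R - {0::'a}"
  have sm: "smooth u" using u by (simp add: test_functions_def)
  obtain \<rho> where \<rho>: "0 < \<rho>" "\<rho> < R"
    and supp: "\<And>x. norm x > \<rho> \<Longrightarrow> u x = 0" "\<And>x. norm x > \<rho> \<Longrightarrow> grad u x = 0"
      "\<And>x h. norm x > \<rho> \<Longrightarrow> hess u x h = 0"
    by (rule test_function_support[OF u R]) blast
  obtain M0 where M0: "\<And>x. x \<in> cball 0 \<rho> - {0} \<Longrightarrow> \<bar>a x\<bar> \<le> M0 \<and> \<bar>b x\<bar> \<le> M0 \<and> \<bar>w x\<bar> \<le> M0"
    using bdd[OF \<rho>(2)] by blast
  define M where "M = max M0 0"
  have M: "\<bar>a x\<bar> \<le> M" "\<bar>b x\<bar> \<le> M" "\<bar>w x\<bar> \<le> M" if "x \<in> cball 0 \<rho> - {0}" for x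
    using M0[OF that] by (auto simp: M_def)
  have "bounded (u ` cball 0 \<rho>)" "bounded (grad u ` cball 0 \<rho>)"
    by (intro compact_imp_bounded compact_continuous_image
        continuous_on_subset[OF continuous_on_u[OF sm]] continuous_on_subset[OF continuous_on_grad[OF sm]]; simp)+
  then obtain B1 B2 where "\<And>x. x \<in> cball 0 \<rho> \<Longrightarrow> \<bar>u x\<bar> \<le> B1" "\<And>x. x \<in> cball 0 \<rho> \<Longrightarrow> norm (grad u x) \<le> B2"
    unfolding bounded_iff real_norm_def by (metis imageI)
  then obtain B where B: "\<And>x. x \<in> cball 0 \<rho> \<Longrightarrow> \<bar>u x\<bar> \<le> B" "\<And>x. x \<in> cball 0 \<rho> \<Longrightarrow> norm (grad u x) \<le> B"
    by (metis max.coboundedI1 max.coboundedI2)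
  have M_nonneg: "M \<ge> 0" by (simp add: M_def)
  have B_nonneg: "B \<ge> 0" using B(1)[of 0] \<rho> by simp
  define S where "S x = ((x \<bullet> grad u x) / (x \<bullet> x)) * (2 * a x * (x \<bullet> x) * (x \<bullet> grad u x) + 2 * b x * (x \<bullet> x) * u x)
       + (w x * (u x)\<^sup>2 - a x * (x \<bullet> x) * (grad u x \<bullet> grad u x))" for x
  \<comment> \<open>One summand for each of the four terms of \<open>S\<close>, with |x| at most
    \<rho>, \<open>u\<close> and its gradient at most \<open>B\<close>, and the coefficients at most
    \<open>M\<close>.\<close>
  define C where "C = 2 * M * (\<rho> * B)\<^sup>2 + 2 * M * (\<rho> * B) * B + M * B\<^sup>2 + M * (\<rho> * B)\<^sup>2"
  have C_nonneg: "C \<ge> 0" using M_nonneg B_nonneg \<rho> by (simp add: C_def)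
  have S_bound: "\<bar>S x\<bar> \<le> C" if x: "x \<in> ?A" for x
  proof (cases "norm x \<le> \<rho>")
    case False then show ?thesis using supp(1,2)[of x] C_nonneg by (simp add: S_def)
  next
    case True
    then have xin: "x \<in> cball 0 \<rho> - {0}" "x \<in> cball 0 \<rho>" using x by auto
    have gr: "norm x * norm (grad u x) \<le> \<rho> * B"
      using True B(2)[OF xin(2)] by (intro mult_mono) (use \<rho> in auto)
    have e: "\<bar>x \<bullet> grad u x\<bar> \<le> \<rho> * B" using Cauchy_Schwarz_ineq2[of x "grad u x"] gr by linarith
    have e2: "(x \<bullet> grad u x)\<^sup>2 \<le> (\<rho> * B)\<^sup>2" using power_mono[OF e, of 2] by simp
    have g2: "(x \<bullet> x) * (grad u x \<bullet> grad u x) \<le> (\<rho> * B)\<^sup>2"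
      using power_mono[OF gr, of 2] by (simp add: dot_square_norm power_mult_distrib)
    have u2: "(u x)\<^sup>2 \<le> B\<^sup>2" using power_mono[OF B(1)[OF xin(2)], of 2] by simp
    have "S x = 2 * a x * (x \<bullet> grad u x)\<^sup>2 + 2 * b x * (x \<bullet> grad u x) * u x + w x * (u x)\<^sup>2
        - a x * ((x \<bullet> x) * (grad u x \<bullet> grad u x))"
      using x by (simp add: S_def power2_eq_square field_simps)
    then have "\<bar>S x\<bar> \<le> \<bar>2 * a x * (x \<bullet> grad u x)\<^sup>2\<bar> + \<bar>2 * b x * (x \<bullet> grad u x) * u x\<bar> + \<bar>w x * (u x)\<^sup>2\<bar>
        + \<bar>a x * ((x \<bullet> x) * (grad u x \<bullet> grad u x))\<bar>" by linarith
    also have "\<bar>2 * a x * (x \<bullet> grad u x)\<^sup>2\<bar> \<le> 2 * M * (\<rho> * B)\<^sup>2"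
      unfolding abs_mult using M(1)[OF xin(1)] e2 M_nonneg by (intro mult_mono) auto
    also have "\<bar>2 * b x * (x \<bullet> grad u x) * u x\<bar> \<le> 2 * M * (\<rho> * B) * B"
      unfolding abs_mult using M(2)[OF xin(1)] e B(1)[OF xin(2)] M_nonneg B_nonneg \<rho>
      by (intro mult_mono) auto
    also have "\<bar>w x * (u x)\<^sup>2\<bar> \<le> M * B\<^sup>2"
      unfolding abs_mult using M(3)[OF xin(1)] u2 M_nonneg by (intro mult_mono) auto
    also have "\<bar>a x * ((x \<bullet> x) * (grad u x \<bullet> grad u x))\<bar> \<le> M * (\<rho> * B)\<^sup>2"
      unfolding abs_mult using M(1)[OF xin(1)] g2 M_nonneg by (intro mult_mono) (auto simp: abs_mult)
    finally show ?thesis by (simp add: C_def)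
  qed
  define \<epsilon> where "\<epsilon> k = 1 / real (Suc k)" for k
  have \<epsilon>: "\<epsilon> k > 0" for k by (simp add: \<epsilon>_def)
  have \<epsilon>lim: "\<epsilon> \<longlonglongrightarrow> 0"
    unfolding \<epsilon>_def using LIMSEQ_inverse_real_of_nat by (simp add: inverse_eq_divide)
  \<comment> \<open>A function of |x|^2, rising from 0 at |x| = \<epsilon> / sqrt 2 to 1 at |x| =
    \<epsilon>. In particular it vanishes for |x| < \<epsilon> / 2, the radius passed to
    \<open>cutoff_estimate\<close>.\<close>
  define \<eta> where "\<eta> k x = smoothstep (2 * (x \<bullet> x) / (\<epsilon> k)\<^sup>2 - 1)" for k and x :: 'a
  define \<eta>' where "\<eta>' k x = smoothstep' (2 * (x \<bullet> x) / (\<epsilon> k)\<^sup>2 - 1) * (4 * (x \<bullet> x) / (\<epsilon> k)\<^sup>2)" for k and x :: 'a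
  \<comment> \<open>16 = 4 * 4: one factor bounds \<open>smoothstep'\<close>, the other 4 |x|^2 /
    \<epsilon>^2. The power of 2 comes from \<open>powr_bound_on_shell\<close>.\<close>
  define C' where "C' = 16 * 2 powr \<bar>\<alpha>\<bar> * C"
  define Z where "Z k x = (C' * \<epsilon> k powr (-\<alpha>)) * indicator (cball 0 (\<epsilon> k)) x" for k and x :: 'a
  have C'_nonneg: "C' \<ge> 0" using C_nonneg by (simp add: C'_def)
  have contq: "continuous_on UNIV (\<lambda>x::'a. 2 * (x \<bullet> x) / (\<epsilon> k)\<^sup>2 - 1)" for k
    by (intro continuous_intros) (use \<epsilon>[of k] in simp)
  have small: "\<eta> k x = 0" "\<eta>' k x = 0" if "norm x < \<epsilon> k / 2" for k x
  proof -
    have "(norm x)\<^sup>2 \<le> (\<epsilon> k / 2)\<^sup>2" using that by (intro power_mono) auto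
    then have "4 * (norm x)\<^sup>2 \<le> (\<epsilon> k)\<^sup>2" by (simp add: power_divide)
    moreover have "0 \<le> (norm x)\<^sup>2" by simp
    ultimately have "2 * (norm x)\<^sup>2 \<le> (\<epsilon> k)\<^sup>2" by linarith
    then have "2 * (x \<bullet> x) \<le> (\<epsilon> k)\<^sup>2" by (simp add: dot_square_norm)
    then have "2 * (x \<bullet> x) / (\<epsilon> k)\<^sup>2 - 1 \<le> 0"
      using \<epsilon>[of k] by (simp add: divide_simps)
    then show "\<eta> k x = 0" "\<eta>' k x = 0" by (simp_all add: \<eta>_def \<eta>'_def smoothstep_le_0)
  qed
  have large: "\<eta> k x = 1" "\<eta>' k x = 0" if "norm x \<ge> \<epsilon> k" for k x
  proof -
    have "(\<epsilon> k)\<^sup>2 \<le> (norm x)\<^sup>2" using that \<epsilon>[of k] by (intro power_mono) auto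
    then have "2 * (x \<bullet> x) / (\<epsilon> k)\<^sup>2 - 1 \<ge> 1"
      using \<epsilon>[of k] by (simp add: dot_square_norm power_divide divide_simps)
    then show "\<eta> k x = 1" "\<eta>' k x = 0" by (simp_all add: \<eta>_def \<eta>'_def smoothstep_ge_1)
  qed
  have \<eta>rad: "radial_derivative ?A (\<eta> k) (\<eta>' k)" for k
  proof -
    have "(\<eta> k has_derivative (\<lambda>h. \<eta>' k x * (x \<bullet> h) / (x \<bullet> x))) (at x)" if x: "x \<in> ?A" for x
    proof -
      have "((\<lambda>x::'a. x \<bullet> x) has_derivative (\<lambda>h. 2 * (x \<bullet> h))) (at x)"
        by (rule derivative_eq_intros refl)+ (simp add: fun_eq_iff inner_commute)
      from has_derivative_diff[OF has_derivative_mult_right[OF this, of "2 / (\<epsilon> k)\<^sup>2"] has_derivative_const[of 1]]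
      have "((\<lambda>x::'a. 2 * (x \<bullet> x) / (\<epsilon> k)\<^sup>2 - 1) has_derivative (\<lambda>h. 4 * (x \<bullet> h) / (\<epsilon> k)\<^sup>2)) (at x)"
        by simp
      from DERIV_compose_FDERIV[OF has_derivative_smoothstep this]
      show ?thesis using x by (simp add: \<eta>_def[abs_def] \<eta>'_def mult_ac)
    qed
    moreover have "continuous_on ?A (\<eta>' k)"
      unfolding \<eta>'_def using \<epsilon>[of k]
      by (intro continuous_intros continuous_on_smoothstep' continuous_on_subset[OF contq]) auto
    ultimately show ?thesis unfolding radial_derivative_def by blast
  qed
  have \<eta>_cont: "continuous_on UNIV (\<eta> k)" "continuous_on UNIV (\<eta>' k)" for k
  proof -
    show "continuous_on UNIV (\<eta>' k)"
      unfolding \<eta>'_def using \<epsilon>[of k]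
      by (intro continuous_intros continuous_on_smoothstep' contq) auto
    have "continuous_on UNIV smoothstep"
      using has_derivative_smoothstep by (meson DERIV_isCont continuous_at_imp_continuous_on)
    then show "continuous_on UNIV (\<eta> k)"
      unfolding \<eta>_def by (rule continuous_on_compose2[OF _ contq]) auto
  qed
  have \<eta>_meas[measurable]: "\<eta> k \<in> borel_measurable borel" "\<eta>' k \<in> borel_measurable borel" for k
    using \<eta>_cont by (auto intro: borel_measurable_continuous_onI)
  have [measurable]: "ball 0 R \<in> sets (borel :: 'a measure)" by simp
  have [measurable]: "u \<in> borel_measurable borel"
    using continuous_on_u[OF sm] by (rule borel_measurable_continuous_onI)
  have Z_bound: "\<bar>\<eta>' k x * norm x powr (-\<alpha>) * S x\<bar> \<le> Z k x" if x: "x \<in> ?A" for k x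
  proof (cases "\<epsilon> k / 2 \<le> norm x \<and> norm x \<le> \<epsilon> k")
    case False
    then have "\<eta>' k x = 0" using small large by (cases "norm x < \<epsilon> k / 2") auto
    then show ?thesis using C'_nonneg by (simp add: Z_def)
  next
    case True
    have "(norm x)\<^sup>2 \<le> (\<epsilon> k)\<^sup>2" using True by (intro power_mono) auto
    then have q: "\<bar>4 * (x \<bullet> x) / (\<epsilon> k)\<^sup>2\<bar> \<le> 4"
      using \<epsilon>[of k] by (simp add: dot_square_norm divide_simps)
    have "\<bar>\<eta>' k x\<bar> \<le> 4 * 4"
      unfolding \<eta>'_def abs_mult[of "smoothstep' _"] by (rule mult_mono[OF smoothstep_bounds(3) q]) auto
    moreover have "norm x powr (-\<alpha>) \<le> 2 powr \<bar>\<alpha>\<bar> * \<epsilon> k powr (-\<alpha>)"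
      using powr_bound_on_shell[of "\<epsilon> k" "norm x" "-\<alpha>"] \<epsilon>[of k] True by simp
    ultimately have "\<bar>\<eta>' k x\<bar> * norm x powr (-\<alpha>) * \<bar>S x\<bar> \<le> (4*4) * (2 powr \<bar>\<alpha>\<bar> * \<epsilon> k powr (-\<alpha>)) * C"
      using S_bound[OF x] by (intro mult_mono) auto
    then show ?thesis using True by (simp add: Z_def C'_def abs_mult mult_ac)
  qed
  have step: "(\<integral>\<^sup>+x\<in>ball 0 R. ennreal (\<eta> k x * (W x * \<bar>u x\<bar>\<^sup>2 / norm x powr \<alpha>)) \<partial>lborel)
      \<le> weighted_rhs R \<alpha> (laplacian u) + ennreal (C' * unit_ball_vol n * \<epsilon> k powr (n - \<alpha>))" for k
  proof -
    have Zk: "Z k \<in> borel_measurable borel" unfolding Z_def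
      by (intro borel_measurable_times borel_measurable_indicator; simp)
    have facts: "\<epsilon> k / 2 > 0" "\<And>x. Z k x \<ge> 0"
      "\<And>x. 0 \<le> \<eta> k x" "\<And>x. \<eta> k x \<le> 1"
      using \<epsilon>[of k] C'_nonneg by (simp_all add: Z_def \<eta>_def smoothstep_bounds)
    have "(\<integral>\<^sup>+x\<in>ball 0 R. ennreal (\<eta> k x * (W x * \<bar>u x\<bar>\<^sup>2 / norm x powr \<alpha>)) \<partial>lborel)
      \<le> weighted_rhs R \<alpha> (laplacian u) + (\<integral>\<^sup>+x. ennreal (Z k x) \<partial>lborel)"
      by (rule cutoff_estimate[where u = u and \<rho> = \<rho> and a = a and a' = a' and b = b and b' = b' and w = w and w' = w'
          and \<eta> = "\<eta> k" and \<eta>' = "\<eta>' k" and \<epsilon> = "\<epsilon> k / 2" and p = p and W = W and Z = "Z k"])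
        (rule sm \<rho>(2) supp rad \<eta>rad facts Zk \<eta>_meas small W_meas W0 T[unfolded T_def n_def] K[unfolded K_def n_def]
          w[unfolded K_def n_def] E[unfolded K_def n_def] Z_bound[unfolded S_def]; assumption)+
    also have "(\<integral>\<^sup>+x. ennreal (Z k x) \<partial>lborel) = ennreal (C' * unit_ball_vol n * \<epsilon> k powr (n - \<alpha>))"
      unfolding Z_def using \<epsilon>[of k] C'_nonneg
      by (subst nn_integral_shell) (auto simp: n_def powr_diff powr_minus powr_realpow divide_inverse mult_ac)
    finally show ?thesis .
  qed
  have lim: "(\<lambda>k. weighted_rhs R \<alpha> (laplacian u) + ennreal (C' * unit_ball_vol n * \<epsilon> k powr (n - \<alpha>)))
      \<longlonglongrightarrow> weighted_rhs R \<alpha> (laplacian u) + ennreal (C' * unit_ball_vol n * 0)"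
  proof (intro tendsto_intros)
    show "(\<lambda>k. \<epsilon> k powr (n - \<alpha>)) \<longlonglongrightarrow> 0"
      by (rule tendsto_zero_powrI[OF \<epsilon>lim tendsto_const]) (use \<alpha> \<epsilon> in \<open>auto intro!: always_eventually less_imp_le\<close>)
  qed
  have "(\<integral>\<^sup>+x\<in>ball 0 R. ennreal (W x * \<bar>u x\<bar>\<^sup>2 / norm x powr \<alpha>) \<partial>lborel)
      \<le> (\<integral>\<^sup>+x. liminf (\<lambda>k. ennreal (\<eta> k x * (W x * \<bar>u x\<bar>\<^sup>2 / norm x powr \<alpha>)) * indicator (ball 0 R) x) \<partial>lborel)"
  proof (rule nn_integral_mono)
    fix x :: 'a
    show "ennreal (W x * \<bar>u x\<bar>\<^sup>2 / norm x powr \<alpha>) * indicator (ball 0 R) x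
      \<le> liminf (\<lambda>k. ennreal (\<eta> k x * (W x * \<bar>u x\<bar>\<^sup>2 / norm x powr \<alpha>)) * indicator (ball 0 R) x)"
    proof (cases "x = 0")
      case False
      then have "\<forall>\<^sub>F k in sequentially. \<epsilon> k < norm x"
        using order_tendstoD(2)[OF \<epsilon>lim, of "norm x"] by simp
      then have "\<forall>\<^sub>F k in sequentially. ennreal (\<eta> k x * (W x * \<bar>u x\<bar>\<^sup>2 / norm x powr \<alpha>)) * indicator (ball 0 R) x
        = ennreal (W x * \<bar>u x\<bar>\<^sup>2 / norm x powr \<alpha>) * indicator (ball 0 R) x"
        by eventually_elim (simp add: large)
      then show ?thesis
        by (intro Liminf_bounded) (auto elim: eventually_mono)
    qed simp
  qed
  also have "\<dots> \<le> liminf (\<lambda>k. \<integral>\<^sup>+x\<in>ball 0 R. ennreal (\<eta> k x * (W x * \<bar>u x\<bar>\<^sup>2 / norm x powr \<alpha>)) \<partial>lborel)"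
    by (rule nn_integral_liminf) measurable
  also have "\<dots> \<le> liminf (\<lambda>k. weighted_rhs R \<alpha> (laplacian u) + ennreal (C' * unit_ball_vol n * \<epsilon> k powr (n - \<alpha>)))"
    by (intro Liminf_mono always_eventually allI step)
  also have "\<dots> = weighted_rhs R \<alpha> (laplacian u)"
    using lim_imp_Liminf[OF _ lim] by simp
  finally show ?thesis .
qed

section \<open>Coefficients for the two inequalities\<close>

text \<open>Grows from 1 at the origin to infinity at the sphere. Its logarithmic derivative is
  affine in itself, so polynomials in it are preserved by x . grad, and the conditions on the
  coefficients become polynomial inequalities on y > 1.\<close>

definition boundary_weight :: "real \<Rightarrow> real \<Rightarrow> 'a::real_normed_vector \<Rightarrow> real"
  where "boundary_weight R \<gamma> x = 1 / (1 - (norm x / R) powr \<gamma>)"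

lemma boundary_weight_gt_1:
  assumes "x \<in> ball 0 R - {0}" "\<gamma> > 0"
  shows "boundary_weight R \<gamma> x > 1" "0 < (norm x / R) powr \<gamma>" "(norm x / R) powr \<gamma> < 1"
proof -
  have R: "norm x < R" "0 < norm x" using assms(1) by auto
  then have "0 < R" by linarith
  with R have "0 < norm x / R" "norm x / R < 1"
    by (simp_all only: divide_pos_pos divide_less_eq_1_pos)
  then show 1: "0 < (norm x / R) powr \<gamma>" "(norm x / R) powr \<gamma> < 1"
    using powr_less_mono2[OF assms(2), of "norm x / R" 1] by auto
  then show "boundary_weight R \<gamma> x > 1" by (simp add: boundary_weight_def)
qed

lemma boundary_weight_radial_derivative:
  assumes "R > 0" "\<gamma> > 0"
  shows "radial_derivative (ball 0 R - {0}) (boundary_weight R \<gamma> :: 'a::euclidean_space \<Rightarrow> real)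
    (\<lambda>x. \<gamma> * ((boundary_weight R \<gamma> x)\<^sup>2 - boundary_weight R \<gamma> x))"
proof -
  let ?X = "boundary_weight R \<gamma> :: 'a \<Rightarrow> real"
  have d: "(?X has_derivative (\<lambda>h. \<gamma> * ((?X x)\<^sup>2 - ?X x) * (x \<bullet> h) / (x \<bullet> x))) (at x)"
    if x: "x \<in> ball 0 R - {0}" for x
  proof -
    let ?t = "(norm x / R) powr \<gamma>"
    have t: "?t < 1" by (rule boundary_weight_gt_1[OF x assms(2)])
    have eq: "(norm y / R) powr \<gamma> = R powr (-\<gamma>) * norm y powr \<gamma>" for y :: 'a
      using assms by (simp add: powr_divide powr_minus_divide)
    have "((\<lambda>x::'a. (norm x / R) powr \<gamma>) has_derivative (\<lambda>h. ?t * (\<gamma> * (x \<bullet> h) / (x \<bullet> x)))) (at x)"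
      unfolding eq using has_derivative_mult_right[OF has_derivative_norm_powr[of x \<gamma>], of "R powr (-\<gamma>)"] x
      by (simp add: mult_ac)
    moreover have "((\<lambda>s. 1 / (1 - s)) has_real_derivative 1 / (1 - ?t)\<^sup>2) (at ?t)"
      using t by (auto intro!: derivative_eq_intros simp: power2_eq_square)
    ultimately have "(?X has_derivative (\<lambda>h. (?t * (\<gamma> * (x \<bullet> h) / (x \<bullet> x))) * (1 / (1 - ?t)\<^sup>2))) (at x)"
      unfolding boundary_weight_def[abs_def] by (rule DERIV_compose_FDERIV[rotated])
    moreover have "(?X x)\<^sup>2 - ?X x = ?t * (1 / (1 - ?t)\<^sup>2)"
      using t by (simp add: boundary_weight_def divide_simps power2_eq_square)
    ultimately show ?thesis by (simp add: mult_ac)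
  qed
  have "continuous_on (ball 0 R - {0}) ?X"
    using d by (meson continuous_at_imp_continuous_on has_derivative_continuous)
  then have "continuous_on (ball 0 R - {0}) (\<lambda>x. \<gamma> * ((?X x)\<^sup>2 - ?X x))"
    by (intro continuous_intros)
  then show ?thesis using d unfolding radial_derivative_def by blast
qed

lemma radial_derivative_compose:
  assumes "radial_derivative S X X'" "\<And>y. (f has_real_derivative f' y) (at y)" "continuous_on UNIV f'"
  shows "radial_derivative S (\<lambda>x. f (X x)) (\<lambda>x. X' x * f' (X x))"
  unfolding radial_derivative_def
proof (intro conjI ballI)
  fix x assume "x \<in> S"
  then have "(X has_derivative (\<lambda>h. X' x * (x \<bullet> h) / (x \<bullet> x))) (at x)"
    using assms(1) by (auto simp: radial_derivative_def)
  from DERIV_compose_FDERIV[OF assms(2) this]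
  show "((\<lambda>x. f (X x)) has_derivative (\<lambda>h. X' x * f' (X x) * (x \<bullet> h) / (x \<bullet> x))) (at x)"
    by (simp add: mult_ac)
next
  have "continuous_on S (\<lambda>x. f' (X x))"
    by (rule continuous_on_compose2[OF assms(3) radial_derivative_continuous[OF assms(1)]]) auto
  then show "continuous_on S (\<lambda>x. X' x * f' (X x))"
    using assms(1) by (intro continuous_intros) (auto simp: radial_derivative_def)
qed

text \<open>With coefficients that are functions of \<open>y = 1 / (1 - (\<bar>x\<bar> / R)\<^sup>\<gamma>)\<close>, the operator \<open>x \<bullet> \<nabla>\<close> becomes
  \<open>\<gamma> (y\<^sup>2 - y) d/dy\<close>.\<close>
lemma rellich_from_coefficients:
  fixes u :: "'a::euclidean_space \<Rightarrow> real" and R \<alpha> \<gamma> :: real and a a' b b' w w' p W :: "real \<Rightarrow> real"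
  defines "n \<equiv> real DIM('a)"
  defines "d f y \<equiv> \<gamma> * (y\<^sup>2 - y) * f y"
  defines "K y \<equiv> 2 * b y + d a' y - (n + \<alpha> - 4) * a y - (a y)\<^sup>2"
  assumes u: "u \<in> test_functions (ball 0 R)" and R: "R > 0" and \<alpha>: "\<alpha> < n" and \<gamma>: "\<gamma> > 0"
    and der: "\<And>y. (a has_real_derivative a' y) (at y)" "\<And>y. (b has_real_derivative b' y) (at y)"
      "\<And>y. (w has_real_derivative w' y) (at y)"
    and cont: "continuous_on UNIV a'" "continuous_on UNIV b'" "continuous_on UNIV w'"
    and W: "W \<in> borel_measurable borel" "\<And>y. y > 1 \<Longrightarrow> W y \<ge> 0"
    and T: "\<And>y. y > 1 \<Longrightarrow> 2 * b y - d a' y - (n - \<alpha>) * a y \<ge> 0"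
    and K: "\<And>y. y > 1 \<Longrightarrow> K y \<ge> 0"
    and w: "\<And>y. y > 1 \<Longrightarrow> w y = K y * p y + a y * b y - d b' y - (2 - \<alpha>) * b y"
    and E: "\<And>y. y > 1 \<Longrightarrow> W y \<le> d w' y + (n - \<alpha>) * w y - (b y)\<^sup>2 - K y * (p y)\<^sup>2"
  shows "(\<integral>\<^sup>+x\<in>ball 0 R. ennreal (W (boundary_weight R \<gamma> x) * \<bar>u x\<bar>\<^sup>2 / norm x powr \<alpha>) \<partial>lborel)
    \<le> weighted_rhs R \<alpha> (laplacian u)"
proof -
  let ?X = "boundary_weight R \<gamma> :: 'a \<Rightarrow> real"
  let ?d = "\<lambda>f x. \<gamma> * ((?X x)\<^sup>2 - ?X x) * f (?X x)"
  have X1: "?X x > 1" if "x \<in> ball 0 R - {0}" for x by (rule boundary_weight_gt_1[OF that \<gamma>])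
  note rd = radial_derivative_compose[OF boundary_weight_radial_derivative[OF R \<gamma>]]
  have [measurable]: "?X \<in> borel_measurable borel" unfolding boundary_weight_def by measurable
  \<comment> \<open>On a smaller closed ball the boundary weight stays in a compact interval, so
    every continuous coefficient is bounded there.\<close>
  have bdd1: "\<exists>M. \<forall>x\<in>cball 0 \<rho> - {0}. \<bar>f (?X x)\<bar> \<le> M"
    if \<rho>: "\<rho> < R" and f: "\<And>y. (f has_real_derivative f' y) (at y)" for \<rho> f f'
  proof (cases "\<rho> > 0")
    case False
    then have "cball 0 \<rho> - {0::'a} = {}"
      by (auto simp: not_less) (metis norm_le_zero_iff order_trans)
    then show ?thesis by blast
  next
    case True
    let ?Y = "1 / (1 - (\<rho> / R) powr \<gamma>)"
    have t: "(\<rho> / R) powr \<gamma> < 1" using \<rho> R True powr_less_mono2[OF \<gamma>, of "\<rho> / R" 1] by auto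
    have XY: "?X x \<in> {1..?Y}" if x: "x \<in> cball 0 \<rho> - {0}" for x
    proof -
      have "x \<in> ball 0 R - {0}" using x \<rho> by auto
      note b = X1[OF this]
      have "(norm x / R) powr \<gamma> \<le> (\<rho> / R) powr \<gamma>"
        using x R \<gamma> by (intro powr_mono2) (auto simp: divide_right_mono)
      then have "?X x \<le> ?Y" unfolding boundary_weight_def using t by (intro divide_left_mono) auto
      then show ?thesis using b by simp
    qed
    have "continuous_on {1..?Y} f"
      using f by (meson DERIV_isCont continuous_at_imp_continuous_on)
    then have "bounded (f ` {1..?Y})" by (intro compact_imp_bounded compact_continuous_image) auto
    then obtain M where "\<And>y. y \<in> {1..?Y} \<Longrightarrow> \<bar>f y\<bar> \<le> M"
      unfolding bounded_iff real_norm_def by (metis imageI)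
    then show ?thesis using XY by blast
  qed
  show ?thesis
  proof (rule rellich_from_square_completion[OF u R _ rd[OF der(1) cont(1)] rd[OF der(2) cont(2)] rd[OF der(3) cont(3)],
        where p = "\<lambda>x. p (?X x)" and W = "\<lambda>x. W (?X x)"])
    show "\<alpha> < real DIM('a)" using \<alpha> by (simp add: n_def)
    show "(\<lambda>x. W (?X x)) \<in> borel_measurable borel" using W(1) by measurable
    fix \<rho> assume \<rho>: "\<rho> < R"
    obtain Ma Mb Mw where "\<forall>x\<in>cball 0 \<rho> - {0}. \<bar>a (?X x)\<bar> \<le> Ma" "\<forall>x\<in>cball 0 \<rho> - {0}. \<bar>b (?X x)\<bar> \<le> Mb"
      "\<forall>x\<in>cball 0 \<rho> - {0}. \<bar>w (?X x)\<bar> \<le> Mw"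
      using bdd1[OF \<rho> der(1)] bdd1[OF \<rho> der(2)] bdd1[OF \<rho> der(3)] by blast
    then show "\<exists>M. \<forall>x\<in>cball 0 \<rho> - {0}. \<bar>a (?X x)\<bar> \<le> M \<and> \<bar>b (?X x)\<bar> \<le> M \<and> \<bar>w (?X x)\<bar> \<le> M"
      by (intro exI[of _ "max Ma (max Mb Mw)"] ballI conjI) (auto simp: le_max_iff_disj)
  qed (use X1 W T K w E in \<open>auto simp: n_def d_def K_def\<close>)
qed

text \<open>Here \<open>p = - r f' / f\<close> for the radial ground state \<open>f = r\<^sup>-\<^sup>m\<^sup>/\<^sup>2 (1 - (r / R)\<^sup>m)\<close>; with \<open>a = 0\<close> the three
  squares amount to a weighted Hardy inequality combined with the Cauchy-Schwarz inequality.\<close>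
lemma rellich_strict_I:
  fixes u :: "'a::euclidean_space \<Rightarrow> real" and R \<alpha> :: real
  defines "m \<equiv> real DIM('a) - \<alpha>"
  defines "c \<equiv> m * (real DIM('a) + \<alpha> - 4) / 4"
  assumes u: "u \<in> test_functions (ball 0 R)" and R: "R > 0" and \<alpha>: "4 - real DIM('a) < \<alpha>" "\<alpha> < real DIM('a)"
  shows "(\<integral>\<^sup>+x\<in>ball 0 R. ennreal ((c\<^sup>2 * (boundary_weight R m x)\<^sup>2 +
      c * m\<^sup>2 / 2 * boundary_weight R m x * (boundary_weight R m x - 1)) * \<bar>u x\<bar>\<^sup>2 / norm x powr \<alpha>) \<partial>lborel)
    \<le> weighted_rhs R \<alpha> (laplacian u)"
proof -
  have m: "m > 0" and c: "c > 0" using \<alpha> by (auto simp: m_def c_def)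
  have n: "real DIM('a) = m + \<alpha>" by (simp add: m_def)
  have c_eq: "c = m * (m + 2 * \<alpha> - 4) / 4" by (simp add: c_def n)
  \<comment> \<open>Since -c is the eigenvalue of |x|^2 times the Laplacian on |x|^(-m/2), the value
    b = c at y = 1 makes the first square vanish on the virtual extremal at the origin. With a = 0
    both \<open>T\<close> and \<open>K\<close> equal 2 b, and \<open>w\<close> is dictated by its
    equation.\<close>
  show ?thesis
  proof (rule rellich_from_coefficients[OF u R \<alpha>(2) m, where
        a = "\<lambda>_. 0" and a' = "\<lambda>_. 0" and b = "\<lambda>y. c * y" and b' = "\<lambda>_. c" and p = "\<lambda>y. m * (y - 1/2)"
        and w = "\<lambda>y. c * m * y\<^sup>2 - (2 - \<alpha>) * c * y"
        and w' = "\<lambda>y. 2 * c * m * y - (2 - \<alpha>) * c"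
        and W = "\<lambda>y. c\<^sup>2 * y\<^sup>2 + c * m\<^sup>2 / 2 * y * (y - 1)"], goal_cases)
    case (2 y) then show ?case by (auto intro!: derivative_eq_intros)
  next
    case (3 y) then show ?case by (auto intro!: derivative_eq_intros simp: algebra_simps)
  next
    \<comment> \<open>Equality holds here: the cubic terms in y cancel, and 2 c = m (m + 2 \<alpha>
      - 4) / 2 leaves exactly the sharp weight c^2 y^2 and the gap.\<close>
    case (12 y)
    show ?case unfolding n
      by (simp add: c_eq) (simp add: power2_eq_square field_simps)
  next
    case 6 show ?case by (intro continuous_intros)
  next
    case 7 show ?case by measurable
  next
    case (8 y) then show ?case using c m by (intro add_nonneg_nonneg mult_nonneg_nonneg) auto
  next
    case (11 y) show ?case by (simp add: power2_eq_square algebra_simps)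
  qed (use c m in auto)
qed

text \<open>Near the boundary, at distance \<open>\<delta>\<close>, leading coefficients \<open>a = A / \<delta>\<close>, \<open>b = B / \<delta>\<^sup>2\<close> and
  \<open>p = 3 / (2 \<delta>)\<close> reach the sharp constant \<open>9/16\<close> whenever \<open>A = 1/2 + 2 B / 3\<close>. The obvious choice
  \<open>B = 0\<close> (Hardy's inequality applied twice) violates \<open>T \<ge> 0\<close>, the condition governing the tangential
  derivatives, which demands \<open>B \<ge> 3/8\<close>; here \<open>B = 3/4\<close>. The remaining coefficients make \<open>T\<close>, \<open>K\<close> and
  the slack in the last inequality polynomials in \<open>y - 1\<close> with nonnegative coefficients.\<close>
lemma rellich_strict_II:
  fixes u :: "'a::euclidean_space \<Rightarrow> real" and R \<alpha> :: real
  defines "g \<equiv> (real DIM('a) - \<alpha>) / 3"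
  assumes u: "u \<in> test_functions (ball 0 R)" and R: "R > 0" and \<alpha>: "2 \<le> \<alpha>" "\<alpha> < real DIM('a)"
  shows "(\<integral>\<^sup>+x\<in>ball 0 R. ennreal (g ^ 4 * (9/16 * (boundary_weight R g x) ^ 4 + 23/16) * \<bar>u x\<bar>\<^sup>2 / norm x powr \<alpha>) \<partial>lborel)
    \<le> weighted_rhs R \<alpha> (laplacian u)"
proof -
  have g: "g > 0" using \<alpha> by (auto simp: g_def)
  define d where "d = \<alpha> - 2"
  have d: "d \<ge> 0" using \<alpha> by (simp add: d_def)
  have al: "\<alpha> = d + 2" by (simp add: d_def)
  have n: "real DIM('a) = 3 * g + d + 2" by (simp add: g_def d_def field_simps)
  \<comment> \<open>The first square annihilates \<delta>^(3/2) to leading order when 3/4 - (3/2) A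
    + B = 0, which is the relation between A and B; here A = 1. The multiplier
    \<open>3/2 * g * y\<close> is -r f'/f for f = r^(-3g/2) (1 - (r/R)^g)^(3/2), which joins the
    virtual extremals at the origin and at the boundary. The summand of \<open>b\<close> containing
    \<open>d\<close> is chosen to make \<open>K\<close> independent of \<open>d\<close>.\<close>
  define b b' K w w' where "b y = g^2 * (1/2 + 5/2 * (y - 1) + 3/4 * (y - 1)^2) + d * g * (y - 1)"
    and "b' y = g^2 * (5/2 + 3/2 * (y - 1)) + d * g"
    and "K y = g^2 * (1 + 3 * (y - 1) + 3/2 * (y - 1)^2)"
    and "w y = K y * (3/2 * g * y) + g * (y - 1) * b y - g * (y\<^sup>2 - y) * b' y + d * b y"
    and "w' y = 3 * g^2 * y * (3/2 * g * y) + K y * (3/2 * g) + g * b y + g * (y - 1) * b' y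
      - g * (2 * y - 1) * b' y - g * (y\<^sup>2 - y) * (3/2 * g^2) + d * b' y" for y
  note defs = this
  have db: "(b has_real_derivative b' y) (at y)" for y
    unfolding b_def[abs_def] b'_def by (rule derivative_eq_intros refl)+ (simp add: field_simps)
  have db': "(b' has_real_derivative 3/2 * g^2) (at y)" for y
    unfolding b'_def[abs_def] by (rule derivative_eq_intros refl)+ (simp add: field_simps)
  have dK: "(K has_real_derivative 3 * g^2 * y) (at y)" for y
    unfolding K_def[abs_def] by (rule derivative_eq_intros refl)+ (simp add: field_simps)
  have dw: "(w has_real_derivative w' y) (at y)" for y
    unfolding w_def[abs_def] w'_def
    by (rule derivative_eq_intros db db' dK refl)+ (simp add: algebra_simps)
  have Kd: "2 * b y + g * (y\<^sup>2 - y) * g - (real DIM('a) + \<alpha> - 4) * (g * (y - 1)) - (g * (y - 1))\<^sup>2 = K y" for y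
    unfolding defs n al by (simp add: power2_eq_square field_simps)
  \<comment> \<open>Expanded in y - 1, the remainder beside the target weight has nonnegative
    coefficients. At y = 1 and d = 0 the left-hand side is 2 g^4, whence 23/16 = 2 - 9/16.\<close>
  have E: "g * (y\<^sup>2 - y) * w' y + 3 * g * w y - (b y)\<^sup>2 - K y * (3/2 * g * y)\<^sup>2 =
      g ^ 4 * (9/16 * y ^ 4 + 23/16) + 3/4 * g^4 * (y - 1)^2 + g^3 * d * (3/2 + 5 * (y - 1) + (y - 1)^2 / 4)
      + 4 * g^2 * d^2 * (y - 1)" for y
  proof -
    define Y where "Y = y - 1"
    have y: "y = 1 + Y" by (simp add: Y_def)
    show ?thesis unfolding defs y by (simp add: power2_eq_square power3_eq_cube power4_eq_xxxx field_simps)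
  qed
  have c: "continuous_on UNIV b" "continuous_on UNIV b'" "continuous_on UNIV K"
    unfolding b_def[abs_def] b'_def[abs_def] K_def[abs_def] by (intro continuous_intros)+
  show ?thesis
  proof (rule rellich_from_coefficients[OF u R \<alpha>(2) g, where
        a = "\<lambda>y. g * (y - 1)" and a' = "\<lambda>_. g" and b = b and b' = b' and p = "\<lambda>y. 3/2 * g * y"
        and w = w and w' = w' and W = "\<lambda>y. g ^ 4 * (9/16 * y ^ 4 + 23/16)"], goal_cases)
    case (1 y) then show ?case by (auto intro!: derivative_eq_intros)
  next
    case 6 show ?case unfolding w'_def[abs_def] by (intro continuous_intros c)
  next
    case (9 y)
    have "2 * b y - g * (y\<^sup>2 - y) * g - (real DIM('a) - \<alpha>) * (g * (y - 1))
      = g^2 * (1 + (y - 1) + 1/2 * (y - 1)^2) + 2 * d * g * (y - 1)"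
      unfolding defs n al by (simp add: power2_eq_square field_simps)
    moreover have "0 \<le> g^2 * (1 + (y - 1) + 1/2 * (y - 1)^2)" "0 \<le> 2 * d * g * (y - 1)"
      using 9 g d by (auto intro!: mult_nonneg_nonneg)
    ultimately show ?case by simp
  next
    case (10 y)
    have "0 \<le> K y" unfolding K_def using 10 by (auto intro!: mult_nonneg_nonneg)
    then show ?case unfolding Kd .
  next
    case (11 y) show ?case unfolding Kd w_def[of y] by (simp add: al)
  next
    case (12 y)
    have "0 \<le> 3/4 * g^4 * (y - 1)^2" "0 \<le> g^3 * d * (3/2 + 5 * (y - 1) + (y - 1)^2 / 4)" "0 \<le> 4 * g^2 * d^2 * (y - 1)"
      using 12 g d by (auto intro!: mult_nonneg_nonneg add_nonneg_nonneg)
    moreover have "real DIM('a) - \<alpha> = 3 * g" by (simp add: n al)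
    ultimately show ?case unfolding Kd using E[of y] by simp
  next
    case 7 show ?case by measurable
  next
    case (8 y) show ?case by (intro mult_nonneg_nonneg add_nonneg_nonneg) (use 8 in auto)
  qed (rule db dw c continuous_on_const)+
qed

text \<open>Weighted arithmetic-geometric mean for \<open>s\<^sup>G\<close> and \<open>1\<close>.\<close>
lemma boundary_weight_mono:
  assumes "0 < g" "g \<le> G" "x \<in> ball 0 R - {0}"
  shows "g * boundary_weight R g x \<le> G * boundary_weight R G x"
proof -
  let ?s = "norm x / R"
  have "norm x < R" "0 < norm x" using assms(3) by auto
  then have s: "0 < ?s" using order_less_trans by (intro divide_pos_pos) blast+
  have t: "?s powr g < 1" "?s powr G < 1" using boundary_weight_gt_1(3)[OF assms(3)] assms(1,2) by auto
  have "(?s powr G) powr (g / G) * 1 powr (1 - g / G) \<le> (g / G) * ?s powr G + (1 - g / G) * 1"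
    using assms s by (intro Youngs_inequality_0) (auto simp: divide_simps)
  moreover have "(?s powr G) powr (g / G) = ?s powr g" using assms by (simp add: powr_powr)
  ultimately have "?s powr g \<le> (g / G) * ?s powr G + (1 - g / G)" by simp
  from mult_left_mono[OF this, of G] have "G * ?s powr g \<le> g * ?s powr G + (G - g)"
    using assms by (simp add: distrib_left right_diff_distrib)
  then have "g * (1 - ?s powr G) \<le> G * (1 - ?s powr g)" by (simp add: algebra_simps)
  then show ?thesis using t by (simp add: boundary_weight_def divide_simps mult.commute)
qed

section \<open>Passage to the completion\<close>

lemma le_of_le_mult_one_plus:
  assumes "\<And>e. e > 0 \<Longrightarrow> a \<le> ennreal (1 + e) * b"
  shows "a \<le> b"
proof (cases "b = \<infinity>")
  case False
  then obtain r where r: "b = ennreal r" "r \<ge> 0" by (cases b) auto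
  have "(\<lambda>k. ennreal ((1 + 1 / real (Suc k)) * r)) \<longlonglongrightarrow> ennreal ((1 + 0) * r)"
    using LIMSEQ_inverse_real_of_nat by (intro tendsto_intros) (simp add: inverse_eq_divide)
  moreover have "a \<le> ennreal ((1 + 1 / real (Suc k)) * r)" for k
    using assms[of "1 / real (Suc k)"] r by (simp add: ennreal_mult)
  ultimately have "a \<le> ennreal ((1 + 0) * r)" by (intro LIMSEQ_le_const) blast+
  then show ?thesis unfolding r by simp
qed simp

text \<open>Young's inequality takes the place of the triangle inequality: the integrals are squares
  of norms and possibly infinite, and the factor 1 + e can be removed at the end.\<close>

lemma weighted_rhs_perturb:
  assumes [measurable]: "f \<in> borel_measurable borel" "h \<in> borel_measurable borel" and e: "e > 0"
  shows "weighted_rhs R \<alpha> f \<le> ennreal (1 + e) * weighted_rhs R \<alpha> h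
    + ennreal (1 + 1 / e) * weighted_rhs R \<alpha> (\<lambda>x::'a::euclidean_space. f x - h x)"
proof -
  have [measurable]: "ball 0 R \<in> sets (borel :: 'a measure)" by simp
  have sq: "y\<^sup>2 \<le> (1 + e) * z\<^sup>2 + (1 + 1 / e) * (y - z)\<^sup>2" for y z :: real
  proof -
    have "0 \<le> (e * z - (y - z))\<^sup>2 / e" using e by simp
    also have "\<dots> = (1 + e) * z\<^sup>2 + (1 + 1 / e) * (y - z)\<^sup>2 - y\<^sup>2"
      using e by (simp add: power2_eq_square field_simps)
    finally show ?thesis by simp
  qed
  have "weighted_rhs R \<alpha> f \<le> (\<integral>\<^sup>+x. ennreal (1 + e) * (ennreal (\<bar>h x\<bar>\<^sup>2 / norm x powr (\<alpha> - 4)) * indicator (ball 0 R) x)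
      + ennreal (1 + 1 / e) * (ennreal (\<bar>f x - h x\<bar>\<^sup>2 / norm x powr (\<alpha> - 4)) * indicator (ball 0 R) x) \<partial>lborel)"
    unfolding weighted_rhs_def
  proof (rule nn_integral_mono)
    fix x :: 'a
    have "\<bar>f x\<bar>\<^sup>2 / norm x powr (\<alpha> - 4) \<le> ((1 + e) * (h x)\<^sup>2 + (1 + 1 / e) * (f x - h x)\<^sup>2) / norm x powr (\<alpha> - 4)"
      using sq[of "f x" "h x"] by (intro divide_right_mono) auto
    also have "\<dots> = (1 + e) * (\<bar>h x\<bar>\<^sup>2 / norm x powr (\<alpha> - 4)) + (1 + 1 / e) * (\<bar>f x - h x\<bar>\<^sup>2 / norm x powr (\<alpha> - 4))"
      by (simp add: add_divide_distrib)
    finally have "ennreal (\<bar>f x\<bar>\<^sup>2 / norm x powr (\<alpha> - 4)) \<le>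
        ennreal ((1 + e) * (\<bar>h x\<bar>\<^sup>2 / norm x powr (\<alpha> - 4)) + (1 + 1 / e) * (\<bar>f x - h x\<bar>\<^sup>2 / norm x powr (\<alpha> - 4)))"
      by (rule ennreal_leI)
    also have "\<dots> = ennreal ((1 + e) * (\<bar>h x\<bar>\<^sup>2 / norm x powr (\<alpha> - 4)))
        + ennreal ((1 + 1 / e) * (\<bar>f x - h x\<bar>\<^sup>2 / norm x powr (\<alpha> - 4)))"
      by (rule ennreal_plus) (use e in auto)
    also have "ennreal ((1 + e) * (\<bar>h x\<bar>\<^sup>2 / norm x powr (\<alpha> - 4))) = ennreal (1 + e) * ennreal (\<bar>h x\<bar>\<^sup>2 / norm x powr (\<alpha> - 4))"
      by (rule ennreal_mult) (use e in auto)
    also have "ennreal ((1 + 1 / e) * (\<bar>f x - h x\<bar>\<^sup>2 / norm x powr (\<alpha> - 4))) =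
        ennreal (1 + 1 / e) * ennreal (\<bar>f x - h x\<bar>\<^sup>2 / norm x powr (\<alpha> - 4))"
      by (rule ennreal_mult) (use e in auto)
    finally have "ennreal (\<bar>f x\<bar>\<^sup>2 / norm x powr (\<alpha> - 4)) \<le> ennreal (1 + e) * ennreal (\<bar>h x\<bar>\<^sup>2 / norm x powr (\<alpha> - 4))
      + ennreal (1 + 1 / e) * ennreal (\<bar>f x - h x\<bar>\<^sup>2 / norm x powr (\<alpha> - 4))" .
    then show "ennreal (\<bar>f x\<bar>\<^sup>2 / norm x powr (\<alpha> - 4)) * indicator (ball 0 R) x \<le>
      ennreal (1 + e) * (ennreal (\<bar>h x\<bar>\<^sup>2 / norm x powr (\<alpha> - 4)) * indicator (ball 0 R) x)
      + ennreal (1 + 1 / e) * (ennreal (\<bar>f x - h x\<bar>\<^sup>2 / norm x powr (\<alpha> - 4)) * indicator (ball 0 R) x)"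
      by (simp add: indicator_def)
  qed
  also have "\<dots> = (\<integral>\<^sup>+x. ennreal (1 + e) * (ennreal (\<bar>h x\<bar>\<^sup>2 / norm x powr (\<alpha> - 4)) * indicator (ball 0 R) x) \<partial>lborel)
      + (\<integral>\<^sup>+x. ennreal (1 + 1 / e) * (ennreal (\<bar>f x - h x\<bar>\<^sup>2 / norm x powr (\<alpha> - 4)) * indicator (ball 0 R) x) \<partial>lborel)"
    by (rule nn_integral_add) measurable
  also have "(\<integral>\<^sup>+x. ennreal (1 + e) * (ennreal (\<bar>h x\<bar>\<^sup>2 / norm x powr (\<alpha> - 4)) * indicator (ball 0 R) x) \<partial>lborel)
      = ennreal (1 + e) * weighted_rhs R \<alpha> h"
    unfolding weighted_rhs_def by (rule nn_integral_cmult) measurable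
  also have "(\<integral>\<^sup>+x. ennreal (1 + 1 / e) * (ennreal (\<bar>f x - h x\<bar>\<^sup>2 / norm x powr (\<alpha> - 4)) * indicator (ball 0 R) x) \<partial>lborel)
      = ennreal (1 + 1 / e) * weighted_rhs R \<alpha> (\<lambda>x. f x - h x)"
    unfolding weighted_rhs_def by (rule nn_integral_cmult) measurable
  finally show ?thesis .
qed

lemma test_function_measurable:
  assumes "u \<in> test_functions (ball 0 R)"
  shows "u \<in> borel_measurable borel" "laplacian u \<in> borel_measurable borel"
  using assms continuous_on_u continuous_on_laplacian
  by (auto intro!: borel_measurable_continuous_onI simp: test_functions_def)

text \<open>Almost everywhere convergence makes the left side lower semicontinuous; convergence of
  the Laplacians controls the right side up to a factor 1 + e. The inequality is transferred with
  the improved weight \<open>W\<close>, since the gap is what the equality case needs.\<close>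

lemma inequality_on_completion:
  fixes W :: "'a::euclidean_space \<Rightarrow> real"
  assumes ineq: "\<And>u. u \<in> test_functions (ball 0 R) \<Longrightarrow>
      (\<integral>\<^sup>+x\<in>ball 0 R. ennreal (W x * \<bar>u x\<bar>\<^sup>2 / norm x powr \<alpha>) \<partial>lborel) \<le> weighted_rhs R \<alpha> (laplacian u)"
    and W[measurable]: "W \<in> borel_measurable borel"
    and uh: "in_completion R \<alpha> u h"
  shows "(\<integral>\<^sup>+x\<in>ball 0 R. ennreal (W x * \<bar>u x\<bar>\<^sup>2 / norm x powr \<alpha>) \<partial>lborel) \<le> weighted_rhs R \<alpha> h"
proof -
  have [measurable]: "ball 0 R \<in> sets (borel :: 'a measure)" by simp
  have [measurable]: "u \<in> borel_measurable borel" "h \<in> borel_measurable borel"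
    using uh by (auto simp: in_completion_def)
  obtain \<phi> where \<phi>: "\<And>n. \<phi> n \<in> test_functions (ball 0 R)"
    and ae: "AE x in lborel. x \<in> ball 0 R \<longrightarrow> (\<lambda>n. \<phi> n x) \<longlonglongrightarrow> u x"
    and lim: "(\<lambda>n. weighted_rhs R \<alpha> (\<lambda>x. laplacian (\<phi> n) x - h x)) \<longlonglongrightarrow> 0"
    using uh by (auto simp: in_completion_def)
  have [measurable]: "\<phi> n \<in> borel_measurable borel" "laplacian (\<phi> n) \<in> borel_measurable borel" for n
    using test_function_measurable[OF \<phi>] by auto
  let ?I = "\<lambda>v::'a \<Rightarrow> real. \<integral>\<^sup>+x\<in>ball 0 R. ennreal (W x * \<bar>v x\<bar>\<^sup>2 / norm x powr \<alpha>) \<partial>lborel"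
  have "?I u \<le> (\<integral>\<^sup>+x. liminf (\<lambda>n. ennreal (W x * \<bar>\<phi> n x\<bar>\<^sup>2 / norm x powr \<alpha>) * indicator (ball 0 R) x) \<partial>lborel)"
  proof (rule nn_integral_mono_AE, use ae in eventually_elim)
    fix x assume x: "x \<in> ball 0 R \<longrightarrow> (\<lambda>n. \<phi> n x) \<longlonglongrightarrow> u x"
    show "ennreal (W x * \<bar>u x\<bar>\<^sup>2 / norm x powr \<alpha>) * indicator (ball 0 R) x
      \<le> liminf (\<lambda>n. ennreal (W x * \<bar>\<phi> n x\<bar>\<^sup>2 / norm x powr \<alpha>) * indicator (ball 0 R) x)"
    proof (cases "x \<in> ball 0 R \<and> x \<noteq> 0")
      case True
      then have "(\<lambda>n. \<phi> n x) \<longlonglongrightarrow> u x" using x by blast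
      then have "(\<lambda>n. ennreal (W x * \<bar>\<phi> n x\<bar>\<^sup>2 / norm x powr \<alpha>)) \<longlonglongrightarrow> ennreal (W x * \<bar>u x\<bar>\<^sup>2 / norm x powr \<alpha>)"
        using True by (intro tendsto_intros) auto
      then have "liminf (\<lambda>n. ennreal (W x * \<bar>\<phi> n x\<bar>\<^sup>2 / norm x powr \<alpha>)) = ennreal (W x * \<bar>u x\<bar>\<^sup>2 / norm x powr \<alpha>)"
        by (rule lim_imp_Liminf[rotated]) simp
      then show ?thesis using True by simp
    qed auto
  qed
  also have "\<dots> \<le> liminf (\<lambda>n. ?I (\<phi> n))" by (rule nn_integral_liminf) measurable
  finally have 1: "?I u \<le> liminf (\<lambda>n. ?I (\<phi> n))" .
  show ?thesis
  proof (rule le_of_le_mult_one_plus)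
    fix e :: real assume e: "e > 0"
    have "(\<lambda>n. ennreal (1 + e) * weighted_rhs R \<alpha> h
        + ennreal (1 + 1 / e) * weighted_rhs R \<alpha> (\<lambda>x. laplacian (\<phi> n) x - h x))
      \<longlonglongrightarrow> ennreal (1 + e) * weighted_rhs R \<alpha> h + ennreal (1 + 1 / e) * 0"
      by (intro tendsto_intros lim tendsto_mult_ennreal) auto
    then have l: "liminf (\<lambda>n. ennreal (1 + e) * weighted_rhs R \<alpha> h
        + ennreal (1 + 1 / e) * weighted_rhs R \<alpha> (\<lambda>x. laplacian (\<phi> n) x - h x)) = ennreal (1 + e) * weighted_rhs R \<alpha> h"
      using lim_imp_Liminf[OF trivial_limit_sequentially] by fastforce
    have "liminf (\<lambda>n. ?I (\<phi> n)) \<le> liminf (\<lambda>n. ennreal (1 + e) * weighted_rhs R \<alpha> h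
        + ennreal (1 + 1 / e) * weighted_rhs R \<alpha> (\<lambda>x. laplacian (\<phi> n) x - h x))"
      by (intro Liminf_mono always_eventually allI order_trans[OF ineq[OF \<phi>]] weighted_rhs_perturb e) measurable
    then show "?I u \<le> ennreal (1 + e) * weighted_rhs R \<alpha> h" using 1 l by simp
  qed
qed

lemma weighted_lhs_cmult:
  fixes u :: "'a::euclidean_space \<Rightarrow> real"
  assumes [measurable]: "u \<in> borel_measurable borel" and C: "C \<ge> 0"
  shows "ennreal C * weighted_lhs R \<alpha> \<gamma> k u =
    (\<integral>\<^sup>+x\<in>ball 0 R. ennreal (C * (boundary_weight R \<gamma> x) ^ k * \<bar>u x\<bar>\<^sup>2 / norm x powr \<alpha>) \<partial>lborel)"
proof -
  have [measurable]: "ball 0 R \<in> sets (borel :: 'a measure)" by simp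
  have "ennreal C * weighted_lhs R \<alpha> \<gamma> k u =
    (\<integral>\<^sup>+x. ennreal C * (ennreal (\<bar>u x\<bar>\<^sup>2 / (norm x powr \<alpha> * (1 - (norm x / R) powr \<gamma>) ^ k)) * indicator (ball 0 R) x) \<partial>lborel)"
    unfolding weighted_lhs_def by (rule nn_integral_cmult[symmetric]) measurable
  also have "\<dots> = (\<integral>\<^sup>+x\<in>ball 0 R. ennreal (C * (boundary_weight R \<gamma> x) ^ k * \<bar>u x\<bar>\<^sup>2 / norm x powr \<alpha>) \<partial>lborel)"
    using C by (intro nn_integral_cong)
      (auto simp: indicator_def boundary_weight_def power_one_over mult_ac ennreal_mult'[symmetric])
  finally show ?thesis .
qed

text \<open>The weight \<open>W\<close> is split into C y^k and a positive remainder. Under equality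
  the first part already fills the right-hand side; being finite it can be cancelled, so the
  remainder integrates to zero and forces u = 0.\<close>

lemma not_attained_of_strict:
  fixes W :: "'a::euclidean_space \<Rightarrow> real"
  assumes ineq: "\<And>u. u \<in> test_functions (ball 0 R) \<Longrightarrow>
      (\<integral>\<^sup>+x\<in>ball 0 R. ennreal (W x * \<bar>u x\<bar>\<^sup>2 / norm x powr \<alpha>) \<partial>lborel) \<le> weighted_rhs R \<alpha> (laplacian u)"
    and W[measurable]: "W \<in> borel_measurable borel" and \<gamma>: "\<gamma> > 0"
    and C: "C \<ge> 0" and strict: "\<And>x. x \<in> ball 0 R - {0} \<Longrightarrow> C * (boundary_weight R \<gamma> x) ^ k < W x"
  shows "not_attained TYPE('a) R \<alpha> \<gamma> k C"
  unfolding not_attained_def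
proof (intro allI impI notI)
  fix u h :: "'a \<Rightarrow> real"
  assume uh: "in_completion R \<alpha> u h" and nz: "\<not> (AE x in lborel. x \<in> ball 0 R \<longrightarrow> u x = 0)"
    and fin: "weighted_rhs R \<alpha> h < \<infinity>" and eq: "ennreal C * weighted_lhs R \<alpha> \<gamma> k u = weighted_rhs R \<alpha> h"
  have [measurable]: "ball 0 R \<in> sets (borel :: 'a measure)" by simp
  have u[measurable]: "u \<in> borel_measurable borel" using uh by (auto simp: in_completion_def)
  have [measurable]: "boundary_weight R \<gamma> \<in> borel_measurable (borel :: 'a measure)"
    unfolding boundary_weight_def by measurable
  let ?B = "boundary_weight R \<gamma>"
  define A where "A = ball 0 R - {0::'a}"
  have [measurable]: "A \<in> sets borel" by (simp add: A_def)
  let ?F = "\<lambda>x. C * ?B x ^ k * \<bar>u x\<bar>\<^sup>2 / norm x powr \<alpha> * indicator A x"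
  let ?G = "\<lambda>x. (W x - C * ?B x ^ k) * \<bar>u x\<bar>\<^sup>2 / norm x powr \<alpha> * indicator A x"
  have nn: "?F x \<ge> 0" "?G x \<ge> 0" for x
    using strict[of x] boundary_weight_gt_1(1)[of x R \<gamma>] \<gamma> C by (auto simp: indicator_def A_def)
  have ae0: "AE x in lborel. x \<noteq> (0::'a)" by (rule AE_lborel_singleton)
  have F: "ennreal C * weighted_lhs R \<alpha> \<gamma> k u = (\<integral>\<^sup>+x. ennreal (?F x) \<partial>lborel)"
    unfolding weighted_lhs_cmult[OF u C]
    by (rule nn_integral_cong_AE, use ae0 in eventually_elim) (auto simp: indicator_def A_def)
  have I: "(\<integral>\<^sup>+x\<in>ball 0 R. ennreal (W x * \<bar>u x\<bar>\<^sup>2 / norm x powr \<alpha>) \<partial>lborel) = (\<integral>\<^sup>+x. ennreal (?F x) + ennreal (?G x) \<partial>lborel)"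
  proof (rule nn_integral_cong_AE, use ae0 in eventually_elim)
    fix x :: 'a assume "x \<noteq> 0"
    then have eq: "W x * \<bar>u x\<bar>\<^sup>2 / norm x powr \<alpha> * indicator (ball 0 R) x = ?F x + ?G x"
      by (simp add: indicator_def A_def left_diff_distrib diff_divide_distrib)
    have "ennreal (W x * \<bar>u x\<bar>\<^sup>2 / norm x powr \<alpha>) * indicator (ball 0 R) x = ennreal (W x * \<bar>u x\<bar>\<^sup>2 / norm x powr \<alpha> * indicator (ball 0 R) x)"
      by (simp add: indicator_def)
    also have "\<dots> = ennreal (?F x) + ennreal (?G x)" unfolding eq by (rule ennreal_plus[OF nn])
    finally show "ennreal (W x * \<bar>u x\<bar>\<^sup>2 / norm x powr \<alpha>) * indicator (ball 0 R) x = ennreal (?F x) + ennreal (?G x)" .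
  qed
  have "(\<integral>\<^sup>+x. ennreal (?F x) \<partial>lborel) + (\<integral>\<^sup>+x. ennreal (?G x) \<partial>lborel) = (\<integral>\<^sup>+x. ennreal (?F x) + ennreal (?G x) \<partial>lborel)"
    by (rule nn_integral_add[symmetric]) measurable
  also have "\<dots> \<le> (\<integral>\<^sup>+x. ennreal (?F x) \<partial>lborel)"
    using inequality_on_completion[OF ineq W uh] eq unfolding I F by simp
  finally have "(\<integral>\<^sup>+x. ennreal (?F x) \<partial>lborel) + (\<integral>\<^sup>+x. ennreal (?G x) \<partial>lborel) \<le> (\<integral>\<^sup>+x. ennreal (?F x) \<partial>lborel) + 0"
    by simp
  moreover have "(\<integral>\<^sup>+x. ennreal (?F x) \<partial>lborel) \<noteq> \<infinity>" using fin eq unfolding F by auto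
  ultimately have "(\<integral>\<^sup>+x. ennreal (?G x) \<partial>lborel) = 0"
    unfolding ennreal_add_left_cancel_le by simp
  then have "AE x in lborel. ennreal (?G x) = 0"
    by (subst (asm) nn_integral_0_iff_AE) measurable
  then have "AE x in lborel. x \<in> ball 0 R \<longrightarrow> u x = 0"
    using ae0
  proof eventually_elim
    fix x :: 'a assume G: "ennreal (?G x) = 0" and x0: "x \<noteq> 0"
    show "x \<in> ball 0 R \<longrightarrow> u x = 0"
    proof
      assume x: "x \<in> ball 0 R"
      have "?G x = 0" using G nn(2)[of x] by (simp add: ennreal_eq_0_iff)
      moreover have "W x - C * ?B x ^ k > 0" using strict[of x] x x0 by simp
      ultimately show "u x = 0" using x x0 by (simp add: A_def)
    qed
  qed
  then show False using nz by blast
qed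

lemma rellich_inequality_of_weight:
  fixes W :: "'a::euclidean_space \<Rightarrow> real"
  assumes ineq: "\<And>u. u \<in> test_functions (ball 0 R) \<Longrightarrow>
      (\<integral>\<^sup>+x\<in>ball 0 R. ennreal (W x * \<bar>u x\<bar>\<^sup>2 / norm x powr \<alpha>) \<partial>lborel) \<le> weighted_rhs R \<alpha> (laplacian u)"
    and C: "C \<ge> 0" and le: "\<And>x. x \<in> ball 0 R - {0} \<Longrightarrow> C * (boundary_weight R \<gamma> x) ^ k \<le> W x"
  shows "rellich_inequality TYPE('a) R \<alpha> \<gamma> k C"
  unfolding rellich_inequality_def
proof (intro allI impI)
  fix u :: "'a \<Rightarrow> real" assume u: "u \<in> test_functions (ball 0 R)"
  have ae0: "AE x in lborel. x \<noteq> (0::'a)" by (rule AE_lborel_singleton)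
  have "ennreal C * weighted_lhs R \<alpha> \<gamma> k u \<le> (\<integral>\<^sup>+x\<in>ball 0 R. ennreal (W x * \<bar>u x\<bar>\<^sup>2 / norm x powr \<alpha>) \<partial>lborel)"
    unfolding weighted_lhs_cmult[OF test_function_measurable(1)[OF u] C]
    by (rule nn_integral_mono_AE, use ae0 in eventually_elim)
      (auto simp: indicator_def intro!: ennreal_leI divide_right_mono mult_right_mono le)
  also have "\<dots> \<le> weighted_rhs R \<alpha> (laplacian u)" by (rule ineq[OF u])
  finally show "ennreal C * weighted_lhs R \<alpha> \<gamma> k u \<le> weighted_rhs R \<alpha> (laplacian u)" .
qed

section \<open>The inequalities for all admissible exponents, and non-attainment\<close>

lemma rellich_inequality_I:
  assumes R: "R > 0" and \<alpha>: "4 - real DIM('a::euclidean_space) < \<alpha>" and \<gamma>: "\<gamma> > 0" "\<alpha> \<le> real DIM('a) - \<gamma>"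
  shows "rellich_inequality TYPE('a) R \<alpha> \<gamma> 2 (((real DIM('a) + \<alpha> - 4) / 4 * \<gamma>)\<^sup>2)"
proof -
  let ?m = "real DIM('a) - \<alpha>" and ?p = "real DIM('a) + \<alpha> - 4"
  let ?c = "?m * ?p / 4"
  have \<alpha>2: "\<alpha> < real DIM('a)" and m: "\<gamma> \<le> ?m" "?m > 0" using \<gamma> by auto
  show ?thesis
  proof (rule rellich_inequality_of_weight[OF rellich_strict_I[OF _ R \<alpha> \<alpha>2]])
    fix x :: 'a assume x: "x \<in> ball 0 R - {0}"
    let ?X = "boundary_weight R \<gamma> x" and ?Y = "boundary_weight R ?m x"
    have 1: "?Y > 1" "?X > 1" using boundary_weight_gt_1(1)[OF x] m \<gamma> by auto
    \<comment> \<open>The required weight, constant included, depends on \<gamma> only through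
      \<gamma> times the boundary weight, so this comparison with \<gamma> = N - \<alpha> is
      enough.\<close>
    have "\<gamma> * ?X \<le> ?m * ?Y" by (rule boundary_weight_mono[OF \<gamma>(1) m(1) x])
    then have "(?p / 4) * (\<gamma> * ?X) \<le> (?p / 4) * (?m * ?Y)" using \<alpha> by (intro mult_left_mono) auto
    then have "((?p / 4) * (\<gamma> * ?X))\<^sup>2 \<le> ((?p / 4) * (?m * ?Y))\<^sup>2" using \<alpha> \<gamma> 1 by (intro power_mono) auto
    moreover have "0 \<le> ?c * ?m\<^sup>2 / 2 * ?Y * (?Y - 1)" using 1 m \<alpha> by (intro mult_nonneg_nonneg divide_nonneg_nonneg) auto
    ultimately show "((?p / 4 * \<gamma>)\<^sup>2) * ?X\<^sup>2 \<le> ?c\<^sup>2 * ?Y\<^sup>2 + ?c * ?m\<^sup>2 / 2 * ?Y * (?Y - 1)"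
      by (simp add: power_mult_distrib mult_ac power_divide)
  qed simp_all
qed

lemma not_attained_I:
  assumes R: "R > 0" and \<alpha>: "4 - real DIM('a::euclidean_space) < \<alpha>" "\<alpha> < real DIM('a)"
  shows "not_attained TYPE('a) R \<alpha> (real DIM('a) - \<alpha>) 2 (((real DIM('a) - \<alpha>) * (real DIM('a) + \<alpha> - 4) / 4)\<^sup>2)"
proof -
  let ?m = "real DIM('a) - \<alpha>" and ?p = "real DIM('a) + \<alpha> - 4"
  let ?c = "?m * ?p / 4"
  show ?thesis
  proof (rule not_attained_of_strict[OF rellich_strict_I[OF _ R \<alpha>]])
    fix x :: 'a assume x: "x \<in> ball 0 R - {0}"
    let ?Y = "boundary_weight R ?m x"
    have "?Y > 1" using boundary_weight_gt_1(1)[OF x] \<alpha> by auto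
    moreover have "?c > 0" using \<alpha> by simp
    \<comment> \<open>The gap tends to zero only at the origin, which is where the constant is
      sharp.\<close>
    ultimately have "0 < ?c * ?m\<^sup>2 / 2 * ?Y * (?Y - 1)" using \<alpha> by (intro mult_pos_pos divide_pos_pos) auto
    then show "?c\<^sup>2 * ?Y\<^sup>2 < ?c\<^sup>2 * ?Y\<^sup>2 + ?c * ?m\<^sup>2 / 2 * ?Y * (?Y - 1)" by simp
  qed (use \<alpha> in \<open>simp_all add: boundary_weight_def\<close>)
qed

lemma strict_weight_II:
  fixes x :: "'a::euclidean_space"
  assumes \<gamma>: "\<gamma> > 0" "3 * \<gamma> \<le> m" and x: "x \<in> ball 0 R - {0}"
  shows "(3 / 4 * \<gamma>\<^sup>2)\<^sup>2 * boundary_weight R \<gamma> x ^ 4 < (m/3) ^ 4 * (9/16 * (boundary_weight R (m/3) x) ^ 4 + 23/16)"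
proof -
  let ?X = "boundary_weight R \<gamma> x" and ?Y = "boundary_weight R (m/3) x"
  have 1: "?X > 1" using boundary_weight_gt_1(1)[OF x] \<gamma> by auto
  have "\<gamma> * ?X \<le> m/3 * ?Y" using boundary_weight_mono[OF \<gamma>(1) _ x, of "m/3"] \<gamma> by simp
  then have "(\<gamma> * ?X) ^ 4 \<le> (m/3 * ?Y) ^ 4" using \<gamma> 1 by (intro power_mono) auto
  \<comment> \<open>For \<gamma> = m/3 the two fourth powers coincide, and only the additive term
    with this factor makes the comparison strict.\<close>
  moreover have "(m/3) ^ 4 > 0" using \<gamma> by (intro zero_less_power) auto
  ultimately have "9/16 * (\<gamma> * ?X) ^ 4 < 9/16 * (m/3 * ?Y) ^ 4 + 23/16 * (m/3) ^ 4" by linarith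
  then show ?thesis by (simp add: power_mult_distrib distrib_left power_divide power_mult[symmetric] mult_ac)
qed

lemma rellich_inequality_II:
  assumes R: "R > 0" and \<alpha>: "2 \<le> \<alpha>" and \<gamma>: "\<gamma> > 0" "\<alpha> \<le> real DIM('a::euclidean_space) - 3 * \<gamma>"
  shows "rellich_inequality TYPE('a) R \<alpha> \<gamma> 4 ((3 / 4 * \<gamma>\<^sup>2)\<^sup>2)"
    and "not_attained TYPE('a) R \<alpha> \<gamma> 4 ((3 / 4 * \<gamma>\<^sup>2)\<^sup>2)"
proof -
  have \<alpha>2: "\<alpha> < real DIM('a)" using \<gamma> by auto
  note s = rellich_strict_II[OF _ R \<alpha> \<alpha>2]
  have l: "(3 / 4 * \<gamma>\<^sup>2)\<^sup>2 * boundary_weight R \<gamma> x ^ 4 <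
      ((real DIM('a) - \<alpha>)/3) ^ 4 * (9/16 * (boundary_weight R ((real DIM('a) - \<alpha>)/3) x) ^ 4 + 23/16)"
    if "x \<in> ball 0 R - {0}" for x :: 'a
    using strict_weight_II[OF \<gamma>(1) _ that] \<gamma>(2) by simp
  show "rellich_inequality TYPE('a) R \<alpha> \<gamma> 4 ((3 / 4 * \<gamma>\<^sup>2)\<^sup>2)"
    by (rule rellich_inequality_of_weight[OF s]) (use l less_imp_le in auto)
  show "not_attained TYPE('a) R \<alpha> \<gamma> 4 ((3 / 4 * \<gamma>\<^sup>2)\<^sup>2)"
    by (rule not_attained_of_strict[OF s]) (use l \<gamma> in \<open>auto simp: boundary_weight_def\<close>)
qed

section \<open>Trial functions\<close>

text \<open>Differentiating exp (-1/x) produces powers of 1/x; carrying them along makes the family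
  closed under differentiation up to linear combinations.\<close>

definition flat_exp :: "nat \<Rightarrow> real \<Rightarrow> real"
  where "flat_exp j x = (if x > 0 then inverse x ^ j * exp (- inverse x) else 0)"

lemma flat_exp_has_derivative:
  "(flat_exp j has_real_derivative flat_exp (j + 2) x - real j * flat_exp (j + 1) x) (at x)"
proof -
  consider "x < 0" | "x > 0" | "x = 0" by linarith
  then show ?thesis
  proof cases
    case 1
    have "(flat_exp j has_real_derivative 0) (at x)"
      by (rule has_field_derivative_transform_within_open[of "\<lambda>_. 0" _ _ "{..<0}"])
        (use 1 in \<open>auto simp: flat_exp_def\<close>)
    then show ?thesis using 1 by (simp add: flat_exp_def)
  next
    case 2
    have "((\<lambda>x. inverse x ^ j * exp (- inverse x)) has_real_derivative
        inverse x ^ (j + 2) * exp (- inverse x) - real j * (inverse x ^ (j + 1) * exp (- inverse x))) (at x)"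
    proof (cases j)
      case 0
      then show ?thesis using 2 by (auto intro!: derivative_eq_intros simp: power2_eq_square)
    next
      case (Suc i)
      then show ?thesis using 2
        by (auto intro!: derivative_eq_intros simp: power2_eq_square algebra_simps) (cases i; simp)
    qed
    then have "(flat_exp j has_real_derivative
        inverse x ^ (j + 2) * exp (- inverse x) - real j * (inverse x ^ (j + 1) * exp (- inverse x))) (at x)"
      by (rule has_field_derivative_transform_within_open[of _ _ _ "{0<..}"])
        (use 2 in \<open>auto simp: flat_exp_def\<close>)
    then show ?thesis using 2 by (simp add: flat_exp_def)
  next
    case 3
    \<comment> \<open>At 0 the left difference quotients vanish, and the right ones are a power of
      1/h divided by exp (1/h), which tends to 0.\<close>
    have l: "((\<lambda>h. flat_exp j h / h) \<longlongrightarrow> 0) (at_left 0)"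
      by (rule tendsto_eventually) (auto simp: flat_exp_def eventually_at_left_field intro!: exI[of _ "-1"])
    have "((\<lambda>h::real. inverse h ^ (j + 1) / exp (inverse h)) \<longlongrightarrow> 0) (at_right 0)"
      by (rule filterlim_compose[OF tendsto_power_div_exp_0 filterlim_inverse_at_top_right])
    moreover have "\<forall>\<^sub>F h in at_right 0. inverse h ^ (j + 1) / exp (inverse h) = flat_exp j h / h"
      by (auto simp: flat_exp_def eventually_at_right_field exp_minus divide_inverse intro!: exI[of _ 1])
    ultimately have r: "((\<lambda>h. flat_exp j h / h) \<longlongrightarrow> 0) (at_right 0)"
      by (rule Lim_transform_eventually)
    have "((\<lambda>h. flat_exp j h / h) \<longlongrightarrow> 0) (at 0)" using l r by (rule filterlim_split_at)
    then show ?thesis using 3 by (simp add: DERIV_def flat_exp_def)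
  qed
qed

text \<open>The linear span of these products is closed under differentiation and its members vanish
  off (0,1), so derivatives of every order are bounded and supported where the bump is.\<close>

inductive_set bumps :: "(real \<Rightarrow> real) set" where
  base: "(\<lambda>s. flat_exp i s * flat_exp j (1 - s)) \<in> bumps"
| add: "f \<in> bumps \<Longrightarrow> g \<in> bumps \<Longrightarrow> (\<lambda>s. f s + g s) \<in> bumps"
| cmult: "f \<in> bumps \<Longrightarrow> (\<lambda>s. c * f s) \<in> bumps"

lemma bumps_derivative: "f \<in> bumps \<Longrightarrow> \<exists>f'\<in>bumps. \<forall>s. (f has_real_derivative f' s) (at s)"
proof (induction rule: bumps.induct)
  case (base i j)
  let ?f' = "\<lambda>s. (flat_exp (i + 2) s * flat_exp j (1 - s) + (- real i) * (flat_exp (i + 1) s * flat_exp j (1 - s)))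
    + ((-1) * (flat_exp i s * flat_exp (j + 2) (1 - s)) + real j * (flat_exp i s * flat_exp (j + 1) (1 - s)))"
  have "?f' \<in> bumps" by (intro bumps.intros)
  moreover have "((\<lambda>s. flat_exp i s * flat_exp j (1 - s)) has_real_derivative ?f' s) (at s)" for s
  proof -
    have "((\<lambda>s. flat_exp j (1 - s)) has_real_derivative
        (flat_exp (j + 2) (1 - s) - real j * flat_exp (j + 1) (1 - s)) * (-1)) (at s)"
      by (rule DERIV_chain2[OF flat_exp_has_derivative]) (auto intro!: derivative_eq_intros)
    from DERIV_mult[OF flat_exp_has_derivative[of i s] this]
    show ?thesis by (rule DERIV_cong) (simp add: algebra_simps)
  qed
  ultimately show ?case by (intro bexI[where x = ?f'] allI)
next
  case (add f g)
  then obtain f' g' where "f' \<in> bumps" "g' \<in> bumps" "\<And>s. (f has_real_derivative f' s) (at s)"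
    "\<And>s. (g has_real_derivative g' s) (at s)" by blast
  then show ?case by (intro bexI[where x = "\<lambda>s. f' s + g' s"] allI DERIV_add bumps.add)
next
  case (cmult f c)
  then obtain f' where "f' \<in> bumps" "\<And>s. (f has_real_derivative f' s) (at s)" by blast
  then show ?case by (intro bexI[where x = "\<lambda>s. c * f' s"] allI DERIV_cmult bumps.cmult)
qed

lemma bumps_support: "f \<in> bumps \<Longrightarrow> s \<notin> {0<..<1} \<Longrightarrow> f s = 0"
  by (induction rule: bumps.induct) (auto simp: flat_exp_def)

lemma bumps_continuous: "f \<in> bumps \<Longrightarrow> continuous_on A f"
  using bumps_derivative by (meson DERIV_isCont continuous_at_imp_continuous_on)

lemma bumps_bounded: assumes "f \<in> bumps" shows "\<exists>M\<ge>0. \<forall>s. \<bar>f s\<bar> \<le> M"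
proof -
  have "bounded (f ` {0..1})"
    by (intro compact_imp_bounded compact_continuous_image bumps_continuous assms) auto
  then obtain M where M: "\<And>s. s \<in> {0..1} \<Longrightarrow> \<bar>f s\<bar> \<le> M"
    unfolding bounded_iff real_norm_def by (metis imageI)
  have "\<bar>f s\<bar> \<le> max M 0" for s
    using M[of s] bumps_support[OF assms, of s] by (cases "s \<in> {0<..<1}") auto
  then show ?thesis by (intro exI[of _ "max M 0"]) auto
qed

text \<open>Trial functions for optimality: the virtual extremal \<open>t\<^sup>A\<close> cut off on the logarithmic scale, with
  \<open>c \<rightarrow> 0\<close> spreading the cutoff over longer and longer ranges of \<open>ln t\<close>. They are used with
  \<open>t = \<bar>x\<bar>\<^sup>2 / R\<^sup>2\<close> at the origin and \<open>t = 1 - \<bar>x\<bar>\<^sup>2 / R\<^sup>2\<close> at the boundary.\<close>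

definition log_profile :: "real \<Rightarrow> real \<Rightarrow> real \<Rightarrow> (real \<Rightarrow> real) \<Rightarrow> real \<Rightarrow> real"
  where "log_profile c d A f t = (if t > 0 then t powr A * f (c * ln t + d) else 0)"

lemma log_profile_has_derivative:
  assumes f: "f \<in> bumps" "\<And>s. (f has_real_derivative f' s) (at s)" and c: "c \<noteq> 0"
  shows "(log_profile c d A f has_real_derivative log_profile c d (A - 1) (\<lambda>s. A * f s + c * f' s) t) (at t)"
proof (cases "t > 0")
  case True
  have "((\<lambda>t. f (c * ln t + d)) has_real_derivative f' (c * ln t + d) * (c / t)) (at t)"
    by (rule DERIV_chain2[OF f(2)]) (use True in \<open>auto intro!: derivative_eq_intros\<close>)
  from DERIV_mult[OF has_real_derivative_powr[OF True, of A] this]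
  have "((\<lambda>t. t powr A * f (c * ln t + d)) has_real_derivative
      log_profile c d (A - 1) (\<lambda>s. A * f s + c * f' s) t) (at t)"
    by (rule DERIV_cong) (use True in \<open>simp add: log_profile_def powr_diff field_simps\<close>)
  then show ?thesis
    by (rule has_field_derivative_transform_within_open[of _ _ _ "{0<..}"])
      (use True in \<open>auto simp: log_profile_def\<close>)
next
  case False
  \<comment> \<open>Below \<open>e\<close> the profile vanishes: as t decreases to 0, the argument c
    ln t + d leaves (0,1) through 0 if c > 0 and through 1 if c < 0.\<close>
  define e where "e = (if c > 0 then exp (- d / c) else exp ((1 - d) / c))"
  have e: "e > 0" by (simp add: e_def)
  have z: "log_profile c d A f s = 0" if "s < e" for s
  proof (cases "s > 0")
    case True
    have "c * ln s + d \<notin> {0<..<1}"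
    proof (cases "c > 0")
      case c0: True
      have "ln s < - d / c" using that True c0 by (metis e_def exp_gt_zero ln_exp ln_less_cancel_iff)
      then show ?thesis using c0 by (simp add: field_simps)
    next
      case c0: False
      have "ln s < (1 - d) / c" using that True c0 by (metis e_def exp_gt_zero ln_exp ln_less_cancel_iff)
      then show ?thesis using c0 c by (simp add: field_simps)
    qed
    then show ?thesis using bumps_support[OF f(1)] by (simp add: log_profile_def)
  qed (simp add: log_profile_def)
  have "(log_profile c d A f has_real_derivative 0) (at t)"
    by (rule has_field_derivative_transform_within_open[of "\<lambda>_. 0" _ _ "{..<e}"])
      (use False e z in auto)
  then show ?thesis using False by (simp add: log_profile_def)
qed

text \<open>A polynomial in the coordinates, unlike the norm, so composing a profile with it creates
  no singularity at the origin. One form covers both |x|^2/R^2 and 1 - |x|^2/R^2.\<close>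

definition radial_quadratic :: "real \<Rightarrow> real \<Rightarrow> 'a::euclidean_space \<Rightarrow> real"
  where "radial_quadratic k0 k1 x = k0 + k1 * (x \<bullet> x)"

text \<open>Contains the trial functions and is closed under partial derivatives, since the
  derivative of a profile is a multiple of a coordinate times another profile. Smoothness then
  follows by induction on the list of directions.\<close>

inductive_set profile_algebra :: "real \<Rightarrow> real \<Rightarrow> real \<Rightarrow> real \<Rightarrow> ('a::euclidean_space \<Rightarrow> real) set"
  for c d k0 k1 :: real where
  const: "(\<lambda>x. a) \<in> profile_algebra c d k0 k1"
| coord: "(\<lambda>x. x \<bullet> b) \<in> profile_algebra c d k0 k1"
| profile: "f \<in> bumps \<Longrightarrow> (\<lambda>x. log_profile c d A f (radial_quadratic k0 k1 x)) \<in> profile_algebra c d k0 k1"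
| plus: "u \<in> profile_algebra c d k0 k1 \<Longrightarrow> v \<in> profile_algebra c d k0 k1 \<Longrightarrow> (\<lambda>x. u x + v x) \<in> profile_algebra c d k0 k1"
| times: "u \<in> profile_algebra c d k0 k1 \<Longrightarrow> v \<in> profile_algebra c d k0 k1 \<Longrightarrow> (\<lambda>x. u x * v x) \<in> profile_algebra c d k0 k1"

lemma radial_quadratic_has_derivative:
  "(radial_quadratic k0 k1 has_derivative (\<lambda>h. 2 * k1 * (x \<bullet> h))) (at x)"
  unfolding radial_quadratic_def[abs_def]
  by (rule derivative_eq_intros refl)+ (simp add: fun_eq_iff inner_commute)

lemma radial_profile_has_derivative:
  assumes "\<And>t. (g has_real_derivative g' t) (at t)"
  shows "((\<lambda>x. g (radial_quadratic k0 k1 x)) has_derivative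
    (\<lambda>h. 2 * k1 * (x \<bullet> h) * g' (radial_quadratic k0 k1 x))) (at x)"
  by (rule DERIV_compose_FDERIV[OF assms radial_quadratic_has_derivative])

lemma partial_deriv_eq: "(u has_derivative D) (at x) \<Longrightarrow> partial_deriv b u x = D b"
  by (simp add: partial_deriv_def frechet_derivative_at[symmetric])

lemma profile_algebra_derivative:
  assumes c: "c \<noteq> 0" and u: "u \<in> profile_algebra c d k0 k1"
  shows "\<exists>D. (\<forall>x. (u has_derivative D x) (at x)) \<and> (\<forall>b. (\<lambda>x. D x b) \<in> profile_algebra c d k0 k1)"
  using u
proof (induction rule: profile_algebra.induct)
  case (const a)
  show ?case by (intro exI[of _ "\<lambda>x h. 0"]) (auto intro: profile_algebra.const)
next
  case (coord b)
  have "((\<lambda>x. x \<bullet> b) has_derivative (\<lambda>h. h \<bullet> b)) (at x)" for x :: 'a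
    by (rule derivative_eq_intros refl)+ simp
  then show ?case by (intro exI[of _ "\<lambda>x h. h \<bullet> b"]) (auto intro: profile_algebra.const)
next
  case (profile f A)
  obtain f' where f': "f' \<in> bumps" "\<And>s. (f has_real_derivative f' s) (at s)"
    using bumps_derivative[OF profile] by blast
  let ?q = "radial_quadratic k0 k1 :: 'a \<Rightarrow> real"
  let ?g = "log_profile c d (A - 1) (\<lambda>s. A * f s + c * f' s)"
  have "((\<lambda>x. log_profile c d A f (?q x)) has_derivative (\<lambda>h. 2 * k1 * (x \<bullet> h) * ?g (?q x))) (at x)" for x
    by (rule radial_profile_has_derivative) (rule log_profile_has_derivative[OF profile f'(2) c])
  moreover have "(\<lambda>x. 2 * k1 * (x \<bullet> b) * ?g (?q x)) \<in> profile_algebra c d k0 k1" for b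
    by (intro profile_algebra.intros bumps.add bumps.cmult profile f'(1))
  ultimately show ?case by (intro exI[of _ "\<lambda>x h. 2 * k1 * (x \<bullet> h) * ?g (?q x)"]) blast
next
  case (plus u v)
  then obtain D E where "\<And>x. (u has_derivative D x) (at x)" "\<And>b. (\<lambda>x. D x b) \<in> profile_algebra c d k0 k1"
    "\<And>x. (v has_derivative E x) (at x)" "\<And>b. (\<lambda>x. E x b) \<in> profile_algebra c d k0 k1" by blast
  then show ?case
    by (intro exI[of _ "\<lambda>x h. D x h + E x h"]) (auto intro: has_derivative_add profile_algebra.plus)
next
  case (times u v)
  then obtain D E where D: "\<And>x. (u has_derivative D x) (at x)" "\<And>b. (\<lambda>x. D x b) \<in> profile_algebra c d k0 k1"
    and E: "\<And>x. (v has_derivative E x) (at x)" "\<And>b. (\<lambda>x. E x b) \<in> profile_algebra c d k0 k1" by blast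
  show ?case
    by (intro exI[of _ "\<lambda>x h. u x * E x h + D x h * v x"] conjI allI has_derivative_mult
        profile_algebra.plus profile_algebra.times D E times.hyps)
qed

lemma profile_algebra_smooth:
  assumes c: "c \<noteq> 0" and u: "u \<in> profile_algebra c d k0 k1"
  shows "smooth u"
proof -
  have "foldr partial_deriv bs u \<in> profile_algebra c d k0 k1" for bs
  proof (induction bs)
    case (Cons b bs)
    obtain D where D: "\<And>x. (foldr partial_deriv bs u has_derivative D x) (at x)"
      "(\<lambda>x. D x b) \<in> profile_algebra c d k0 k1"
      using profile_algebra_derivative[OF c Cons] by blast
    have "partial_deriv b (foldr partial_deriv bs u) = (\<lambda>x. D x b)"
      using partial_deriv_eq[OF D(1)] by blast
    then show ?case using D(2) by simp
  qed (use u in simp)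
  then show ?thesis unfolding smooth_def
    by (meson profile_algebra_derivative[OF c] differentiableI differentiable_at_imp_differentiable_on)
qed

lemma laplacian_radial_profile:
  fixes x :: "'a::euclidean_space" and k0 k1 :: real
  assumes g: "\<And>t. (g has_real_derivative g' t) (at t)" "\<And>t. (g' has_real_derivative g'' t) (at t)"
  defines "q \<equiv> radial_quadratic k0 k1 :: 'a \<Rightarrow> real"
  shows "laplacian (\<lambda>x. g (q x)) x = 4 * k1\<^sup>2 * (x \<bullet> x) * g'' (q x) + 2 * k1 * real DIM('a) * g' (q x)"
proof -
  have 1: "partial_deriv b (\<lambda>x. g (q x)) = (\<lambda>x. 2 * k1 * (x \<bullet> b) * g' (q x))" for b
    unfolding q_def using partial_deriv_eq[OF radial_profile_has_derivative[OF g(1)]] by blast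
  have 2: "partial_deriv b (\<lambda>x. 2 * k1 * (x \<bullet> b) * g' (q x)) x = 2 * k1 * (b \<bullet> b) * g' (q x) + 4 * k1\<^sup>2 * (x \<bullet> b)\<^sup>2 * g'' (q x)"
    for b
  proof -
    have "((\<lambda>x. 2 * k1 * (x \<bullet> b) * g' (q x)) has_derivative
      (\<lambda>h. 2 * k1 * (x \<bullet> b) * (2 * k1 * (x \<bullet> h) * g'' (q x)) + 2 * k1 * (h \<bullet> b) * g' (q x))) (at x)"
      unfolding q_def
      by (rule has_derivative_mult[OF _ radial_profile_has_derivative[OF g(2)]])
        (auto intro!: derivative_eq_intros)
    from partial_deriv_eq[OF this] show ?thesis by (simp add: power2_eq_square algebra_simps)
  qed
  have "laplacian (\<lambda>x. g (q x)) x = (\<Sum>b\<in>Basis. 2 * k1 * g' (q x) + 4 * k1\<^sup>2 * g'' (q x) * (x \<bullet> b)\<^sup>2)"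
    unfolding laplacian_def 1 2 by (intro sum.cong refl) (simp add: inner_Basis)
  also have "\<dots> = 2 * k1 * real DIM('a) * g' (q x) + 4 * k1\<^sup>2 * g'' (q x) * (\<Sum>b\<in>Basis. (x \<bullet> b)\<^sup>2)"
    by (simp add: sum.distrib sum_distrib_left)
  also have "(\<Sum>b\<in>Basis. (x \<bullet> b)\<^sup>2) = x \<bullet> x"
    using euclidean_inner[of x x] by (simp add: power2_eq_square)
  finally show ?thesis by simp
qed

lemma log_profile_test_function:
  fixes c d A k0 k1 :: real and f :: "real \<Rightarrow> real"
  defines "u \<equiv> \<lambda>x::'a::euclidean_space. log_profile c d A f (radial_quadratic k0 k1 x)"
  assumes c: "c \<noteq> 0" and f: "f \<in> bumps" and \<rho>: "\<rho> < R"
    and supp: "\<And>x::'a. norm x > \<rho> \<Longrightarrow> u x = 0"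
  shows "u \<in> test_functions (ball 0 R)"
proof -
  have "smooth u" unfolding u_def by (rule profile_algebra_smooth[OF c profile_algebra.profile[OF f]])
  moreover have "closure {x. u x \<noteq> 0} \<subseteq> cball 0 \<rho>"
    by (rule closure_minimal) (use supp in \<open>auto simp: not_less[symmetric]\<close>)
  moreover from this have "compact (closure {x. u x \<noteq> 0})"
    by (meson bounded_cball bounded_subset closed_closure compact_eq_bounded_closed)
  moreover have "cball (0::'a) \<rho> \<subseteq> ball 0 R" using \<rho> by auto
  ultimately show ?thesis unfolding test_functions_def by blast
qed

section \<open>Radial integrals and reduction to one variable\<close>

lemma nn_integral_norm:
  fixes F :: "real \<Rightarrow> ennreal"
  assumes [measurable]: "F \<in> borel_measurable borel"
  shows "(\<integral>\<^sup>+x. F (norm (x::'a::euclidean_space)) \<partial>lborel) =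
    (\<integral>\<^sup>+r. F r * ennreal (real DIM('a) * unit_ball_vol (DIM('a)) * r ^ (DIM('a) - 1)) * indicator {0..} r \<partial>lborel)"
proof -
  let ?N = "DIM('a)"
  let ?V = "unit_ball_vol (real ?N)"
  let ?d = "\<lambda>r. ennreal (real ?N * ?V * r ^ (?N - 1)) * indicator {0..} r"
  \<comment> \<open>Both measures give \<open>{..a}\<close> the volume of the ball of radius a, and
    these rays generate the Borel sets; polar coordinates are obtained without a surface
    measure.\<close>
  have eq: "distr (lborel :: 'a measure) borel norm = density lborel ?d"
  proof (rule measure_eqI_generator_eq[where E = "range (\<lambda>a::real. {..a})" and A = "\<lambda>i. {..real i}" and \<Omega> = UNIV])
    show "Int_stable (range (\<lambda>a::real. {..a}))" by (auto simp: Int_stable_def)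
    show e: "emeasure (distr (lborel :: 'a measure) borel norm) X = emeasure (density lborel ?d) X"
      if X0: "X \<in> range (\<lambda>a::real. {..a})" for X
    proof -
      obtain a where X: "X = {..a}" using X0 by blast
      have 1: "emeasure (distr (lborel :: 'a measure) borel norm) X = emeasure lborel (cball (0::'a) a)"
        unfolding X by (subst emeasure_distr) (auto intro!: arg_cong[where f = "emeasure lborel"])
      have 2: "emeasure (density lborel ?d) X = (\<integral>\<^sup>+r. ennreal (real ?N * ?V * r ^ (?N - 1)) * indicator {0..a} r \<partial>lborel)"
        unfolding X by (subst emeasure_density) (auto intro!: nn_integral_cong simp: indicator_def)
      show ?thesis
      proof (cases "a \<ge> 0")
        case True
        have "(\<integral>\<^sup>+r. ennreal (real ?N * ?V * r ^ (?N - 1)) * indicator {0..a} r \<partial>lborel) = ?V * a ^ ?N - ?V * 0 ^ ?N"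
        proof (rule nn_integral_FTC_Icc)
          show "((\<lambda>r. ?V * r ^ ?N) has_real_derivative real ?N * ?V * r ^ (?N - 1)) (at r)" for r
            by (rule derivative_eq_intros refl)+ simp
        qed (use True in auto)
        then show ?thesis unfolding 1 2 using True by (simp add: emeasure_cball)
      next
        case False
        then show ?thesis unfolding 1 2 by simp
      qed
    qed
    show "sets (distr (lborel :: 'a measure) borel norm) = sigma_sets UNIV (range (\<lambda>a::real. {..a}))"
      "sets (density lborel ?d) = sigma_sets UNIV (range (\<lambda>a::real. {..a}))"
      by (simp_all add: borel_eq_atMost)
    show "(\<Union>i. {..real i}) = UNIV" using real_arch_simple by auto
    show "emeasure (distr (lborel :: 'a measure) borel norm) {..real i} \<noteq> \<infinity>" for i
    proof -
      have "emeasure (distr (lborel :: 'a measure) borel norm) {..real i} = emeasure lborel (cball (0::'a) (real i))"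
        by (subst emeasure_distr) (auto intro!: arg_cong[where f = "emeasure lborel"])
      then show ?thesis by (simp add: emeasure_cball)
    qed
  qed auto
  have "(\<integral>\<^sup>+x. F (norm (x::'a)) \<partial>lborel) = (\<integral>\<^sup>+r. F r \<partial>distr (lborel :: 'a measure) borel norm)"
    by (subst nn_integral_distr) auto
  also have "\<dots> = (\<integral>\<^sup>+r. ?d r * F r \<partial>lborel)"
    unfolding eq by (subst nn_integral_density) auto
  finally show ?thesis by (simp add: mult_ac)
qed

text \<open>The new variable \<open>s\<close> will be the argument of the bump, so that the scale
  parameter is left only in the coefficients of functions on the fixed interval [0,1].\<close>

lemma nn_integral_norm_substitution:
  fixes F :: "real \<Rightarrow> ennreal" and \<rho> \<rho>' :: "real \<Rightarrow> real"
  assumes F[measurable]: "F \<in> borel_measurable borel"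
    and supp: "\<And>r. r \<ge> 0 \<Longrightarrow> r \<notin> {\<rho> 0..\<rho> 1} \<Longrightarrow> F r = 0" and \<rho>0: "0 \<le> \<rho> 0"
    and der: "\<And>s. s \<in> {0..1} \<Longrightarrow> (\<rho> has_real_derivative \<rho>' s) (at s)"
    and cont: "continuous_on {0..1} \<rho>'" and nonneg: "\<And>s. s \<in> {0..1} \<Longrightarrow> \<rho>' s \<ge> 0"
  shows "(\<integral>\<^sup>+x. F (norm (x::'a::euclidean_space)) \<partial>lborel) =
    (\<integral>\<^sup>+s. F (\<rho> s) * ennreal (real DIM('a) * unit_ball_vol (DIM('a)) * \<rho> s ^ (DIM('a) - 1)) * ennreal (\<rho>' s) * indicator {0..1} s \<partial>lborel)"
proof -
  let ?G = "\<lambda>r. F r * ennreal (real DIM('a) * unit_ball_vol (DIM('a)) * r ^ (DIM('a) - 1))"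
  have "(\<integral>\<^sup>+x. F (norm (x::'a)) \<partial>lborel) = (\<integral>\<^sup>+r. ?G r * indicator {\<rho> 0..\<rho> 1} r \<partial>lborel)"
    unfolding nn_integral_norm[OF F]
    by (intro nn_integral_cong) (use supp \<rho>0 in \<open>force simp: indicator_def\<close>)
  also have "\<dots> = (\<integral>\<^sup>+s. ?G (\<rho> s) * ennreal (\<rho>' s) * indicator {0..1} s \<partial>lborel)"
    by (rule nn_integral_substitution_aux[OF _ _ der cont nonneg]) auto
  finally show ?thesis .
qed

text \<open>\<open>D\<close> collects what both sides have in common, such as the area of the unit
  sphere and the scale of the logarithmic range, and cancels. One-sided bounds \<open>a\<close> and
  \<open>b\<close> are enough for testing.\<close>

lemma radial_rellich_test:
  fixes u :: "'a::euclidean_space \<Rightarrow> real" and \<rho> \<rho>' a b Fl Fr :: "real \<Rightarrow> real"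
  defines "w s \<equiv> real DIM('a) * unit_ball_vol (DIM('a)) * \<rho> s ^ (DIM('a) - 1) * \<rho>' s"
  assumes rellich: "rellich_inequality TYPE('a) R \<alpha> \<gamma> k C" and u: "u \<in> test_functions (ball 0 R)"
    and lhs: "\<And>x. x \<in> ball 0 R \<Longrightarrow> \<bar>u x\<bar>\<^sup>2 / (norm x powr \<alpha> * (1 - (norm x / R) powr \<gamma>) ^ k) = Fl (norm x)"
    and rhs: "\<And>x. x \<in> ball 0 R \<Longrightarrow> \<bar>laplacian u x\<bar>\<^sup>2 / norm x powr (\<alpha> - 4) = Fr (norm x)"
    and meas[measurable]: "Fl \<in> borel_measurable borel" "Fr \<in> borel_measurable borel"
      "a \<in> borel_measurable borel" "b \<in> borel_measurable borel"
    and supp: "\<And>r. r \<ge> 0 \<Longrightarrow> r \<notin> {\<rho> 0..\<rho> 1} \<Longrightarrow> Fl r = 0" "\<And>r. r \<ge> 0 \<Longrightarrow> r \<notin> {\<rho> 0..\<rho> 1} \<Longrightarrow> Fr r = 0"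
    and \<rho>01: "0 \<le> \<rho> 0" "\<rho> 1 < R"
    and der: "\<And>s. s \<in> {0..1} \<Longrightarrow> (\<rho> has_real_derivative \<rho>' s) (at s)"
    and cont: "continuous_on {0..1} \<rho>'" and nonneg: "\<And>s. s \<in> {0..1} \<Longrightarrow> \<rho>' s \<ge> 0" "\<And>s. s \<in> {0..1} \<Longrightarrow> \<rho> s \<ge> 0"
    and D: "D > 0"
    and low: "\<And>s. s \<in> {0..1} \<Longrightarrow> D * a s \<le> Fl (\<rho> s) * w s"
    and up: "\<And>s. s \<in> {0..1} \<Longrightarrow> Fr (\<rho> s) * w s \<le> D * b s"
  shows "ennreal C * (\<integral>\<^sup>+s\<in>{0..1}. ennreal (a s) \<partial>lborel) \<le> (\<integral>\<^sup>+s\<in>{0..1}. ennreal (b s) \<partial>lborel)"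
proof -
  let ?V = "\<lambda>r. real DIM('a) * unit_ball_vol (DIM('a)) * r ^ (DIM('a) - 1)"
  have conv: "ennreal (F (\<rho> s)) * ennreal (?V (\<rho> s)) * ennreal (\<rho>' s) = ennreal (F (\<rho> s) * w s)"
    if "s \<in> {0..1}" for F s
    using nonneg[OF that] unfolding w_def
    by (simp add: ennreal_mult''[symmetric] mult.assoc)
  have "weighted_lhs R \<alpha> \<gamma> k u = (\<integral>\<^sup>+x. ennreal (Fl (norm (x::'a))) \<partial>lborel)"
    unfolding weighted_lhs_def
  proof (rule nn_integral_cong)
    fix x :: 'a
    show "ennreal (\<bar>u x\<bar>\<^sup>2 / (norm x powr \<alpha> * (1 - (norm x / R) powr \<gamma>) ^ k)) * indicator (ball 0 R) x = ennreal (Fl (norm x))"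
      using lhs[of x] supp(1)[of "norm x"] \<rho>01 by (cases "x \<in> ball 0 R") auto
  qed
  also have "\<dots> = (\<integral>\<^sup>+s. ennreal (Fl (\<rho> s)) * ennreal (?V (\<rho> s)) * ennreal (\<rho>' s) * indicator {0..1} s \<partial>lborel)"
    by (rule nn_integral_norm_substitution) (use supp \<rho>01 der cont nonneg in auto)
  also have "\<dots> \<ge> (\<integral>\<^sup>+s. ennreal D * (ennreal (a s) * indicator {0..1} s) \<partial>lborel)"
  proof (rule nn_integral_mono)
    fix s :: real
    show "ennreal D * (ennreal (a s) * indicator {0..1} s) \<le> ennreal (Fl (\<rho> s)) * ennreal (?V (\<rho> s)) * ennreal (\<rho>' s) * indicator {0..1} s"
      using low[of s] conv[of s Fl] D by (cases "s \<in> {0..1}") (auto simp: ennreal_mult'[symmetric] intro!: ennreal_leI)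
  qed
  finally have 1: "ennreal D * (\<integral>\<^sup>+s\<in>{0..1}. ennreal (a s) \<partial>lborel) \<le> weighted_lhs R \<alpha> \<gamma> k u"
    by (simp add: nn_integral_cmult)
  have "weighted_rhs R \<alpha> (laplacian u) = (\<integral>\<^sup>+x. ennreal (Fr (norm (x::'a))) \<partial>lborel)"
    unfolding weighted_rhs_def
  proof (rule nn_integral_cong)
    fix x :: 'a
    show "ennreal (\<bar>laplacian u x\<bar>\<^sup>2 / norm x powr (\<alpha> - 4)) * indicator (ball 0 R) x = ennreal (Fr (norm x))"
      using rhs[of x] supp(2)[of "norm x"] \<rho>01 by (cases "x \<in> ball 0 R") auto
  qed
  also have "\<dots> = (\<integral>\<^sup>+s. ennreal (Fr (\<rho> s)) * ennreal (?V (\<rho> s)) * ennreal (\<rho>' s) * indicator {0..1} s \<partial>lborel)"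
    by (rule nn_integral_norm_substitution) (use supp \<rho>01 der cont nonneg in auto)
  also have "\<dots> \<le> (\<integral>\<^sup>+s. ennreal D * (ennreal (b s) * indicator {0..1} s) \<partial>lborel)"
  proof (rule nn_integral_mono)
    fix s :: real
    show "ennreal (Fr (\<rho> s)) * ennreal (?V (\<rho> s)) * ennreal (\<rho>' s) * indicator {0..1} s \<le> ennreal D * (ennreal (b s) * indicator {0..1} s)"
      using up[of s] conv[of s Fr] D by (cases "s \<in> {0..1}") (auto simp: ennreal_mult'[symmetric] intro!: ennreal_leI)
  qed
  finally have 2: "weighted_rhs R \<alpha> (laplacian u) \<le> ennreal D * (\<integral>\<^sup>+s\<in>{0..1}. ennreal (b s) \<partial>lborel)"
    by (simp add: nn_integral_cmult)
  have "ennreal D * (ennreal C * (\<integral>\<^sup>+s\<in>{0..1}. ennreal (a s) \<partial>lborel)) = ennreal C * (ennreal D * (\<integral>\<^sup>+s\<in>{0..1}. ennreal (a s) \<partial>lborel))"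
    by (simp add: mult_ac)
  also have "\<dots> \<le> ennreal C * weighted_lhs R \<alpha> \<gamma> k u" by (rule mult_left_mono[OF 1]) simp
  also have "\<dots> \<le> weighted_rhs R \<alpha> (laplacian u)" using rellich u unfolding rellich_inequality_def by blast
  also note 2
  finally show ?thesis using D by (simp add: ennreal_mult_le_mult_iff)
qed

definition bump :: "real \<Rightarrow> real"
  where "bump s = flat_exp 0 s * flat_exp 0 (1 - s)"

lemma bump_in_bumps: "bump \<in> bumps"
  unfolding bump_def[abs_def] by (rule bumps.base)

lemma bump_nonneg: "bump s \<ge> 0"
  by (simp add: bump_def flat_exp_def)

lemma bump_pos: "s \<in> {0<..<1} \<Longrightarrow> bump s > 0"
  by (simp add: bump_def flat_exp_def)

text \<open>As \<epsilon> tends to 0 the hypothesis becomes C a I \<le> l^2 I, where I is the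
  integral of the squared bump, finite and positive. In the applications \<open>l\<close> is the
  leading coefficient of the Laplacian on the virtual extremal and \<open>a\<close> that of the
  weight on the left.\<close>

lemma concentration_limit:
  assumes C: "C \<ge> 0" and a: "a > 0"
    and main: "\<And>\<epsilon>. 0 < \<epsilon> \<Longrightarrow> \<epsilon> < 1 \<Longrightarrow>
      ennreal C * (\<integral>\<^sup>+s\<in>{0..1}. ennreal ((a - \<epsilon>) * (bump s)\<^sup>2) \<partial>lborel)
        \<le> (\<integral>\<^sup>+s\<in>{0..1}. ennreal ((1 + \<epsilon>) * (l * bump s + \<epsilon>)\<^sup>2) \<partial>lborel)"
    and l: "l \<ge> 0"
  shows "C * a \<le> l\<^sup>2"
proof -
  obtain M where M: "M \<ge> 0" "\<And>s. \<bar>bump s\<bar> \<le> M" using bumps_bounded[OF bump_in_bumps] by blast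
  have [measurable]: "bump \<in> borel_measurable borel"
    by (rule borel_measurable_continuous_onI) (rule bumps_continuous[OF bump_in_bumps])
  let ?I = "\<integral>\<^sup>+s\<in>{0..1}. ennreal ((bump s)\<^sup>2) \<partial>lborel"
  have "(bump s)\<^sup>2 \<le> M\<^sup>2" for s using power_mono[OF M(2)[of s], of 2] by simp
  then have "?I \<le> (\<integral>\<^sup>+s. ennreal (M\<^sup>2) * indicator {0..1::real} s \<partial>lborel)"
    by (intro nn_integral_mono mult_right_mono ennreal_leI) auto
  also have "\<dots> < \<infinity>" by (simp add: nn_integral_cmult_indicator ennreal_mult_less_top)
  finally have fin: "?I < \<infinity>" .
  define J where "J = enn2real ?I"
  have J: "?I = ennreal J" "J \<ge> 0" using fin by (auto simp: J_def)
  have "J \<noteq> 0"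
  proof
    assume "J = 0"
    then have "?I = 0" using J by simp
    then have "AE s in lborel. ennreal ((bump s)\<^sup>2) * indicator {0..1} s = 0"
      by (subst (asm) nn_integral_0_iff_AE) auto
    then have "AE s in lborel. s \<notin> {0<..<1::real}"
    proof eventually_elim
      fix s :: real assume s: "ennreal ((bump s)\<^sup>2) * indicator {0..1} s = 0"
      show "s \<notin> {0<..<1}"
      proof
        assume "s \<in> {0<..<1}"
        then have "bump s > 0" "s \<in> {0..1}" using bump_pos by auto
        then show False using s by (simp add: ennreal_eq_0_iff)
      qed
    qed
    then have "emeasure lborel {0<..<1::real} = 0"
      by (subst (asm) AE_iff_measurable[of "{0<..<1}"]) auto
    then show False by simp
  qed
  then have Jpos: "J > 0" using J(2) by simp
  \<comment> \<open>\<open>\<epsilon> * Q\<close> bounds the cross term and the term \<epsilon>^2 of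
    the expanded square, since \<epsilon> < 1.\<close>
  define Q where "Q = 2 * l * M + 1"
  have Q: "Q \<ge> 0" using l M(1) by (simp add: Q_def)
  have bound: "C * ((a - \<epsilon>) * J) \<le> (1 + \<epsilon>) * (l\<^sup>2 * J + \<epsilon> * Q)" if \<epsilon>: "0 < \<epsilon>" "\<epsilon> < 1" "\<epsilon> < a" for \<epsilon>
  proof -
    have "(\<integral>\<^sup>+s\<in>{0..1}. ennreal ((1 + \<epsilon>) * (l * bump s + \<epsilon>)\<^sup>2) \<partial>lborel)
      \<le> (\<integral>\<^sup>+s. ennreal ((1 + \<epsilon>) * l\<^sup>2) * (ennreal ((bump s)\<^sup>2) * indicator {0..1} s)
        + ennreal ((1 + \<epsilon>) * (\<epsilon> * Q)) * indicator {0..1} s \<partial>lborel)"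
    proof (rule nn_integral_mono)
      fix s :: real
      have "2 * l * bump s * \<epsilon> \<le> 2 * l * M * \<epsilon>" using M(2)[of s] l \<epsilon> by (intro mult_right_mono mult_left_mono) auto
      moreover have "\<epsilon> * \<epsilon> \<le> 1 * \<epsilon>" using \<epsilon> by (intro mult_right_mono) auto
      ultimately have "(l * bump s + \<epsilon>)\<^sup>2 \<le> l\<^sup>2 * (bump s)\<^sup>2 + \<epsilon> * Q"
        by (simp add: power2_eq_square Q_def algebra_simps)
      then have "(1 + \<epsilon>) * (l * bump s + \<epsilon>)\<^sup>2 \<le> (1 + \<epsilon>) * (l\<^sup>2 * (bump s)\<^sup>2 + \<epsilon> * Q)"
        using \<epsilon> by (intro mult_left_mono) auto
      then have "ennreal ((1 + \<epsilon>) * (l * bump s + \<epsilon>)\<^sup>2) \<le> ennreal ((1 + \<epsilon>) * l\<^sup>2 * (bump s)\<^sup>2 + (1 + \<epsilon>) * (\<epsilon> * Q))"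
        by (intro ennreal_leI) (simp add: algebra_simps)
      also have "\<dots> = ennreal ((1 + \<epsilon>) * l\<^sup>2 * (bump s)\<^sup>2) + ennreal ((1 + \<epsilon>) * (\<epsilon> * Q))"
        by (rule ennreal_plus) (use \<epsilon> Q in auto)
      also have "ennreal ((1 + \<epsilon>) * l\<^sup>2 * (bump s)\<^sup>2) = ennreal ((1 + \<epsilon>) * l\<^sup>2) * ennreal ((bump s)\<^sup>2)"
        by (rule ennreal_mult) (use \<epsilon> in auto)
      finally show "ennreal ((1 + \<epsilon>) * (l * bump s + \<epsilon>)\<^sup>2) * indicator {0..1} s
        \<le> ennreal ((1 + \<epsilon>) * l\<^sup>2) * (ennreal ((bump s)\<^sup>2) * indicator {0..1} s) + ennreal ((1 + \<epsilon>) * (\<epsilon> * Q)) * indicator {0..1} s"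
        by (simp add: indicator_def)
    qed
    also have "\<dots> = (\<integral>\<^sup>+s. ennreal ((1 + \<epsilon>) * l\<^sup>2) * (ennreal ((bump s)\<^sup>2) * indicator {0..1} s) \<partial>lborel)
        + (\<integral>\<^sup>+s. ennreal ((1 + \<epsilon>) * (\<epsilon> * Q)) * indicator {0..1::real} s \<partial>lborel)"
      by (rule nn_integral_add) measurable
    also have "(\<integral>\<^sup>+s. ennreal ((1 + \<epsilon>) * l\<^sup>2) * (ennreal ((bump s)\<^sup>2) * indicator {0..1} s) \<partial>lborel) = ennreal ((1 + \<epsilon>) * l\<^sup>2) * ennreal J"
      unfolding J(1)[symmetric] by (rule nn_integral_cmult) measurable
    also have "(\<integral>\<^sup>+s. ennreal ((1 + \<epsilon>) * (\<epsilon> * Q)) * indicator {0..1::real} s \<partial>lborel) = ennreal ((1 + \<epsilon>) * (\<epsilon> * Q))"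
      by (simp add: nn_integral_cmult_indicator)
    also have "ennreal ((1 + \<epsilon>) * l\<^sup>2) * ennreal J + ennreal ((1 + \<epsilon>) * (\<epsilon> * Q)) = ennreal ((1 + \<epsilon>) * l\<^sup>2 * J + (1 + \<epsilon>) * (\<epsilon> * Q))"
    proof -
      have "ennreal ((1 + \<epsilon>) * l\<^sup>2) * ennreal J = ennreal ((1 + \<epsilon>) * l\<^sup>2 * J)"
        by (rule ennreal_mult[symmetric]) (use \<epsilon> J(2) in auto)
      moreover have "ennreal ((1 + \<epsilon>) * l\<^sup>2 * J) + ennreal ((1 + \<epsilon>) * (\<epsilon> * Q)) = ennreal ((1 + \<epsilon>) * l\<^sup>2 * J + (1 + \<epsilon>) * (\<epsilon> * Q))"
        by (rule ennreal_plus[symmetric]) (use \<epsilon> J(2) Q in auto)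
      ultimately show ?thesis by simp
    qed
    finally have R: "(\<integral>\<^sup>+s\<in>{0..1}. ennreal ((1 + \<epsilon>) * (l * bump s + \<epsilon>)\<^sup>2) \<partial>lborel) \<le> ennreal ((1 + \<epsilon>) * (l\<^sup>2 * J + \<epsilon> * Q))"
      unfolding distrib_left[of "1 + \<epsilon>"] mult.assoc .
    have "(\<integral>\<^sup>+s\<in>{0..1}. ennreal ((a - \<epsilon>) * (bump s)\<^sup>2) \<partial>lborel) = (\<integral>\<^sup>+s. ennreal (a - \<epsilon>) * (ennreal ((bump s)\<^sup>2) * indicator {0..1} s) \<partial>lborel)"
      using \<epsilon> by (intro nn_integral_cong) (simp add: ennreal_mult mult.assoc)
    also have "\<dots> = ennreal (a - \<epsilon>) * ennreal J" unfolding J(1)[symmetric] by (rule nn_integral_cmult) measurable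
    also have "\<dots> = ennreal ((a - \<epsilon>) * J)" using \<epsilon> J(2) by (simp add: ennreal_mult)
    finally have "ennreal (C * ((a - \<epsilon>) * J)) \<le> ennreal ((1 + \<epsilon>) * (l\<^sup>2 * J + \<epsilon> * Q))"
      using order_trans[OF main[OF \<epsilon>(1,2)] R] unfolding ennreal_mult'[OF C] by simp
    moreover have "0 \<le> (1 + \<epsilon>) * (l\<^sup>2 * J + \<epsilon> * Q)" using \<epsilon> J(2) Q by simp
    ultimately show ?thesis by (simp add: ennreal_le_iff)
  qed
  have "((\<lambda>\<epsilon>. C * ((a - \<epsilon>) * J)) \<longlongrightarrow> C * ((a - 0) * J)) (at_right 0)"
    by (intro tendsto_intros)
  moreover have "((\<lambda>\<epsilon>. (1 + \<epsilon>) * (l\<^sup>2 * J + \<epsilon> * Q)) \<longlongrightarrow> (1 + 0) * (l\<^sup>2 * J + 0 * Q)) (at_right 0)"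
    by (intro tendsto_intros)
  moreover have "\<forall>\<^sub>F \<epsilon> in at_right 0. C * ((a - \<epsilon>) * J) \<le> (1 + \<epsilon>) * (l\<^sup>2 * J + \<epsilon> * Q)"
    unfolding eventually_at_right_field using a bound by (intro exI[of _ "min 1 a"]) simp
  ultimately have "C * ((a - 0) * J) \<le> (1 + 0) * (l\<^sup>2 * J + 0 * Q)"
    by (intro tendsto_le[of "at_right (0::real)"]) auto
  then show ?thesis using Jpos by (simp add: mult.assoc[symmetric])
qed

section \<open>Optimality of the constants\<close>

lemma log_profile_exp:
  assumes "c \<noteq> 0"
  shows "log_profile c d A f (exp ((s - d) / c)) = exp ((s - d) / c) powr A * f s"
  using assms by (simp add: log_profile_def)

lemma log_profile_eq_0:
  assumes "f \<in> bumps" "t > 0 \<Longrightarrow> c * ln t + d \<notin> {0<..<1}"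
  shows "log_profile c d A f t = 0"
  using assms bumps_support[OF assms(1)] by (simp add: log_profile_def)

lemma log_profile_measurable:
  assumes "f \<in> bumps" "c \<noteq> 0"
  shows "log_profile c d A f \<in> borel_measurable borel"
proof -
  obtain f' where "f' \<in> bumps" "\<And>s. (f has_real_derivative f' s) (at s)" using bumps_derivative[OF assms(1)] by blast
  then have "continuous_on UNIV (log_profile c d A f)"
    using log_profile_has_derivative[OF assms(1) _ assms(2)] by (meson DERIV_isCont continuous_at_imp_continuous_on)
  then show ?thesis by (rule borel_measurable_continuous_onI)
qed

lemma bump_profile_data:
  obtains f1 f2 M1 M2 where "f1 \<in> bumps" "f2 \<in> bumps" "\<And>s. (bump has_real_derivative f1 s) (at s)"
    "\<And>s. (f1 has_real_derivative f2 s) (at s)" "M1 \<ge> 0" "M2 \<ge> 0" "\<And>s. \<bar>f1 s\<bar> \<le> M1" "\<And>s. \<bar>f2 s\<bar> \<le> M2"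
proof -
  obtain f1 where f1: "f1 \<in> bumps" "\<And>s. (bump has_real_derivative f1 s) (at s)"
    using bumps_derivative[OF bump_in_bumps] by blast
  obtain f2 where f2: "f2 \<in> bumps" "\<And>s. (f1 has_real_derivative f2 s) (at s)"
    using bumps_derivative[OF f1(1)] by blast
  obtain M1 where "M1 \<ge> 0" "\<And>s. \<bar>f1 s\<bar> \<le> M1" using bumps_bounded[OF f1(1)] by blast
  moreover obtain M2 where "M2 \<ge> 0" "\<And>s. \<bar>f2 s\<bar> \<le> M2" using bumps_bounded[OF f2(1)] by blast
  ultimately show thesis using f1 f2 that by blast
qed

text \<open>With |x|^2/R^2 = exp ((s - 2) / c) all powers of the radius cancel, and |x|^2 times the
  Laplacian turns the bump factor into -l bump + O(c). Letting c tend to 0 isolates l^2.\<close>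

lemma optimal_bound_I:
  fixes R \<alpha> :: real
  defines "N \<equiv> DIM('a::euclidean_space)"
  defines "m \<equiv> real N - \<alpha>"
  assumes R: "R > 0" and \<alpha>: "4 - real N < \<alpha>" "\<alpha> < real N"
    and rellich: "rellich_inequality TYPE('a) R \<alpha> m 2 C" and C: "C \<ge> 0"
  shows "C \<le> (m * (real N + \<alpha> - 4) / 4)\<^sup>2"
proof -
  define l where "l = m * (real N + \<alpha> - 4) / 4"
  have m: "m > 0" using \<alpha> by (simp add: m_def)
  have l: "l \<ge> 0" using \<alpha> m by (simp add: l_def)
  obtain f1 f2 M1 M2 where f: "f1 \<in> bumps" "f2 \<in> bumps" "\<And>s. (bump has_real_derivative f1 s) (at s)"
    "\<And>s. (f1 has_real_derivative f2 s) (at s)" and M: "M1 \<ge> 0" "M2 \<ge> 0" "\<And>s. \<bar>f1 s\<bar> \<le> M1" "\<And>s. \<bar>f2 s\<bar> \<le> M2"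
    by (rule bump_profile_data) blast
  have [measurable]: "bump \<in> borel_measurable borel"
    by (rule borel_measurable_continuous_onI) (rule bumps_continuous[OF bump_in_bumps])
  \<comment> \<open>A quarter instead of a half, because the profile variable is the squared radius:
    t^A is (|x|/R)^(-m/2).\<close>
  define A where "A = - m / 4"
  have "C * 1 \<le> l\<^sup>2"
  proof (rule concentration_limit[OF C _ _ l])
    fix \<epsilon> :: real assume \<epsilon>: "0 < \<epsilon>" "\<epsilon> < 1"
    \<comment> \<open>\<open>c * Z\<close> will bound the terms with derivatives of the bump;
      \<open>k\<close> is chosen to make it at most \<epsilon>.\<close>
    define Z where "Z = \<bar>8 * A - 4 + 2 * real N\<bar> * M1 + 4 * M2"
    define k where "k = max 1 (Z / \<epsilon>)"
    define c where "c = 1 / k"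
    have k: "k \<ge> 1" by (simp add: k_def)
    have c: "c > 0" "c \<le> 1" using k by (simp_all add: c_def)
    have cZ: "c * Z \<le> \<epsilon>"
    proof -
      have "Z / \<epsilon> \<le> k" by (simp add: k_def)
      then show ?thesis using \<epsilon> k by (simp add: c_def divide_simps mult.commute)
    qed
    define h1 where "h1 = (\<lambda>s. A * bump s + c * f1 s)"
    define h1' where "h1' = (\<lambda>s. A * f1 s + c * f2 s)"
    define h2 where "h2 = (\<lambda>s. (A - 1) * h1 s + c * h1' s)"
    have h: "h1 \<in> bumps" "h1' \<in> bumps" "h2 \<in> bumps"
      unfolding h1_def h1'_def h2_def by (intro bumps.add bumps.cmult f bump_in_bumps)+
    have dh1: "(h1 has_real_derivative h1' s) (at s)" for s
      unfolding h1_def h1'_def by (intro DERIV_add DERIV_cmult f)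
    define g where "g = log_profile c 2 A bump"
    define g1 where "g1 = log_profile c 2 (A - 1) h1"
    define g2 where "g2 = log_profile c 2 (A - 1 - 1) h2"
    have dg: "(g has_real_derivative g1 t) (at t)" for t
      unfolding g_def g1_def h1_def by (rule log_profile_has_derivative[OF bump_in_bumps f(3)]) (use c in simp)
    have dg1: "(g1 has_real_derivative g2 t) (at t)" for t
      unfolding g1_def g2_def h2_def by (rule log_profile_has_derivative[OF h(1) dh1]) (use c in simp)
    have [measurable]: "g \<in> borel_measurable borel" "g1 \<in> borel_measurable borel" "g2 \<in> borel_measurable borel"
      unfolding g_def g1_def g2_def by (intro log_profile_measurable bump_in_bumps h; use c in simp)+
    \<comment> \<open>The radius at which the bump has argument \<open>s\<close>. The shift 2 places
      the support at |x|^2/R^2 between exp (-2 k) and exp (-k), inside the ball and shrinking to the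
      origin as \<open>k\<close> grows.\<close>
    define \<rho> where "\<rho> s = R * exp (k * (s - 2) / 2)" for s
    define \<rho>' where "\<rho>' s = k / 2 * \<rho> s" for s
    define L where "L r = 4 * (1 / R\<^sup>2)\<^sup>2 * r\<^sup>2 * g2 (r\<^sup>2 / R\<^sup>2) + 2 * (1 / R\<^sup>2) * real N * g1 (r\<^sup>2 / R\<^sup>2)" for r
    define Fl where "Fl r = (g (r\<^sup>2 / R\<^sup>2))\<^sup>2 / (r powr \<alpha> * (1 - (r / R) powr m) ^ 2)" for r
    define Fr where "Fr r = (L r)\<^sup>2 / r powr (\<alpha> - 4)" for r
    let ?u = "\<lambda>x::'a. g (radial_quadratic 0 (1 / R\<^sup>2) x)"
    have rq: "radial_quadratic 0 (1 / R\<^sup>2) x = (norm x)\<^sup>2 / R\<^sup>2" for x :: 'a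
      by (simp add: radial_quadratic_def dot_square_norm)
    have \<rho>1: "\<rho> 1 < R" using R k by (simp add: \<rho>_def)
    have off: "c * ln (r\<^sup>2 / R\<^sup>2) + 2 \<notin> {0<..<1}" if "r \<ge> 0" "r \<notin> {\<rho> 0..\<rho> 1}" "r\<^sup>2 / R\<^sup>2 > 0" for r
    proof -
      have r: "r > 0" using that(1,3) by (cases "r = 0") auto
      then have q: "ln (r\<^sup>2 / R\<^sup>2) = 2 * ln (r / R)" using R
        by (simp add: power_divide[symmetric] ln_realpow)
      have "r / R < exp (- k) \<or> exp (- k / 2) < r / R"
        using that(2) R by (auto simp: \<rho>_def field_simps not_le)
      then have "ln (r / R) < - k \<or> - k / 2 < ln (r / R)"
        using r R by (metis divide_pos_pos exp_less_cancel_iff exp_ln)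
      then show ?thesis unfolding q using k by (auto simp: c_def field_simps)
    qed
    have off0: "g (r\<^sup>2 / R\<^sup>2) = 0" "g1 (r\<^sup>2 / R\<^sup>2) = 0" "g2 (r\<^sup>2 / R\<^sup>2) = 0" if "r \<ge> 0" "r \<notin> {\<rho> 0..\<rho> 1}" for r
      unfolding g_def g1_def g2_def using off[OF that] by (intro log_profile_eq_0 bump_in_bumps h; blast)+
    have "ennreal C * (\<integral>\<^sup>+s\<in>{0..1}. ennreal ((1 - \<epsilon>) * (bump s)\<^sup>2) \<partial>lborel)
        \<le> (\<integral>\<^sup>+s\<in>{0..1}. ennreal ((1 + \<epsilon>) * (l * bump s + \<epsilon>)\<^sup>2) \<partial>lborel)"
    proof (rule radial_rellich_test[OF rellich, where u = ?u and Fl = Fl and Fr = Fr and \<rho> = \<rho> and \<rho>' = \<rho>'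
          and D = "k / 2 * (real N * unit_ball_vol (real N)) * R powr m"])
      have "?u x = 0" if "norm x > \<rho> 1" for x :: 'a
        unfolding rq using off0(1)[of "norm x"] that by auto
      then show "?u \<in> test_functions (ball 0 R)"
        unfolding g_def by (intro log_profile_test_function[OF _ bump_in_bumps \<rho>1]) (use c in auto)
      show "\<bar>?u x\<bar>\<^sup>2 / (norm x powr \<alpha> * (1 - (norm x / R) powr m)\<^sup>2) = Fl (norm x)" for x :: 'a
        unfolding rq Fl_def by simp
      show "\<bar>laplacian ?u x\<bar>\<^sup>2 / norm x powr (\<alpha> - 4) = Fr (norm x)" for x :: 'a
        using laplacian_radial_profile[OF dg dg1, of 0 "1 / R\<^sup>2" x]
        by (simp only: Fr_def L_def rq N_def dot_square_norm power2_abs)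
      show "Fl \<in> borel_measurable borel" "Fr \<in> borel_measurable borel"
        unfolding Fl_def[abs_def] Fr_def[abs_def] L_def[abs_def] by measurable
      show "(\<lambda>s. (1 - \<epsilon>) * (bump s)\<^sup>2) \<in> borel_measurable borel" "(\<lambda>s. (1 + \<epsilon>) * (l * bump s + \<epsilon>)\<^sup>2) \<in> borel_measurable borel"
        by measurable
      show "Fl r = 0" "Fr r = 0" if "r \<ge> 0" "r \<notin> {\<rho> 0..\<rho> 1}" for r
        using off0[OF that] by (simp_all add: Fl_def Fr_def L_def)
      show "0 \<le> \<rho> 0" "\<rho> 1 < R" using R \<rho>1 by (simp_all add: \<rho>_def)
      show "(\<rho> has_real_derivative \<rho>' s) (at s)" for s
        unfolding \<rho>_def[abs_def] \<rho>'_def by (auto intro!: derivative_eq_intros)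
      show "continuous_on {0..1} \<rho>'" unfolding \<rho>'_def[abs_def] \<rho>_def by (intro continuous_intros) auto
      show "0 \<le> \<rho>' s" "0 \<le> \<rho> s" for s using R k by (simp_all add: \<rho>'_def \<rho>_def)
      show "0 < k / 2 * (real N * unit_ball_vol (real N)) * R powr m"
        using k R by (simp add: N_def)
      fix s :: real assume s: "s \<in> {0..1}"
      let ?y = "\<rho> s"
      let ?t = "exp ((s - 2) / c)"
      have y: "?y > 0" using R by (simp add: \<rho>_def)
      have t: "?y\<^sup>2 / R\<^sup>2 = ?t"
        using R by (simp add: \<rho>_def c_def power_mult_distrib exp_double[symmetric] mult.commute)
      have y2: "?y\<^sup>2 = R\<^sup>2 * ?t" using t R by (simp add: field_simps)
      have tA: "?t powr (A - 1) * ?t = ?t powr A" "?t powr (A - 1 - 1) * ?t\<^sup>2 = ?t powr A"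
      proof -
        have "x powr (A - 1) * x = x powr A" "x powr (A - 1 - 1) * x\<^sup>2 = x powr A" if "x > 0" for x :: real
          using that by (simp_all add: powr_diff power2_eq_square)
        from this[OF exp_gt_zero] show "?t powr (A - 1) * ?t = ?t powr A" "?t powr (A - 1 - 1) * ?t\<^sup>2 = ?t powr A" by auto
      qed
      have gt: "g ?t = ?t powr A * bump s" "g1 ?t = ?t powr (A - 1) * h1 s" "g2 ?t = ?t powr (A - 1 - 1) * h2 s"
        unfolding g_def g1_def g2_def by (rule log_profile_exp; use c in simp)+
      let ?H = "4 * h2 s + 2 * real N * h1 s"
      have L: "?y\<^sup>2 * L ?y = ?t powr A * ?H"
      proof -
        have "?y\<^sup>2 * L ?y = 4 * ((?y\<^sup>2 / R\<^sup>2)\<^sup>2 * g2 (?y\<^sup>2 / R\<^sup>2)) + 2 * real N * (?y\<^sup>2 / R\<^sup>2 * g1 (?y\<^sup>2 / R\<^sup>2))"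
          unfolding L_def by (simp add: power2_eq_square algebra_simps)
        also have "\<dots> = 4 * (?t powr (A - 1 - 1) * ?t\<^sup>2) * h2 s + 2 * real N * (?t powr (A - 1) * ?t) * h1 s"
          unfolding t gt by simp
        finally show ?thesis unfolding tA by (simp add: algebra_simps)
      qed
      \<comment> \<open>Criticality of the exponent: the squared profile compensates the power of
        the radius left over by weight and volume.\<close>
      have "(?t powr A)\<^sup>2 * ?y powr m = R powr m"
      proof -
        have "?y powr m = (?y\<^sup>2) powr (m / 2)" using y by (simp add: powr_powr flip: powr_numeral)
        also have "\<dots> = R powr m * ?t powr (m / 2)"
          unfolding y2 using R by (simp add: powr_mult powr_powr flip: powr_numeral)
        finally show ?thesis by (simp add: A_def powr_powr power2_eq_square powr_add[symmetric])
      qed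
      note tR = this
      have ypow: "?y ^ (N - 1) * ?y = ?y powr m * ?y powr \<alpha>"
      proof -
        have "?y ^ (N - 1) * ?y = ?y ^ N" by (simp add: N_def power_eq_if)
        also have "\<dots> = ?y powr (real N)" using y by (simp add: powr_realpow)
        finally show ?thesis by (simp add: powr_add[symmetric] m_def)
      qed
      have y4: "?y powr (\<alpha> - 4) = ?y powr \<alpha> / ?y ^ 4"
        using y powr_realpow[of ?y 4] by (simp add: powr_diff)
      let ?w = "real N * unit_ball_vol (real N) * ?y ^ (N - 1) * \<rho>' s"
      let ?D = "k / 2 * (real N * unit_ball_vol (real N)) * R powr m"
      have w: "?w = k / 2 * (real N * unit_ball_vol (real N)) * (?y powr m * ?y powr \<alpha>)"
        unfolding ypow[symmetric] \<rho>'_def by simp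
      have Dp: "?D \<ge> 0" using k R by (simp add: N_def)
      have "Fr ?y * ?w = k / 2 * (real N * unit_ball_vol (real N)) * ((?y\<^sup>2 * L ?y)\<^sup>2 * ?y powr m)"
        unfolding Fr_def y4 w using y by (simp add: power_mult_distrib power2_eq_square power4_eq_xxxx)
      also have "\<dots> = ?D * ?H\<^sup>2"
        unfolding L power_mult_distrib tR[symmetric] by simp
      also have "\<dots> \<le> ?D * ((1 + \<epsilon>) * (l * bump s + \<epsilon>)\<^sup>2)"
      proof (rule mult_left_mono[OF _ Dp])
        \<comment> \<open>The coefficient of \<open>bump s\<close> is 4 A (A - 1) + 2 N A = -l;
          every term with a derivative of the bump carries a factor c.\<close>
        have "?H = - l * bump s + c * ((8 * A - 4 + 2 * real N) * f1 s + 4 * c * f2 s)"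
          unfolding h2_def h1_def h1'_def A_def l_def m_def by (simp add: field_simps power2_eq_square)
        then have "\<bar>?H\<bar> \<le> \<bar>- l * bump s\<bar> + \<bar>c * ((8 * A - 4 + 2 * real N) * f1 s + 4 * c * f2 s)\<bar>" by linarith
        also have "\<bar>- l * bump s\<bar> = l * bump s" using l bump_nonneg[of s] by (simp add: abs_mult)
        also have "\<bar>c * ((8 * A - 4 + 2 * real N) * f1 s + 4 * c * f2 s)\<bar> \<le> c * Z"
        proof -
          have "\<bar>(8 * A - 4 + 2 * real N) * f1 s\<bar> \<le> \<bar>8 * A - 4 + 2 * real N\<bar> * M1"
            unfolding abs_mult by (intro mult_left_mono M) auto
          moreover have "\<bar>4 * c * f2 s\<bar> \<le> 4 * M2"
          proof -
            have "\<bar>c\<bar> * \<bar>f2 s\<bar> \<le> 1 * M2" using c M by (intro mult_mono) auto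
            then show ?thesis by (simp add: abs_mult)
          qed
          ultimately have "\<bar>(8 * A - 4 + 2 * real N) * f1 s + 4 * c * f2 s\<bar> \<le> Z" unfolding Z_def by linarith
          then show ?thesis using c by (simp add: abs_mult)
        qed
        also note cZ
        finally have "\<bar>?H\<bar> \<le> l * bump s + \<epsilon>" by simp
        then have "?H\<^sup>2 \<le> (l * bump s + \<epsilon>)\<^sup>2" using power_mono[of "\<bar>?H\<bar>" _ 2] by simp
        also have "\<dots> \<le> (1 + \<epsilon>) * (l * bump s + \<epsilon>)\<^sup>2" using \<epsilon> by (simp add: distrib_right)
        finally show "?H\<^sup>2 \<le> (1 + \<epsilon>) * (l * bump s + \<epsilon>)\<^sup>2" .
      qed
      finally show "Fr ?y * (real DIM('a) * unit_ball_vol (real DIM('a)) * ?y ^ (DIM('a) - 1) * \<rho>' s)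
        \<le> k / 2 * (real N * unit_ball_vol (real N)) * R powr m * ((1 + \<epsilon>) * (l * bump s + \<epsilon>)\<^sup>2)"
        by (simp add: N_def)
      \<comment> \<open>The factor 1 / ?x^2 of the weight is at least 1 and tends to 1 at the
        origin, so bounding it below by 1 loses nothing in the limit.\<close>
      let ?x = "1 - (?y / R) powr m"
      have x: "0 < ?x" "?x \<le> 1"
      proof -
        have "k * (s - 2) < 0" using s k by (intro mult_pos_neg) auto
        then have "?y / R < 1" "0 < ?y / R" using R by (simp_all add: \<rho>_def divide_less_eq)
        then have "(?y / R) powr m < 1 powr m" using m by (intro powr_less_mono2) auto
        then show "0 < ?x" "?x \<le> 1" by auto
      qed
      have x2: "0 < ?x\<^sup>2" "?x\<^sup>2 \<le> 1" using x by (auto simp: power_le_one)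
      have "(1 - \<epsilon>) * (bump s)\<^sup>2 \<le> 1 * (bump s)\<^sup>2" using \<epsilon> by (intro mult_right_mono) auto
      also have "\<dots> \<le> (bump s)\<^sup>2 / ?x\<^sup>2"
        using x2 by (simp add: le_divide_eq mult_left_le)
      finally have "?D * ((1 - \<epsilon>) * (bump s)\<^sup>2) \<le> ?D * ((bump s)\<^sup>2 / ?x\<^sup>2)" using Dp by (rule mult_left_mono)
      also have "\<dots> = Fl ?y * ?w"
        unfolding Fl_def t gt w tR[symmetric] using y by (simp add: power_mult_distrib mult_ac)
      finally show "k / 2 * (real N * unit_ball_vol (real N)) * R powr m * ((1 - \<epsilon>) * (bump s)\<^sup>2)
        \<le> Fl ?y * (real DIM('a) * unit_ball_vol (real DIM('a)) * ?y ^ (DIM('a) - 1) * \<rho>' s)"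
        by (simp add: N_def)
    qed
    then show "ennreal C * (\<integral>\<^sup>+s\<in>{0..1}. ennreal ((1 - \<epsilon>) * (bump s)\<^sup>2) \<partial>lborel)
        \<le> (\<integral>\<^sup>+s\<in>{0..1}. ennreal ((1 + \<epsilon>) * (l * bump s + \<epsilon>)\<^sup>2) \<partial>lborel)" .
  qed simp
  then show ?thesis by (simp add: l_def)
qed

text \<open>For t = 1 - |x|^2/R^2 the boundary weight is 1 / (1 - (1 - t)^(\<gamma>/2)), asymptotic
  to 2 / (\<gamma> t), hence the value 16 / \<gamma>^4. Powers of |x|/R become powers of 1 - t,
  which tend to 1.\<close>

lemma boundary_asymptotics:
  fixes \<gamma> a1 a2 \<epsilon> :: real
  assumes \<gamma>: "\<gamma> > 0" and \<epsilon>: "\<epsilon> > 0"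
  shows "\<exists>\<delta>>0. \<forall>t. 0 < t \<and> t < \<delta> \<longrightarrow> (1 - t) powr a1 \<le> 1 + \<epsilon> \<and>
    16 / \<gamma> ^ 4 - \<epsilon> \<le> (t / (1 - (1 - t) powr (\<gamma> / 2))) ^ 4 * (1 - t) powr a2"
proof -
  have p: "((\<lambda>t. (1 - t) powr b) \<longlongrightarrow> 1) (at_right 0)" for b :: real
  proof -
    have "((\<lambda>t::real. (1 - t) powr b) \<longlongrightarrow> (1 - 0) powr b) (at_right 0)"
      by (intro tendsto_intros) auto
    then show ?thesis by simp
  qed
  have "((\<lambda>t. 1 - (1 - t) powr (\<gamma> / 2)) has_real_derivative \<gamma> / 2) (at 0)"
    by (auto intro!: derivative_eq_intros)
  then have "((\<lambda>t. (1 - (1 - t) powr (\<gamma> / 2)) / t) \<longlongrightarrow> \<gamma> / 2) (at 0)"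
    by (simp add: DERIV_def)
  then have q: "((\<lambda>t. (1 - (1 - t) powr (\<gamma> / 2)) / t) \<longlongrightarrow> \<gamma> / 2) (at_right 0)"
    by (rule filterlim_mono) (simp_all add: at_within_le_at)
  have "((\<lambda>t. inverse ((1 - (1 - t) powr (\<gamma> / 2)) / t) ^ 4 * (1 - t) powr a2) \<longlongrightarrow> inverse (\<gamma> / 2) ^ 4 * 1) (at_right 0)"
    by (intro tendsto_mult tendsto_power tendsto_inverse p q) (use \<gamma> in simp)
  then have l: "((\<lambda>t. (t / (1 - (1 - t) powr (\<gamma> / 2))) ^ 4 * (1 - t) powr a2) \<longlongrightarrow> 16 / \<gamma> ^ 4) (at_right 0)"
    by (simp add: power_divide inverse_eq_divide)
  have "\<forall>\<^sub>F t in at_right 0. (1 - t) powr a1 < 1 + \<epsilon>"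
    using order_tendstoD(2)[OF p, of "1 + \<epsilon>"] \<epsilon> by simp
  moreover have "\<forall>\<^sub>F t in at_right 0. 16 / \<gamma> ^ 4 - \<epsilon> < (t / (1 - (1 - t) powr (\<gamma> / 2))) ^ 4 * (1 - t) powr a2"
    using order_tendstoD(1)[OF l, of "16 / \<gamma> ^ 4 - \<epsilon>"] \<epsilon> by simp
  ultimately have "\<forall>\<^sub>F t in at_right 0. (1 - t) powr a1 \<le> 1 + \<epsilon> \<and>
    16 / \<gamma> ^ 4 - \<epsilon> \<le> (t / (1 - (1 - t) powr (\<gamma> / 2))) ^ 4 * (1 - t) powr a2"
    by eventually_elim simp
  then show ?thesis unfolding eventually_at_right_field by auto
qed

text \<open>Near the sphere R^2 times the Laplacian is to leading order 4 times the second
  derivative in t = 1 - |x|^2/R^2, which multiplies t^(3/2) by 3 / t^2. With the factor 16 /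
  \<gamma>^4 from the weight this gives 16 C / \<gamma>^4 \<le> 9.\<close>

lemma optimal_bound_II:
  fixes R \<alpha> \<gamma> :: real
  defines "N \<equiv> DIM('a::euclidean_space)"
  assumes R: "R > 0" and \<gamma>: "\<gamma> > 0" and N2: "N \<ge> 2"
    and rellich: "rellich_inequality TYPE('a) R \<alpha> \<gamma> 4 C" and C: "C \<ge> 0"
  shows "C \<le> (3 / 4 * \<gamma>\<^sup>2)\<^sup>2"
proof -
  obtain f1 f2 M1 M2 where f: "f1 \<in> bumps" "f2 \<in> bumps" "\<And>s. (bump has_real_derivative f1 s) (at s)"
    "\<And>s. (f1 has_real_derivative f2 s) (at s)" and M: "M1 \<ge> 0" "M2 \<ge> 0" "\<And>s. \<bar>f1 s\<bar> \<le> M1" "\<And>s. \<bar>f2 s\<bar> \<le> M2"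
    by (rule bump_profile_data) blast
  obtain M0 where M0: "M0 \<ge> 0" "\<And>s. \<bar>bump s\<bar> \<le> M0" using bumps_bounded[OF bump_in_bumps] by blast
  have [measurable]: "bump \<in> borel_measurable borel"
    by (rule borel_measurable_continuous_onI) (rule bumps_continuous[OF bump_in_bumps])
  let ?a = "16 / \<gamma> ^ 4"
  have "C * ?a \<le> 3\<^sup>2"
  proof (rule concentration_limit[OF C])
    show "?a > 0" using \<gamma> by simp
    fix \<epsilon> :: real assume \<epsilon>: "0 < \<epsilon>" "\<epsilon> < 1"
    let ?A1 = "\<lambda>t. (1 - t) powr ((real N + 2 - \<alpha>) / 2)"
    let ?A2 = "\<lambda>t. (t / (1 - (1 - t) powr (\<gamma> / 2))) ^ 4 * (1 - t) powr ((real N - 2 - \<alpha>) / 2)"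
    obtain \<delta> where \<delta>: "\<delta> > 0" "\<And>t. 0 < t \<Longrightarrow> t < \<delta> \<Longrightarrow> ?A1 t \<le> 1 + \<epsilon> \<and> ?a - \<epsilon> \<le> ?A2 t"
      using boundary_asymptotics[OF \<gamma> \<epsilon>(1), of "(real N + 2 - \<alpha>) / 2" "(real N - 2 - \<alpha>) / 2"] by blast
    define Z where "Z = 8 * M1 + 4 * M2 + 2 * real N * (3/2 * M0 + M1)"
    \<comment> \<open>Besides keeping the error below \<epsilon>, this ensures exp (-k) < \<delta>,
      so that the support lies in the range of the boundary asymptotics.\<close>
    define k where "k = max 1 (max (Z / \<epsilon>) (1 - ln \<delta>))"
    \<comment> \<open>Negative, so that the bump argument grows with |x| and the substitution \<rho>
      is increasing.\<close>
    define c where "c = - 1 / k"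
    have k: "k \<ge> 1" "k > - ln \<delta>" by (auto simp: k_def)
    have c: "c < 0" "\<bar>c\<bar> \<le> 1" "\<bar>c\<bar> = 1 / k" using k by (simp_all add: c_def)
    have kZ: "1 / k * Z \<le> \<epsilon>"
    proof -
      have "Z / \<epsilon> \<le> k" by (simp add: k_def)
      then show ?thesis using \<epsilon> k by (simp add: divide_simps mult.commute)
    qed
    define h1 where "h1 = (\<lambda>s. 3/2 * bump s + c * f1 s)"
    define h1' where "h1' = (\<lambda>s. 3/2 * f1 s + c * f2 s)"
    define h2 where "h2 = (\<lambda>s. (3/2 - 1) * h1 s + c * h1' s)"
    have h: "h1 \<in> bumps" "h1' \<in> bumps" "h2 \<in> bumps"
      unfolding h1_def h1'_def h2_def by (intro bumps.add bumps.cmult f bump_in_bumps)+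
    have dh1: "(h1 has_real_derivative h1' s) (at s)" for s
      unfolding h1_def h1'_def by (intro DERIV_add DERIV_cmult f)
    define g where "g = log_profile c (- 1) (3/2) bump"
    define g1 where "g1 = log_profile c (- 1) (3/2 - 1) h1"
    define g2 where "g2 = log_profile c (- 1) (3/2 - 1 - 1) h2"
    have dg: "(g has_real_derivative g1 t) (at t)" for t
      unfolding g_def g1_def h1_def by (rule log_profile_has_derivative[OF bump_in_bumps f(3)]) (use c in simp)
    have dg1: "(g1 has_real_derivative g2 t) (at t)" for t
      unfolding g1_def g2_def h2_def by (rule log_profile_has_derivative[OF h(1) dh1]) (use c in simp)
    have [measurable]: "g \<in> borel_measurable borel" "g1 \<in> borel_measurable borel" "g2 \<in> borel_measurable borel"
      unfolding g_def g1_def g2_def by (intro log_profile_measurable bump_in_bumps h; use c in simp)+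
    define t where "t s = exp (- k * (s + 1))" for s
    define \<rho> where "\<rho> s = R * sqrt (1 - t s)" for s
    define \<rho>' where "\<rho>' s = R * (k * t s / (2 * sqrt (1 - t s)))" for s
    have t: "0 < t s" "t s \<le> exp (- k)" "t s < 1" if "s \<in> {0..1}" for s
    proof -
      have "k * 1 \<le> k * (s + 1)" using that k by (intro mult_left_mono) auto
      then show "0 < t s" and le: "t s \<le> exp (- k)" by (simp_all add: t_def)
      have "exp (- k) < 1" using k by simp
      then show "t s < 1" using le by linarith
    qed
    have tk: "t s \<le> 1 / k" "t s < \<delta>" if "s \<in> {0..1}" for s
    proof -
      have "k \<le> exp k" using exp_ge_add_one_self[of k] by linarith
      then have "exp (- k) \<le> 1 / k" using k by (simp add: exp_minus inverse_eq_divide divide_simps)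
      then show "t s \<le> 1 / k" using t(2)[OF that] by linarith
      have "exp (- k) < exp (ln \<delta>)" using k by simp
      then show "t s < \<delta>" using t(2)[OF that] \<delta>(1) by simp
    qed
    define L where "L r = 4 * (- 1 / R\<^sup>2)\<^sup>2 * r\<^sup>2 * g2 (1 - r\<^sup>2 / R\<^sup>2) + 2 * (- 1 / R\<^sup>2) * real N * g1 (1 - r\<^sup>2 / R\<^sup>2)" for r
    define Fl where "Fl r = (g (1 - r\<^sup>2 / R\<^sup>2))\<^sup>2 / (r powr \<alpha> * (1 - (r / R) powr \<gamma>) ^ 4)" for r
    define Fr where "Fr r = (L r)\<^sup>2 / r powr (\<alpha> - 4)" for r
    let ?u = "\<lambda>x::'a. g (radial_quadratic 1 (- 1 / R\<^sup>2) x)"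
    have rq: "radial_quadratic 1 (- 1 / R\<^sup>2) x = 1 - (norm x)\<^sup>2 / R\<^sup>2" for x :: 'a
      by (simp add: radial_quadratic_def dot_square_norm)
    have \<rho>1: "\<rho> 1 < R" using R t[of 1] by (simp add: \<rho>_def)
    have \<rho>sq: "(\<rho> s)\<^sup>2 = R\<^sup>2 * (1 - t s)" if "s \<in> {0..1}" for s
      using t[OF that] by (simp add: \<rho>_def power_mult_distrib)
    have \<rho>pos: "\<rho> s > 0" if "s \<in> {0..1}" for s using t[OF that] R by (simp add: \<rho>_def)
    have off: "c * ln (1 - r\<^sup>2 / R\<^sup>2) + (- 1) \<notin> {0<..<1}" if "r \<ge> 0" "r \<notin> {\<rho> 0..\<rho> 1}" "1 - r\<^sup>2 / R\<^sup>2 > 0" for r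
    proof -
      let ?v = "1 - r\<^sup>2 / R\<^sup>2"
      have "r < \<rho> 0 \<or> \<rho> 1 < r" using that(2) by auto
      then have "- k < ln ?v \<or> ln ?v < - k * 2"
      proof
        assume "r < \<rho> 0"
        then have "r\<^sup>2 < (\<rho> 0)\<^sup>2" using that(1) by (intro power_strict_mono) auto
        then have "r\<^sup>2 / R\<^sup>2 < 1 - t 0" using R \<rho>sq[of 0] by (simp add: divide_less_eq mult.commute)
        then have "exp (- k) < ?v" by (simp add: t_def)
        then have "ln (exp (- k)) < ln ?v" using that(3) by (subst ln_less_cancel_iff) auto
        then show ?thesis by simp
      next
        assume "\<rho> 1 < r"
        then have "(\<rho> 1)\<^sup>2 < r\<^sup>2" using \<rho>pos[of 1] by (intro power_strict_mono) auto
        then have "1 - t 1 < r\<^sup>2 / R\<^sup>2" using R \<rho>sq[of 1] by (simp add: less_divide_eq mult.commute)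
        then have "?v < exp (- k * 2)" by (simp add: t_def)
        then have "ln ?v < ln (exp (- k * 2))" using that(3) by (subst ln_less_cancel_iff) auto
        then show ?thesis by simp
      qed
      then show ?thesis using k by (auto simp: c_def field_simps)
    qed
    have off0: "g (1 - r\<^sup>2 / R\<^sup>2) = 0" "g1 (1 - r\<^sup>2 / R\<^sup>2) = 0" "g2 (1 - r\<^sup>2 / R\<^sup>2) = 0" if "r \<ge> 0" "r \<notin> {\<rho> 0..\<rho> 1}" for r
      unfolding g_def g1_def g2_def using off[OF that] by (intro log_profile_eq_0 bump_in_bumps h; blast)+
    have "ennreal C * (\<integral>\<^sup>+s\<in>{0..1}. ennreal ((?a - \<epsilon>) * (bump s)\<^sup>2) \<partial>lborel)
        \<le> (\<integral>\<^sup>+s\<in>{0..1}. ennreal ((1 + \<epsilon>) * (3 * bump s + \<epsilon>)\<^sup>2) \<partial>lborel)"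
    proof (rule radial_rellich_test[OF rellich, where u = ?u and Fl = Fl and Fr = Fr and \<rho> = \<rho> and \<rho>' = \<rho>'
          and D = "k / 2 * (real N * unit_ball_vol (real N)) * R powr (real N - \<alpha>)"])
      have "?u x = 0" if "norm x > \<rho> 1" for x :: 'a
        unfolding rq using off0(1)[of "norm x"] that by auto
      then show "?u \<in> test_functions (ball 0 R)"
        unfolding g_def by (intro log_profile_test_function[OF _ bump_in_bumps \<rho>1]) (use c in auto)
      show "\<bar>?u x\<bar>\<^sup>2 / (norm x powr \<alpha> * (1 - (norm x / R) powr \<gamma>) ^ 4) = Fl (norm x)" for x :: 'a
        unfolding rq Fl_def by simp
      show "\<bar>laplacian ?u x\<bar>\<^sup>2 / norm x powr (\<alpha> - 4) = Fr (norm x)" for x :: 'a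
        using laplacian_radial_profile[OF dg dg1, of 1 "- 1 / R\<^sup>2" x]
        by (simp only: Fr_def L_def rq N_def dot_square_norm power2_abs)
      show "Fl \<in> borel_measurable borel" "Fr \<in> borel_measurable borel"
        unfolding Fl_def[abs_def] Fr_def[abs_def] L_def[abs_def] by measurable
      show "(\<lambda>s. (?a - \<epsilon>) * (bump s)\<^sup>2) \<in> borel_measurable borel" "(\<lambda>s. (1 + \<epsilon>) * (3 * bump s + \<epsilon>)\<^sup>2) \<in> borel_measurable borel"
        by measurable
      show "Fl r = 0" "Fr r = 0" if "r \<ge> 0" "r \<notin> {\<rho> 0..\<rho> 1}" for r
        using off0[OF that] by (simp_all add: Fl_def Fr_def L_def)
      show "0 \<le> \<rho> 0" "\<rho> 1 < R" using \<rho>pos[of 0] \<rho>1 by simp_all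
      show "(\<rho> has_real_derivative \<rho>' s) (at s)" if "s \<in> {0..1}" for s
      proof -
        have "((\<lambda>s. 1 - t s) has_real_derivative k * t s) (at s)"
          unfolding t_def by (auto intro!: derivative_eq_intros)
        from DERIV_cmult[OF DERIV_chain2[OF DERIV_real_sqrt this], of R]
        show ?thesis using t(3)[OF that] unfolding \<rho>_def[abs_def] \<rho>'_def by (simp add: field_simps)
      qed
      show "continuous_on {0..1} \<rho>'"
      proof -
        have "continuous_on {0..1} t" unfolding t_def[abs_def] by (intro continuous_intros)
        moreover have "2 * sqrt (1 - t s) \<noteq> 0" if "s \<in> {0..1}" for s using t(3)[OF that] by simp
        ultimately show ?thesis unfolding \<rho>'_def[abs_def] by (intro continuous_intros ballI) blast+
      qed
      show "0 \<le> \<rho> s" if "s \<in> {0..1}" for s using \<rho>pos[OF that] by simp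
      show "0 \<le> \<rho>' s" if "s \<in> {0..1}" for s using R k t[OF that] by (simp add: \<rho>'_def)
      show "0 < k / 2 * (real N * unit_ball_vol (real N)) * R powr (real N - \<alpha>)"
        using k R by (simp add: N_def)
      fix s :: real assume s: "s \<in> {0..1}"
      let ?y = "\<rho> s"
      let ?t = "t s"
      note tt = t[OF s] tk[OF s]
      have y: "?y > 0" by (rule \<rho>pos[OF s])
      have ty: "1 - ?y\<^sup>2 / R\<^sup>2 = ?t" using \<rho>sq[OF s] R by simp
      have texp: "?t = exp ((s - (- 1)) / c)" using k by (simp add: t_def c_def mult.commute)
      have gt: "g ?t = ?t powr (3/2) * bump s" "g1 ?t = ?t powr (3/2 - 1) * h1 s" "g2 ?t = ?t powr (3/2 - 1 - 1) * h2 s"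
        unfolding g_def g1_def g2_def texp by (rule log_profile_exp; use c in simp)+
      \<comment> \<open>Criticality at the boundary: t^3 times the factor t from the measure
        balances the fourth power in the weight, and on the other side the square of t^(-1/2) times
        t is 1.\<close>
      have tp: "?t powr (3/2 - 1) = ?t powr (-1/2) * ?t" "(?t powr (-1/2))\<^sup>2 * ?t = 1" "(?t powr (3/2))\<^sup>2 = ?t ^ 3"
      proof -
        have "?t powr (-1/2) * ?t = ?t powr (-1/2) * ?t powr 1" using tt by simp
        also have "\<dots> = ?t powr (3/2 - 1)" unfolding powr_add[symmetric] by simp
        finally show "?t powr (3/2 - 1) = ?t powr (-1/2) * ?t" ..
        have "(?t powr (-1/2))\<^sup>2 = ?t powr (-1)" by (simp add: power2_eq_square powr_add[symmetric])
        then show "(?t powr (-1/2))\<^sup>2 * ?t = 1" using tt by (simp add: powr_minus)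
        have "(?t powr (3/2))\<^sup>2 = ?t powr (real 3)" by (simp add: power2_eq_square powr_add[symmetric])
        then show "(?t powr (3/2))\<^sup>2 = ?t ^ 3" using powr_realpow[OF tt(1), of 3] by simp
      qed
      \<comment> \<open>The first-order term carries an extra factor t \<le> 1 / k and belongs to
        the error; the factor 1 - t before \<open>h2\<close> is bounded by 1.\<close>
      let ?H = "4 * (1 - ?t) * h2 s - 2 * real N * ?t * h1 s"
      have L: "R\<^sup>2 * L ?y = ?t powr (-1/2) * ?H"
      proof -
        have "R\<^sup>2 * L ?y = 4 * (?y\<^sup>2 / R\<^sup>2) * g2 (1 - ?y\<^sup>2 / R\<^sup>2) - 2 * real N * g1 (1 - ?y\<^sup>2 / R\<^sup>2)"
          unfolding L_def using R by (simp add: power2_eq_square field_simps)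
        also have "?y\<^sup>2 / R\<^sup>2 = 1 - ?t" using ty by simp
        also have "1 - (1 - ?t) = ?t" by simp
        finally show ?thesis unfolding gt tp(1) by (simp add: algebra_simps)
      qed
      have ypowr: "?y powr z = R powr z * (1 - ?t) powr (z / 2)" for z
        unfolding \<rho>_def using R tt by (simp add: powr_mult powr_half_sqrt[symmetric] powr_powr)
      have w1: "?y ^ (N - 1) * \<rho>' s = k / 2 * R\<^sup>2 * ?t * ?y powr (real N - 2)"
      proof -
        have "?y * \<rho>' s = k / 2 * R\<^sup>2 * ?t" unfolding \<rho>_def \<rho>'_def using tt by (simp add: power2_eq_square field_simps)
        moreover have "?y ^ (N - 1) = ?y powr (real N - 2) * ?y"
        proof -
          have "?y ^ (N - 1) = ?y ^ (N - 2) * ?y"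
          proof -
            have "N - 1 = Suc (N - 2)" using N2 by simp
            then show ?thesis by (simp only: power_Suc2)
          qed
          also have "?y ^ (N - 2) = ?y powr (real (N - 2))" using y by (simp add: powr_realpow)
          finally show ?thesis using N2 by (simp add: of_nat_diff)
        qed
        ultimately show ?thesis by (simp add: mult_ac)
      qed
      let ?w = "real N * unit_ball_vol (real N) * ?y ^ (N - 1) * \<rho>' s"
      let ?V = "k / 2 * (real N * unit_ball_vol (real N))"
      let ?D = "?V * R powr (real N - \<alpha>)"
      have w: "?w = ?V * R\<^sup>2 * ?t * ?y powr (real N - 2)"
        using w1 by (simp add: mult_ac)
      have Dp: "?D \<ge> 0" using k R by (simp add: N_def)
      have R2: "R powr 2 = R\<^sup>2" using powr_realpow[OF R, of 2] by simp
      have "Fr ?y * ?w = ?V * R\<^sup>2 * (L ?y)\<^sup>2 * ?t * (?y powr (real N - 2) / ?y powr (\<alpha> - 4))"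
        unfolding Fr_def w by (simp add: mult_ac)
      also have "?y powr (real N - 2) / ?y powr (\<alpha> - 4) = ?y powr (real N + 2 - \<alpha>)"
        by (simp add: powr_diff[symmetric] algebra_simps)
      also have "\<dots> = R powr (real N - \<alpha>) * R\<^sup>2 * ?A1 ?t"
        unfolding ypowr R2[symmetric] by (simp add: powr_add[symmetric] algebra_simps)
      also have "?V * R\<^sup>2 * (L ?y)\<^sup>2 * ?t * (R powr (real N - \<alpha>) * R\<^sup>2 * ?A1 ?t) = ?D * (R\<^sup>2 * L ?y)\<^sup>2 * ?t * ?A1 ?t"
        by (simp add: power_mult_distrib power2_eq_square mult_ac)
      also have "\<dots> = ?D * (((?t powr (-1/2))\<^sup>2 * ?t) * ?H\<^sup>2 * ?A1 ?t)"
        unfolding L power_mult_distrib by (simp add: mult_ac)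
      also have "\<dots> = ?D * (?A1 ?t * ?H\<^sup>2)" unfolding tp(2) by simp
      also have "\<dots> \<le> ?D * ((1 + \<epsilon>) * (3 * bump s + \<epsilon>)\<^sup>2)"
      proof (rule mult_left_mono[OF _ Dp], rule mult_mono)
        show "?A1 ?t \<le> 1 + \<epsilon>" using \<delta>(2) tt by blast
        have h2: "4 * h2 s = 3 * bump s + c * (8 * f1 s + 4 * c * f2 s)"
          unfolding h2_def h1_def h1'_def by (simp add: field_simps power2_eq_square)
        have "\<bar>4 * h2 s\<bar> \<le> \<bar>3 * bump s\<bar> + \<bar>c * (8 * f1 s + 4 * c * f2 s)\<bar>" unfolding h2 by linarith
        also have "\<bar>3 * bump s\<bar> = 3 * bump s" using bump_nonneg[of s] by simp
        also have "\<bar>c * (8 * f1 s + 4 * c * f2 s)\<bar> \<le> 1 / k * (8 * M1 + 4 * M2)"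
        proof -
          have "\<bar>c\<bar> * \<bar>f2 s\<bar> \<le> 1 * M2" using c M by (intro mult_mono) auto
          then have "\<bar>4 * c * f2 s\<bar> \<le> 4 * M2" by (simp add: abs_mult)
          moreover have "\<bar>8 * f1 s\<bar> \<le> 8 * M1" using M(3)[of s] by (simp add: abs_mult)
          ultimately have "\<bar>8 * f1 s + 4 * c * f2 s\<bar> \<le> 8 * M1 + 4 * M2" by linarith
          then show ?thesis unfolding abs_mult c(3) using k by (intro mult_left_mono) auto
        qed
        finally have 1: "\<bar>4 * h2 s\<bar> \<le> 3 * bump s + 1 / k * (8 * M1 + 4 * M2)" by simp
        have "\<bar>4 * (1 - ?t) * h2 s\<bar> = (1 - ?t) * \<bar>4 * h2 s\<bar>" using tt by (simp add: abs_mult)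
        also have "\<dots> \<le> 1 * \<bar>4 * h2 s\<bar>" using tt by (intro mult_right_mono) auto
        finally have 2: "\<bar>4 * (1 - ?t) * h2 s\<bar> \<le> \<bar>4 * h2 s\<bar>" by simp
        have "\<bar>h1 s\<bar> \<le> 3/2 * M0 + M1"
        proof -
          have "\<bar>c\<bar> * \<bar>f1 s\<bar> \<le> 1 * M1" using c M by (intro mult_mono) auto
          then have "\<bar>c * f1 s\<bar> \<le> M1" by (simp add: abs_mult)
          moreover have "\<bar>3/2 * bump s\<bar> \<le> 3/2 * M0" using M0(2)[of s] by (simp add: abs_mult)
          ultimately show ?thesis unfolding h1_def by linarith
        qed
        then have "?t * \<bar>h1 s\<bar> \<le> 1 / k * (3/2 * M0 + M1)" using tt k by (intro mult_mono) auto
        then have 3: "\<bar>2 * real N * ?t * h1 s\<bar> \<le> 1 / k * (2 * real N * (3/2 * M0 + M1))"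
          using mult_left_mono[of "?t * \<bar>h1 s\<bar>" "1 / k * (3/2 * M0 + M1)" "2 * real N"] tt
          by (simp add: abs_mult mult_ac)
        have "\<bar>?H\<bar> \<le> 3 * bump s + (1 / k * (8 * M1 + 4 * M2) + 1 / k * (2 * real N * (3/2 * M0 + M1)))"
          using 1 2 3 by linarith
        also have "1 / k * (8 * M1 + 4 * M2) + 1 / k * (2 * real N * (3/2 * M0 + M1)) = 1 / k * Z"
          unfolding Z_def by (simp only: distrib_left add.assoc)
        finally have "\<bar>?H\<bar> \<le> 3 * bump s + \<epsilon>" using kZ by linarith
        then show "?H\<^sup>2 \<le> (3 * bump s + \<epsilon>)\<^sup>2" using power_mono[of "\<bar>?H\<bar>" _ 2] by simp
      qed (use \<epsilon> in auto)
      finally show "Fr ?y * (real DIM('a) * unit_ball_vol (real DIM('a)) * ?y ^ (DIM('a) - 1) * \<rho>' s)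
        \<le> k / 2 * (real N * unit_ball_vol (real N)) * R powr (real N - \<alpha>) * ((1 + \<epsilon>) * (3 * bump s + \<epsilon>)\<^sup>2)"
        by (simp add: N_def)
      have yR: "(?y / R) powr \<gamma> = (1 - ?t) powr (\<gamma> / 2)"
        using ypowr[of \<gamma>] R y by (simp add: powr_divide)
      have "Fl ?y * ?w = ?V * (g ?t)\<^sup>2 * ?t / (1 - (1 - ?t) powr (\<gamma> / 2)) ^ 4 * (R\<^sup>2 * (?y powr (real N - 2) / ?y powr \<alpha>))"
        unfolding Fl_def w ty yR by (simp add: mult_ac)
      also have "R\<^sup>2 * (?y powr (real N - 2) / ?y powr \<alpha>) = R powr (real N - \<alpha>) * (1 - ?t) powr ((real N - 2 - \<alpha>) / 2)"
      proof -
        have "?y powr (real N - 2) / ?y powr \<alpha> = ?y powr (real N - 2 - \<alpha>)"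
          by (rule powr_diff[symmetric])
        moreover have "R powr 2 * R powr (real N - 2 - \<alpha>) = R powr (real N - \<alpha>)"
          by (simp add: powr_add[symmetric])
        ultimately show ?thesis unfolding ypowr R2[symmetric] by (simp add: mult.assoc[symmetric])
      qed
      also have "(g ?t)\<^sup>2 = ?t ^ 3 * (bump s)\<^sup>2" unfolding gt power_mult_distrib tp(3) ..
      finally have Fl: "Fl ?y * ?w = ?D * (?A2 ?t * (bump s)\<^sup>2)"
        by (simp add: power_divide power3_eq_cube power4_eq_xxxx mult_ac)
      have "?D * ((?a - \<epsilon>) * (bump s)\<^sup>2) \<le> ?D * (?A2 ?t * (bump s)\<^sup>2)"
        using \<delta>(2) tt by (intro mult_left_mono[OF _ Dp] mult_right_mono) auto
      then show "k / 2 * (real N * unit_ball_vol (real N)) * R powr (real N - \<alpha>) * ((?a - \<epsilon>) * (bump s)\<^sup>2)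
        \<le> Fl ?y * (real DIM('a) * unit_ball_vol (real DIM('a)) * ?y ^ (DIM('a) - 1) * \<rho>' s)"
        unfolding Fl[symmetric] by (simp add: N_def)
    qed
    then show "ennreal C * (\<integral>\<^sup>+s\<in>{0..1}. ennreal ((?a - \<epsilon>) * (bump s)\<^sup>2) \<partial>lborel)
        \<le> (\<integral>\<^sup>+s\<in>{0..1}. ennreal ((1 + \<epsilon>) * (3 * bump s + \<epsilon>)\<^sup>2) \<partial>lborel)" .
  qed simp
  then have "C * 16 \<le> 9 * \<gamma> ^ 4" using \<gamma> by (simp add: divide_simps)
  then show ?thesis by (simp add: power_mult_distrib power2_eq_square power4_eq_xxxx)
qed

theorem theorem6:
  fixes N :: nat and R :: real
  assumes "N = CARD('n::finite)" and "N \<ge> 2" and "R > 0"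
  shows
    "(\<forall>\<alpha> \<gamma>. 4 - real N < \<alpha> \<and> \<alpha> \<le> real N - \<gamma> \<and> \<gamma> > 0 \<longrightarrow>
        rellich_inequality TYPE(real ^ 'n) R \<alpha> \<gamma> 2 (((real N + \<alpha> - 4) / 4 * \<gamma>)\<^sup>2) \<and>
        (\<gamma> = real N - \<alpha> \<longrightarrow>
          optimal_constant TYPE(real ^ 'n) R \<alpha> \<gamma> 2
            (((real N - \<alpha>) * (real N + \<alpha> - 4) / 4)\<^sup>2) \<and>
          not_attained TYPE(real ^ 'n) R \<alpha> \<gamma> 2
            (((real N - \<alpha>) * (real N + \<alpha> - 4) / 4)\<^sup>2)))
     \<and>
     (\<forall>\<alpha> \<gamma>. 3 \<le> \<alpha> \<and> \<alpha> \<le> min (real N - \<gamma> + 2) (real N - 3 * \<gamma>) \<and> \<gamma> > 0 \<longrightarrow>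
        rellich_inequality TYPE(real ^ 'n) R \<alpha> \<gamma> 4 ((3 / 4 * \<gamma>\<^sup>2)\<^sup>2) \<and>
        optimal_constant TYPE(real ^ 'n) R \<alpha> \<gamma> 4 ((3 / 4 * \<gamma>\<^sup>2)\<^sup>2) \<and>
        not_attained TYPE(real ^ 'n) R \<alpha> \<gamma> 4 ((3 / 4 * \<gamma>\<^sup>2)\<^sup>2))"
proof -
  have N: "real DIM(real ^ 'n) = real N" "DIM(real ^ 'n) = N" using assms(1) by simp_all
  have I: "rellich_inequality TYPE(real ^ 'n) R \<alpha> \<gamma> 2 (((real N + \<alpha> - 4) / 4 * \<gamma>)\<^sup>2)"
    if "4 - real N < \<alpha>" "\<alpha> \<le> real N - \<gamma>" "\<gamma> > 0" for \<alpha> \<gamma>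
    using rellich_inequality_I[where 'a = "real ^ 'n", OF assms(3)] that unfolding N by simp
  have Iopt: "optimal_constant TYPE(real ^ 'n) R \<alpha> \<gamma> 2 (((real N - \<alpha>) * (real N + \<alpha> - 4) / 4)\<^sup>2)"
    if \<alpha>: "4 - real N < \<alpha>" "\<alpha> \<le> real N - \<gamma>" "\<gamma> > 0" and \<gamma>: "\<gamma> = real N - \<alpha>" for \<alpha> \<gamma>
    unfolding optimal_constant_def
  proof (intro conjI allI impI notI)
    have "(real N + \<alpha> - 4) / 4 * \<gamma> = (real N - \<alpha>) * (real N + \<alpha> - 4) / 4" by (simp add: \<gamma>)
    then show "rellich_inequality TYPE(real ^ 'n) R \<alpha> \<gamma> 2 (((real N - \<alpha>) * (real N + \<alpha> - 4) / 4)\<^sup>2)"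
      using I[OF \<alpha>] by (simp only:)
    fix C assume C: "C > ((real N - \<alpha>) * (real N + \<alpha> - 4) / 4)\<^sup>2" and "rellich_inequality TYPE(real ^ 'n) R \<alpha> \<gamma> 2 C"
    \<comment> \<open>\<open>ennreal\<close> sends negative reals to 0, so the bound on constants is
      stated for C \<ge> 0; a competitor exceeding a square satisfies this.\<close>
    moreover have "C \<ge> 0" using C zero_le_power2 less_imp_le order_trans by blast
    ultimately have "C \<le> ((real N - \<alpha>) * (real N + \<alpha> - 4) / 4)\<^sup>2"
      using optimal_bound_I[where 'a = "real ^ 'n", OF assms(3), of \<alpha> C] \<alpha> unfolding N \<gamma> by simp
    then show False using C by simp
  qed
  have Inot: "not_attained TYPE(real ^ 'n) R \<alpha> \<gamma> 2 (((real N - \<alpha>) * (real N + \<alpha> - 4) / 4)\<^sup>2)"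
    if "4 - real N < \<alpha>" "\<alpha> \<le> real N - \<gamma>" "\<gamma> > 0" "\<gamma> = real N - \<alpha>" for \<alpha> \<gamma>
    using not_attained_I[where 'a = "real ^ 'n", OF assms(3), of \<alpha>] that unfolding N by simp
  have II: "rellich_inequality TYPE(real ^ 'n) R \<alpha> \<gamma> 4 ((3 / 4 * \<gamma>\<^sup>2)\<^sup>2)"
    "not_attained TYPE(real ^ 'n) R \<alpha> \<gamma> 4 ((3 / 4 * \<gamma>\<^sup>2)\<^sup>2)"
    if "3 \<le> \<alpha>" "\<alpha> \<le> min (real N - \<gamma> + 2) (real N - 3 * \<gamma>)" "\<gamma> > 0" for \<alpha> \<gamma>
    using rellich_inequality_II[where 'a = "real ^ 'n", OF assms(3), of \<alpha> \<gamma>] that unfolding N by simp_all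
  have IIopt: "optimal_constant TYPE(real ^ 'n) R \<alpha> \<gamma> 4 ((3 / 4 * \<gamma>\<^sup>2)\<^sup>2)"
    if \<alpha>: "3 \<le> \<alpha>" "\<alpha> \<le> min (real N - \<gamma> + 2) (real N - 3 * \<gamma>)" "\<gamma> > 0" for \<alpha> \<gamma>
    unfolding optimal_constant_def
  proof (intro conjI allI impI notI)
    show "rellich_inequality TYPE(real ^ 'n) R \<alpha> \<gamma> 4 ((3 / 4 * \<gamma>\<^sup>2)\<^sup>2)" by (rule II(1)[OF \<alpha>])
    fix C assume C: "C > (3 / 4 * \<gamma>\<^sup>2)\<^sup>2" and "rellich_inequality TYPE(real ^ 'n) R \<alpha> \<gamma> 4 C"
    moreover have "C \<ge> 0" using C zero_le_power2 less_imp_le order_trans by blast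
    ultimately have "C \<le> (3 / 4 * \<gamma>\<^sup>2)\<^sup>2"
      using optimal_bound_II[where 'a = "real ^ 'n", OF assms(3) \<alpha>(3), of \<alpha> C] assms(2) unfolding N by simp
    then show False using C by simp
  qed
  show ?thesis using I Iopt Inot II IIopt by blast
qed

end
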